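(* Let $R$ be a standard graded algebra over a field $k$, $M$ a finitely generated graded $R$-module and $x\in R$ a homogeneous form of degree $d\ge 1$. If $\operatorname{depth} M/xM\ge \dim (0:_M x)-1$ then $$\operatorname{reg} M=\max\{\operatorname{reg} (0:_M x),\ \operatorname{reg} (M/xM)-d+1\}.$$
   Context: A standard graded $k$-algebra $R$ is a commutative $\mathbb{N}$-graded ring with $R_0=k$, generated over $k$ by finitely many elements of degree $1$; $\mathfrak m$ is its graded maximal ideal. $0:_M x=\{a\in M: xa=0\}$. For a finitely generated graded $R$-module $P$, $\operatorname{reg} P=\sup\{i+j: H^i_{\mathfrak m}(P)_j\neq 0\}$ where $H^i_{\mathfrak m}$ is local cohomology, and $\operatorname{reg} 0=-\infty$. Conventions for the zero module: $\operatorname{depth} 0=+\infty$, $\dim 0=-\infty$. *)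

theory Defs
  imports "HOL-Library.Extended_Real" "HOL-Algebra.Generated_Rings" "HOL-Algebra.QuotRing" "HOL-Algebra.Module"
begin

section \<open>Modules\<close>

definition module_span ::
  "('a, 'm) ring_scheme \<Rightarrow> ('a, 'b, 'n) module_scheme \<Rightarrow> 'b set \<Rightarrow> 'b set" where
  "module_span R M V = \<Inter> {N. submodule N R M \<and> V \<subseteq> N}"

definition fin_gen_module ::
  "('a, 'm) ring_scheme \<Rightarrow> ('a, 'b, 'n) module_scheme \<Rightarrow> bool" where
  "fin_gen_module R M \<longleftrightarrow>
     module R M \<and> (\<exists>V. finite V \<and> V \<subseteq> carrier M \<and> module_span R M V = carrier M)"

text \<open>
  The record type of modules extends that of rings, so a module has two fields
  \<open>mult\<close> and \<open>one\<close> that carry no meaning. Newly constructed modules leave them undefined.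
\<close>

definition quotient_module ::
  "('a, 'm) ring_scheme \<Rightarrow> ('a, 'b, 'n) module_scheme \<Rightarrow> 'b set \<Rightarrow> ('a, 'b set) module" where
  "quotient_module R M N =
     \<lparr>carrier = a_rcosets\<^bsub>M\<^esub> N,
      mult = undefined, one = undefined,
      zero = N,
      add = set_add M,
      smult = (\<lambda>r U. \<Union>m\<in>U. N +>\<^bsub>M\<^esub> (r \<odot>\<^bsub>M\<^esub> m))\<rparr>"

definition zero_colon ::
  "('a, 'b, 'n) module_scheme \<Rightarrow> 'a \<Rightarrow> ('a, 'b, 'n) module_scheme" where
  "zero_colon M x = M\<lparr>carrier := {m \<in> carrier M. x \<odot>\<^bsub>M\<^esub> m = \<zero>\<^bsub>M\<^esub>}\<rparr>"

definition elt_smult :: "'a \<Rightarrow> ('a, 'b, 'n) module_scheme \<Rightarrow> 'b set" where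
  "elt_smult x M = (\<lambda>m. x \<odot>\<^bsub>M\<^esub> m) ` carrier M"

definition mod_elt ::
  "('a, 'm) ring_scheme \<Rightarrow> ('a, 'b, 'n) module_scheme \<Rightarrow> 'a \<Rightarrow> ('a, 'b set) module" where
  "mod_elt R M x = quotient_module R M (elt_smult x M)"


section \<open>Gradings\<close>

definition internal_direct_sum :: "('a, 'm) ring_scheme \<Rightarrow> ('i \<Rightarrow> 'a set) \<Rightarrow> bool" where
  "internal_direct_sum G A \<longleftrightarrow>
     (\<forall>i. additive_subgroup (A i) G) \<and>
     (\<forall>r\<in>carrier G. \<exists>!f. (\<forall>i. f i \<in> A i) \<and> finite {i. f i \<noteq> \<zero>\<^bsub>G\<^esub>} \<and>
        r = (\<Oplus>\<^bsub>G\<^esub>i\<in>{i. f i \<noteq> \<zero>\<^bsub>G\<^esub>}. f i))"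

locale graded_ring = cring R
  for R :: "('a, 'm) ring_scheme" (structure) and gr :: "nat \<Rightarrow> 'a set" +
  assumes grading: "internal_direct_sum R gr"
    and mult_degree: "\<lbrakk>a \<in> gr i; b \<in> gr j\<rbrakk> \<Longrightarrow> a \<otimes> b \<in> gr (i + j)"

locale standard_graded_algebra = graded_ring R gr + subfield k R
  for k and R :: "('a, 'm) ring_scheme" (structure) and gr +
  assumes degree_zero: "gr 0 = k"
    and generated_degree_one: "\<exists>U. finite U \<and> U \<subseteq> gr 1 \<and> generate_ring R (k \<union> U) = carrier R"

locale graded_module = graded_ring R gr + module R M
  for R :: "('a, 'm) ring_scheme" (structure) and gr
    and M :: "('a, 'b, 'n) module_scheme" (structure) and gm :: "int \<Rightarrow> 'b set" +
  assumes module_grading: "internal_direct_sum M gm"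
    and smult_degree: "\<lbrakk>a \<in> gr i; m \<in> gm j\<rbrakk> \<Longrightarrow> a \<odot>\<^bsub>M\<^esub> m \<in> gm (int i + j)"

definition irrelevant_ideal :: "('a, 'm) ring_scheme \<Rightarrow> (nat \<Rightarrow> 'a set) \<Rightarrow> 'a set" where
  "irrelevant_ideal R gr = Idl\<^bsub>R\<^esub> (\<Union>i\<in>{1..}. gr i)"

definition zero_colon_grading ::
  "('a, 'b, 'n) module_scheme \<Rightarrow> (int \<Rightarrow> 'b set) \<Rightarrow> 'a \<Rightarrow> int \<Rightarrow> 'b set" where
  "zero_colon_grading M gm x j = gm j \<inter> carrier (zero_colon M x)"

definition quotient_grading ::
  "('a, 'b, 'n) module_scheme \<Rightarrow> (int \<Rightarrow> 'b set) \<Rightarrow> 'b set \<Rightarrow> int \<Rightarrow> 'b set set" where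
  "quotient_grading M gm N j = (\<lambda>m. N +>\<^bsub>M\<^esub> m) ` gm j"

definition mod_elt_grading ::
  "('a, 'b, 'n) module_scheme \<Rightarrow> (int \<Rightarrow> 'b set) \<Rightarrow> 'a \<Rightarrow> int \<Rightarrow> 'b set set" where
  "mod_elt_grading M gm x = quotient_grading M gm (elt_smult x M)"


section \<open>Krull dimension and depth\<close>

text \<open>The supremum over the empty set is \<open>-\<infinity>\<close>, so the zero ring has dimension \<open>-\<infinity>\<close>.\<close>

definition krull_dim :: "('a, 'm) ring_scheme \<Rightarrow> ereal" where
  "krull_dim R = Sup {ereal (real n) | n.
     \<exists>P. (\<forall>i\<le>n. primeideal (P i) R) \<and> (\<forall>i<n. P i \<subset> P (Suc i))}"

definition module_ann ::
  "('a, 'm) ring_scheme \<Rightarrow> ('a, 'b, 'n) module_scheme \<Rightarrow> 'a set" where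
  "module_ann R M = {r \<in> carrier R. \<forall>m\<in>carrier M. r \<odot>\<^bsub>M\<^esub> m = \<zero>\<^bsub>M\<^esub>}"

definition module_dim ::
  "('a, 'm) ring_scheme \<Rightarrow> ('a, 'b, 'n) module_scheme \<Rightarrow> ereal" where
  "module_dim R M = krull_dim (R Quot (module_ann R M))"

definition seq_smult ::
  "('a, 'm) ring_scheme \<Rightarrow> ('a, 'b, 'n) module_scheme \<Rightarrow> 'a list \<Rightarrow> 'b set" where
  "seq_smult R M ys = module_span R M {y \<odot>\<^bsub>M\<^esub> m | y m. y \<in> set ys \<and> m \<in> carrier M}"

definition regular_sequence ::
  "('a, 'm) ring_scheme \<Rightarrow> ('a, 'b, 'n) module_scheme \<Rightarrow> 'a list \<Rightarrow> bool" where
  "regular_sequence R M ys \<longleftrightarrow>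
     set ys \<subseteq> carrier R \<and> seq_smult R M ys \<noteq> carrier M \<and>
     (\<forall>i<length ys. let Q = quotient_module R M (seq_smult R M (take i ys)) in
        \<forall>z\<in>carrier Q. (ys ! i) \<odot>\<^bsub>Q\<^esub> z = \<zero>\<^bsub>Q\<^esub> \<longrightarrow> z = \<zero>\<^bsub>Q\<^esub>)"

definition module_depth ::
  "('a, 'm) ring_scheme \<Rightarrow> (nat \<Rightarrow> 'a set) \<Rightarrow> ('a, 'b, 'n) module_scheme \<Rightarrow> ereal" where
  "module_depth R gr M =
     (if carrier M = {\<zero>\<^bsub>M\<^esub>} then \<infinity>
      else Sup {ereal (real (length ys)) | ys.
        set ys \<subseteq> irrelevant_ideal R gr \<and> regular_sequence R M ys})"


section \<open>Localization at the powers of an element\<close>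

text \<open>The pair \<open>(m, t)\<close> stands for the fraction \<open>m / f\<^sup>t\<close>.\<close>

definition loc_rel ::
  "('a, 'm) ring_scheme \<Rightarrow> ('a, 'b, 'n) module_scheme \<Rightarrow> 'a \<Rightarrow> (('b \<times> nat) \<times> ('b \<times> nat)) set" where
  "loc_rel R M f = {((m, t), (m', t')). m \<in> carrier M \<and> m' \<in> carrier M \<and>
     (\<exists>s::nat. (f [^]\<^bsub>R\<^esub> (s + t')) \<odot>\<^bsub>M\<^esub> m = (f [^]\<^bsub>R\<^esub> (s + t)) \<odot>\<^bsub>M\<^esub> m')}"

definition loc_frac ::
  "('a, 'm) ring_scheme \<Rightarrow> ('a, 'b, 'n) module_scheme \<Rightarrow> 'a \<Rightarrow> 'b \<Rightarrow> nat \<Rightarrow> ('b \<times> nat) set" where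
  "loc_frac R M f m t = loc_rel R M f `` {(m, t)}"

definition localization ::
  "('a, 'm) ring_scheme \<Rightarrow> ('a, 'b, 'n) module_scheme \<Rightarrow> 'a \<Rightarrow> ('a, ('b \<times> nat) set) module" where
  "localization R M f =
     \<lparr>carrier = {loc_frac R M f m t | m t. m \<in> carrier M},
      mult = undefined, one = undefined,
      zero = loc_frac R M f \<zero>\<^bsub>M\<^esub> 0,
      add = (\<lambda>U V. \<Union>(m, t)\<in>U. \<Union>(m', t')\<in>V.
        loc_frac R M f ((f [^]\<^bsub>R\<^esub> t') \<odot>\<^bsub>M\<^esub> m \<oplus>\<^bsub>M\<^esub> (f [^]\<^bsub>R\<^esub> t) \<odot>\<^bsub>M\<^esub> m') (t + t')),
      smult = (\<lambda>r U. \<Union>(m, t)\<in>U. loc_frac R M f (r \<odot>\<^bsub>M\<^esub> m) t)\<rparr>"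

text \<open>The canonical map from \<open>M\<^sub>f\<close> to \<open>M\<^bsub>fg\<^esub>\<close>, which sends \<open>m / f\<^sup>t\<close> to \<open>g\<^sup>t m / (fg)\<^sup>t\<close>.\<close>

definition loc_map ::
  "('a, 'm) ring_scheme \<Rightarrow> ('a, 'b, 'n) module_scheme \<Rightarrow> 'a \<Rightarrow> 'a \<Rightarrow>
     ('b \<times> nat) set \<Rightarrow> ('b \<times> nat) set" where
  "loc_map R M f g U =
     (\<Union>(m, t)\<in>U. loc_frac R M (f \<otimes>\<^bsub>R\<^esub> g) ((g [^]\<^bsub>R\<^esub> t) \<odot>\<^bsub>M\<^esub> m) t)"


section \<open>The Cech complex\<close>

text \<open>
  For a sequence \<open>xs\<close> of elements of \<open>R\<close>, the module of \<open>p\<close>-cochains is the direct sum of the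
  localizations of \<open>M\<close> at the products \<open>x\<^sub>S\<close>, where \<open>S\<close> runs through the sets of \<open>p\<close> positions
  in \<open>xs\<close>. There are finitely many such \<open>S\<close>, so a cochain is an extensional function of \<open>S\<close>.
\<close>

definition cech_index :: "'a list \<Rightarrow> nat \<Rightarrow> nat set set" where
  "cech_index xs p = {S. S \<subseteq> {..<length xs} \<and> card S = p}"

definition cech_elt :: "('a, 'm) ring_scheme \<Rightarrow> 'a list \<Rightarrow> nat set \<Rightarrow> 'a" where
  "cech_elt R xs S = (\<Otimes>\<^bsub>R\<^esub>i\<in>S. xs ! i)"

abbreviation cech_loc ::
  "('a, 'm) ring_scheme \<Rightarrow> ('a, 'b, 'n) module_scheme \<Rightarrow> 'a list \<Rightarrow> nat set \<Rightarrow>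
     ('a, ('b \<times> nat) set) module" where
  "cech_loc R M xs S \<equiv> localization R M (cech_elt R xs S)"

definition cech_cochains ::
  "('a, 'm) ring_scheme \<Rightarrow> ('a, 'b, 'n) module_scheme \<Rightarrow> 'a list \<Rightarrow> nat \<Rightarrow>
     ('a, nat set \<Rightarrow> ('b \<times> nat) set) module" where
  "cech_cochains R M xs p =
     \<lparr>carrier = (\<Pi>\<^sub>E S\<in>cech_index xs p. carrier (cech_loc R M xs S)),
      mult = undefined, one = undefined,
      zero = (\<lambda>S\<in>cech_index xs p. \<zero>\<^bsub>cech_loc R M xs S\<^esub>),
      add = (\<lambda>c c'. \<lambda>S\<in>cech_index xs p. c S \<oplus>\<^bsub>cech_loc R M xs S\<^esub> c' S),
      smult = (\<lambda>r c. \<lambda>S\<in>cech_index xs p. r \<odot>\<^bsub>cech_loc R M xs S\<^esub> c S)\<rparr>"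

definition cech_diff ::
  "('a, 'm) ring_scheme \<Rightarrow> ('a, 'b, 'n) module_scheme \<Rightarrow> 'a list \<Rightarrow> nat \<Rightarrow>
     (nat set \<Rightarrow> ('b \<times> nat) set) \<Rightarrow> nat set \<Rightarrow> ('b \<times> nat) set" where
  "cech_diff R M xs p c =
     (\<lambda>S\<in>cech_index xs (Suc p).
        \<Oplus>\<^bsub>cech_loc R M xs S\<^esub>i\<in>S.
          ((\<ominus>\<^bsub>R\<^esub> \<one>\<^bsub>R\<^esub>) [^]\<^bsub>R\<^esub> card {j \<in> S. j < i}) \<odot>\<^bsub>cech_loc R M xs S\<^esub>
            loc_map R M (cech_elt R xs (S - {i})) (xs ! i) (c (S - {i})))"

definition cech_cocycles ::
  "('a, 'm) ring_scheme \<Rightarrow> ('a, 'b, 'n) module_scheme \<Rightarrow> 'a list \<Rightarrow> nat \<Rightarrow>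
     (nat set \<Rightarrow> ('b \<times> nat) set) set" where
  "cech_cocycles R M xs p =
     {c \<in> carrier (cech_cochains R M xs p).
        cech_diff R M xs p c = \<zero>\<^bsub>cech_cochains R M xs (Suc p)\<^esub>}"

definition cech_coboundaries ::
  "('a, 'm) ring_scheme \<Rightarrow> ('a, 'b, 'n) module_scheme \<Rightarrow> 'a list \<Rightarrow> nat \<Rightarrow>
     (nat set \<Rightarrow> ('b \<times> nat) set) set" where
  "cech_coboundaries R M xs p =
     (case p of 0 \<Rightarrow> {\<zero>\<^bsub>cech_cochains R M xs 0\<^esub>}
      | Suc q \<Rightarrow> cech_diff R M xs q ` carrier (cech_cochains R M xs q))"

definition cech_cocycle_module ::
  "('a, 'm) ring_scheme \<Rightarrow> ('a, 'b, 'n) module_scheme \<Rightarrow> 'a list \<Rightarrow> nat \<Rightarrow>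
     ('a, nat set \<Rightarrow> ('b \<times> nat) set) module" where
  "cech_cocycle_module R M xs p =
     (cech_cochains R M xs p)\<lparr>carrier := cech_cocycles R M xs p\<rparr>"

definition cech_cohomology ::
  "('a, 'm) ring_scheme \<Rightarrow> ('a, 'b, 'n) module_scheme \<Rightarrow> 'a list \<Rightarrow> nat \<Rightarrow>
     ('a, (nat set \<Rightarrow> ('b \<times> nat) set) set) module" where
  "cech_cohomology R M xs p =
     quotient_module R (cech_cocycle_module R M xs p) (cech_coboundaries R M xs p)"

text \<open>
  The gradings below are for \<open>xs\<close> of degree 1: then \<open>x\<^sub>S\<close> has degree \<open>p = card S\<close>,
  and \<open>m / x\<^sub>S\<^sup>t\<close> has degree \<open>deg m - t p\<close>.
\<close>

definition cech_cocycle_grading ::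
  "('a, 'm) ring_scheme \<Rightarrow> ('a, 'b, 'n) module_scheme \<Rightarrow> (int \<Rightarrow> 'b set) \<Rightarrow> 'a list \<Rightarrow> nat \<Rightarrow>
     int \<Rightarrow> (nat set \<Rightarrow> ('b \<times> nat) set) set" where
  "cech_cocycle_grading R M gm xs p j =
     {c \<in> cech_cocycles R M xs p. \<forall>S\<in>cech_index xs p.
        \<exists>t m. m \<in> gm (j + int (t * p)) \<and> c S = loc_frac R M (cech_elt R xs S) m t}"

definition cech_cohomology_grading ::
  "('a, 'm) ring_scheme \<Rightarrow> ('a, 'b, 'n) module_scheme \<Rightarrow> (int \<Rightarrow> 'b set) \<Rightarrow> 'a list \<Rightarrow> nat \<Rightarrow>
     int \<Rightarrow> (nat set \<Rightarrow> ('b \<times> nat) set) set set" where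
  "cech_cohomology_grading R M gm xs p =
     quotient_grading (cech_cocycle_module R M xs p) (cech_cocycle_grading R M gm xs p)
       (cech_coboundaries R M xs p)"


section \<open>Local cohomology and regularity\<close>

text \<open>
  Local cohomology with support in the graded maximal ideal is the cohomology of the Cech
  complex on generators of that ideal. Up to isomorphism of graded modules it does not depend on
  the generators. A finite list of generators of degree 1 exists for every standard graded
  algebra, and the one that is chosen depends on the graded ring only, not on the module.
\<close>

definition irrelevant_gens :: "('a, 'm) ring_scheme \<Rightarrow> (nat \<Rightarrow> 'a set) \<Rightarrow> 'a list" where
  "irrelevant_gens R gr =
     (SOME xs. set xs \<subseteq> gr 1 \<and> Idl\<^bsub>R\<^esub> (set xs) = irrelevant_ideal R gr)"

definition local_cohomology ::
  "('a, 'm) ring_scheme \<Rightarrow> (nat \<Rightarrow> 'a set) \<Rightarrow> ('a, 'b, 'n) module_scheme \<Rightarrow> nat \<Rightarrow>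
     ('a, (nat set \<Rightarrow> ('b \<times> nat) set) set) module" where
  "local_cohomology R gr M i = cech_cohomology R M (irrelevant_gens R gr) i"

definition local_cohomology_grading ::
  "('a, 'm) ring_scheme \<Rightarrow> (nat \<Rightarrow> 'a set) \<Rightarrow> ('a, 'b, 'n) module_scheme \<Rightarrow> (int \<Rightarrow> 'b set) \<Rightarrow>
     nat \<Rightarrow> int \<Rightarrow> (nat set \<Rightarrow> ('b \<times> nat) set) set set" where
  "local_cohomology_grading R gr M gm i =
     cech_cohomology_grading R M gm (irrelevant_gens R gr) i"

definition regularity ::
  "('a, 'm) ring_scheme \<Rightarrow> (nat \<Rightarrow> 'a set) \<Rightarrow> ('a, 'b, 'n) module_scheme \<Rightarrow> (int \<Rightarrow> 'b set) \<Rightarrow>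
     ereal" where
  "regularity R gr M gm =
     Sup {ereal (real i + real_of_int j) | i j.
       local_cohomology_grading R gr M gm i j \<noteq> {\<zero>\<^bsub>local_cohomology R gr M i\<^esub>}}"

end

theory Submission
  imports Defs
begin

text \<open>
  Put \<open>K = 0 :\<^sub>M x\<close>. The exact sequences \<open>0 \<rightarrow> K \<rightarrow> M \<rightarrow> xM \<rightarrow> 0\<close> and \<open>0 \<rightarrow> xM \<rightarrow> M \<rightarrow> M/xM \<rightarrow> 0\<close>, the first of which
  shifts degrees by \<open>d\<close> on the right, give long exact sequences of local cohomology. Above the
  claimed maximum, multiplication by \<open>x\<close> is injective on \<open>H\<^sup>i(M)\<close>, in degree \<open>j\<close> and in all degrees
  \<open>j + kd\<close>. But every class is killed by a power of \<open>x\<close>, so \<open>H\<^sup>i(M)\<close> vanishes there, and this half needs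
  no hypothesis on depth. For the converse the obstruction to \<open>reg K \<le> reg M\<close> is a map from
  \<open>H\<^sup>i\<^sup>-\<^sup>2(M/xM)\<close> towards \<open>H\<^sup>i(K)\<close>. By the vanishing of local cohomology above the dimension and below
  the depth, the hypothesis makes one of these two modules zero for every \<open>i\<close>. Then
  \<open>reg (M/xM) \<le> reg M + d - 1\<close> follows from the same sequences.
\<close>

section \<open>Koszul cochains\<close>

text \<open>No cohomology module is formed. Each exact sequence is used only to pass from the
  vanishing of two of its terms to that of the third, so a predicate for the vanishing of H^i(L/N)_j
  suffices, and connecting homomorphisms appear as corrections of cochains. The obstructing map is a
  composite of two of them, H^(i-2)(M/xM)_(j+d) -> H^(i-1)(xM)_(j+d) = H^(i-1)(M/K)_j -> H^i(K)_j,
  where multiplication by x identifies M/K with xM and raises degrees by d. The index i - 2 is what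
  pairs with the -1 in the hypothesis: if i <= dim K, then i - 2 < dim K - 1 <= depth M/xM. The
  constant 1 - d comes from the injectivity half: the kernel of x on H^i(M)_j is controlled by
  H^i(K)_j and H^(i-1)(M/xM)_(j+d), and (i-1) + (j+d) exceeds i + j by d - 1. The vanishing theorems
  above the dimension and below the depth do not see the grading, and both rest on the torsion
  argument of the first half, applied to a nonzerodivisor.\<close>

lemma (in abelian_group) finsum_antisym_pairs:
  assumes "finite S"
    and "\<And>i j. i \<in> S \<Longrightarrow> j \<in> S \<Longrightarrow> i \<noteq> j \<Longrightarrow> F i j \<in> carrier G"
    and "\<And>i j. i \<in> S \<Longrightarrow> j \<in> S \<Longrightarrow> i \<noteq> j \<Longrightarrow> F i j \<oplus> F j i = \<zero>"
  shows "(\<Oplus>i\<in>S. \<Oplus>j\<in>S - {i}. F i j) = \<zero>"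
  using assms
proof (induction S rule: finite_induct)
  case empty
  then show ?case by simp
next
  case (insert a S)
  have C: "F i j \<in> carrier G" if "i \<in> insert a S" "j \<in> insert a S" "i \<noteq> j" for i j
    using insert.prems(1) that by blast
  have inner: "(\<Oplus>j\<in>insert a S - {i}. F i j) = F i a \<oplus> (\<Oplus>j\<in>S - {i}. F i j)" if "i \<in> S" for i
  proof -
    have "insert a S - {i} = insert a (S - {i})" using that insert.hyps by auto
    then show ?thesis using insert.hyps that C by (auto intro!: finsum_insert)
  qed
  have outer_a: "(\<Oplus>j\<in>insert a S - {a}. F a j) = (\<Oplus>j\<in>S. F a j)"
    using insert.hyps by simp
  have ia: "F i a \<in> carrier G" "F a i \<in> carrier G" if "i \<in> S" for i
    using that insert.hyps C by auto
  have cl: "(\<Oplus>j\<in>S - {i}. F i j) \<in> carrier G" if "i \<in> S" for i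
    using that C by (auto intro!: finsum_closed)
  have "(\<Oplus>i\<in>insert a S. \<Oplus>j\<in>insert a S - {i}. F i j)
      = (\<Oplus>j\<in>S. F a j) \<oplus> (\<Oplus>i\<in>S. \<Oplus>j\<in>insert a S - {i}. F i j)"
    using insert.hyps inner ia cl
    by (subst finsum_insert) (auto simp: outer_a intro!: finsum_closed)
  also have "(\<Oplus>i\<in>S. \<Oplus>j\<in>insert a S - {i}. F i j) = (\<Oplus>i\<in>S. F i a \<oplus> (\<Oplus>j\<in>S - {i}. F i j))"
    using inner ia cl by (intro finsum_cong') auto
  also have "\<dots> = (\<Oplus>i\<in>S. F i a) \<oplus> (\<Oplus>i\<in>S. \<Oplus>j\<in>S - {i}. F i j)"
    using ia cl by (intro finsum_addf) auto
  also have "(\<Oplus>i\<in>S. \<Oplus>j\<in>S - {i}. F i j) = \<zero>"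
    by (rule insert.IH) (use insert.prems in auto)
  \<comment> \<open>The new index \<open>a\<close> contributes one row and one column, which cancel
    entry by entry.\<close>
  also have "(\<Oplus>j\<in>S. F a j) \<oplus> ((\<Oplus>i\<in>S. F i a) \<oplus> \<zero>) = (\<Oplus>i\<in>S. F a i \<oplus> F i a)"
    using ia by (simp add: finsum_addf Pi_def finsum_closed)
  also have "\<dots> = \<zero>"
    using insert.prems(2) insert.hyps by (intro add.finprod_one_eqI) auto
  finally show ?case .
qed

definition koszul_sign :: "('a, 'm) ring_scheme \<Rightarrow> nat set \<Rightarrow> nat \<Rightarrow> 'a" where
  "koszul_sign R S i = (\<ominus>\<^bsub>R\<^esub> \<one>\<^bsub>R\<^esub>) [^]\<^bsub>R\<^esub> card {j \<in> S. j < i}"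

lemma (in cring) koszul_sign_closed [simp]: "koszul_sign R S i \<in> carrier R"
  by (simp add: koszul_sign_def)

lemma (in cring) koszul_sign_sq: "koszul_sign R S i \<otimes> koszul_sign R S i = \<one>"
proof -
  have "(\<ominus> \<one>) \<otimes> (\<ominus> \<one>) = \<one>" by (simp add: r_minus l_minus)
  then show ?thesis
    by (simp add: koszul_sign_def flip: nat_pow_distrib)
qed

text \<open>Deleting the smaller of two indices lowers the count below the larger one by one, while
  deleting the larger one leaves the count below the smaller unchanged. So exactly one of the two
  signs flips.\<close>

lemma (in cring) koszul_sign_swap:
  assumes "finite S" "i \<in> S" "j \<in> S" "i \<noteq> j"
  shows "koszul_sign R S i \<otimes> koszul_sign R (S - {i}) j =
    \<ominus> (koszul_sign R S j \<otimes> koszul_sign R (S - {j}) i)"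
proof -
  have *: "koszul_sign R S i \<otimes> koszul_sign R (S - {i}) j =
    \<ominus> (koszul_sign R S j \<otimes> koszul_sign R (S - {j}) i)"
    if ij: "i \<in> S" "j \<in> S" "i < j" for i j
  proof -
    have "{l \<in> S - {j}. l < i} = {l \<in> S. l < i}" using ij by auto
    then have 1: "koszul_sign R (S - {j}) i = koszul_sign R S i" by (simp add: koszul_sign_def)
    have "{l \<in> S. l < j} = insert i {l \<in> S - {i}. l < j}" using ij by auto
    then have "card {l \<in> S. l < j} = Suc (card {l \<in> S - {i}. l < j})"
      using assms(1) by simp
    then have 2: "koszul_sign R S j = \<ominus> koszul_sign R (S - {i}) j"
      by (simp add: koszul_sign_def r_minus l_minus)
    show ?thesis unfolding 1 2 by (simp add: l_minus r_minus m_comm)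
  qed
  show ?thesis
  proof (cases "i < j")
    case True then show ?thesis using * assms by blast
  next
    case False
    then have "koszul_sign R S j \<otimes> koszul_sign R (S - {j}) i =
      \<ominus> (koszul_sign R S i \<otimes> koszul_sign R (S - {i}) j)" using * assms by auto
    then show ?thesis by simp
  qed
qed

locale koszul = module R M
  for R :: "('a, 'm) ring_scheme" (structure) and M :: "('a, 'b, 'n) module_scheme" (structure) +
  fixes xs :: "'a list"
  assumes xs_closed: "set xs \<subseteq> carrier R"
begin

text \<open>The size \<open>p\<close> is an integer, so that cochains in the degrees \<open>p - 1\<close> and \<open>p - 2\<close> need no case distinction.\<close>

definition idx :: "int \<Rightarrow> nat set set" where
  "idx p = {S. S \<subseteq> {..<length xs} \<and> int (card S) = p}"

definition xprod :: "nat set \<Rightarrow> 'a" where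
  "xprod S = (\<Otimes>i\<in>S. xs ! i)"

text \<open>This is the Cech differential on numerators. For fractions with denominators
  \<open>xprod T [^] t\<close>, passing from \<open>S - {i}\<close> to \<open>S\<close> enlarges the
  denominator by the factor x_i^t, which therefore appears in the numerator.\<close>

definition koszul_diff :: "nat \<Rightarrow> (nat set \<Rightarrow> 'b) \<Rightarrow> nat set \<Rightarrow> 'b" where
  "koszul_diff t m S = (\<Oplus>\<^bsub>M\<^esub>i\<in>S. (koszul_sign R S i \<otimes> (xs ! i) [^] t) \<odot>\<^bsub>M\<^esub> m (S - {i}))"

lemma nth_closed: "S \<subseteq> {..<length xs} \<Longrightarrow> i \<in> S \<Longrightarrow> xs ! i \<in> carrier R"
  using xs_closed by (metis lessThan_iff nth_mem subsetD)

lemma idx_finite: "S \<in> idx p \<Longrightarrow> finite S"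
  by (auto simp: idx_def intro: finite_subset)

lemma idx_nth_closed: "S \<in> idx p \<Longrightarrow> i \<in> S \<Longrightarrow> xs ! i \<in> carrier R"
  by (auto simp: idx_def dest: nth_closed)

lemma finite_idx: "finite (idx p)"
  by (rule finite_subset[of _ "Pow {..<length xs}"]) (auto simp: idx_def)

lemma idx_diff: "S \<in> idx p \<Longrightarrow> i \<in> S \<Longrightarrow> S - {i} \<in> idx (p - 1)"
  using idx_finite[of S p] by (cases "card S") (auto simp: idx_def)

lemma idx_insert: "S \<in> idx p \<Longrightarrow> i < length xs \<Longrightarrow> i \<notin> S \<Longrightarrow> insert i S \<in> idx (p + 1)"
  using idx_finite[of S p] by (auto simp: idx_def)

lemma idx_neg: "p < 0 \<Longrightarrow> idx p = {}"
  by (auto simp: idx_def)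

lemma xprod_closed: "S \<in> idx p \<Longrightarrow> xprod S \<in> carrier R"
  unfolding xprod_def by (intro R.finprod_closed) (auto intro: idx_nth_closed)

lemma xprod_remove: "S \<in> idx p \<Longrightarrow> i \<in> S \<Longrightarrow> xprod S = xprod (S - {i}) \<otimes> xs ! i"
proof -
  assume a: "S \<in> idx p" "i \<in> S"
  have "xprod S = xprod (insert i (S - {i}))" using a by (simp add: insert_absorb)
  also have "\<dots> = xs ! i \<otimes> xprod (S - {i})"
    unfolding xprod_def using a idx_finite[of S p]
    by (intro R.finprod_insert) (auto intro: idx_nth_closed)
  finally show ?thesis using a idx_diff[of S p i] xprod_closed idx_nth_closed
    by (metis m_comm)
qed

lemma koszul_diff_term_closed:
  fixes t :: nat
  assumes "S \<in> idx p" "i \<in> S" "\<And>T. T \<in> idx (p - 1) \<Longrightarrow> m T \<in> carrier M"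
  shows "(koszul_sign R S i \<otimes> (xs ! i) [^] t) \<odot>\<^bsub>M\<^esub> m (S - {i}) \<in> carrier M"
  using idx_nth_closed[OF assms(1,2)] assms(3)[OF idx_diff[OF assms(1,2)]] by simp

lemma koszul_diff_closed:
  assumes "S \<in> idx p" "\<And>T. T \<in> idx (p - 1) \<Longrightarrow> m T \<in> carrier M"
  shows "koszul_diff t m S \<in> carrier M"
  unfolding koszul_diff_def using assms koszul_diff_term_closed[of S p _ m] by (auto intro!: M.finsum_closed)

lemma finsum_in_submodule:
  assumes N: "submodule N R M" and f: "\<And>i. i \<in> A \<Longrightarrow> f i \<in> N"
  shows "(\<Oplus>\<^bsub>M\<^esub>i\<in>A. f i) \<in> N"
proof (cases "finite A")
  case True
  then show ?thesis using f
  proof (induction A rule: finite_induct)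
    case empty then show ?case using submoduleE(2)[OF N] submodule.axioms(1)[OF N]
        subgroup.one_closed by fastforce
  next
    case (insert a A)
    have "f i \<in> carrier M" if "i \<in> insert a A" for i using insert.prems that submoduleE(1)[OF N] by auto
    then show ?case using insert by (simp add: Pi_def M.finsum_insert submoduleE(5)[OF N])
  qed
next
  \<comment> \<open>A sum over an infinite set is zero by convention.\<close>
  case False
  then show ?thesis using submodule.axioms(1)[OF N] subgroup.one_closed M.add.finprod_infinite by fastforce
qed

lemma koszul_diff_in_submodule:
  assumes N: "submodule N R M" and S: "S \<in> idx p" and m: "\<And>T. T \<in> idx (p - 1) \<Longrightarrow> m T \<in> N"
  shows "koszul_diff t m S \<in> N"
  unfolding koszul_diff_def
  using S m idx_diff[OF S] idx_nth_closed[OF S]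
  by (auto intro!: finsum_in_submodule[OF N] submoduleE(4)[OF N] R.m_closed R.nat_pow_closed)

lemma koszul_diff_cong: "(\<And>T. T \<in> idx (p - 1) \<Longrightarrow> m T = m' T) \<Longrightarrow> (\<And>T. T \<in> idx (p - 1) \<Longrightarrow> m' T \<in> carrier M) \<Longrightarrow>
    S \<in> idx p \<Longrightarrow> koszul_diff t m S = koszul_diff t m' S"
  unfolding koszul_diff_def using koszul_diff_term_closed[of S p _ m'] idx_diff
  by (intro M.finsum_cong') auto

lemma finsum_smult:
  assumes "finite A" "r \<in> carrier R" "\<And>i. i \<in> A \<Longrightarrow> f i \<in> carrier M"
  shows "r \<odot>\<^bsub>M\<^esub> (\<Oplus>\<^bsub>M\<^esub>i\<in>A. f i) = (\<Oplus>\<^bsub>M\<^esub>i\<in>A. r \<odot>\<^bsub>M\<^esub> f i)"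
  using assms by (induction A rule: finite_induct) (auto simp: smult_r_distr M.finsum_insert Pi_def)

lemma koszul_diff_add:
  assumes "S \<in> idx p" "\<And>T. T \<in> idx (p - 1) \<Longrightarrow> m T \<in> carrier M" "\<And>T. T \<in> idx (p - 1) \<Longrightarrow> m' T \<in> carrier M"
  shows "koszul_diff t (\<lambda>T. m T \<oplus>\<^bsub>M\<^esub> m' T) S = koszul_diff t m S \<oplus>\<^bsub>M\<^esub> koszul_diff t m' S"
proof -
  have "koszul_diff t (\<lambda>T. m T \<oplus>\<^bsub>M\<^esub> m' T) S = (\<Oplus>\<^bsub>M\<^esub>i\<in>S. (koszul_sign R S i \<otimes> (xs ! i) [^] t) \<odot>\<^bsub>M\<^esub> m (S - {i})
     \<oplus>\<^bsub>M\<^esub> (koszul_sign R S i \<otimes> (xs ! i) [^] t) \<odot>\<^bsub>M\<^esub> m' (S - {i}))"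
    unfolding koszul_diff_def
    using koszul_diff_term_closed[of S p _ m] koszul_diff_term_closed[of S p _ m']
      assms idx_diff[OF assms(1)] idx_nth_closed[OF assms(1)]
    by (intro M.finsum_cong') (auto simp: smult_r_distr)
  also have "\<dots> = koszul_diff t m S \<oplus>\<^bsub>M\<^esub> koszul_diff t m' S" unfolding koszul_diff_def
    using assms koszul_diff_term_closed[of S p _ m] koszul_diff_term_closed[of S p _ m']
    by (intro M.finsum_addf) auto
  finally show ?thesis .
qed

lemma koszul_diff_smult:
  assumes "S \<in> idx p" "\<And>T. T \<in> idx (p - 1) \<Longrightarrow> m T \<in> carrier M" "r \<in> carrier R"
  shows "koszul_diff t (\<lambda>T. r \<odot>\<^bsub>M\<^esub> m T) S = r \<odot>\<^bsub>M\<^esub> koszul_diff t m S"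
proof -
  have *: "(koszul_sign R S i \<otimes> (xs ! i) [^] t) \<odot>\<^bsub>M\<^esub> (r \<odot>\<^bsub>M\<^esub> m (S - {i})) =
     r \<odot>\<^bsub>M\<^esub> ((koszul_sign R S i \<otimes> (xs ! i) [^] t) \<odot>\<^bsub>M\<^esub> m (S - {i}))" if "i \<in> S" for i
    using that assms idx_diff[OF assms(1)] idx_nth_closed[OF assms(1)]
    by (simp add: m_comm flip: smult_assoc1)
  show ?thesis unfolding koszul_diff_def
    using koszul_diff_term_closed[of S p _ m] assms idx_finite
    by (subst finsum_smult) (auto simp: * intro!: M.finsum_cong')
qed

lemma koszul_diff_minus:
  assumes "S \<in> idx p" "\<And>T. T \<in> idx (p - 1) \<Longrightarrow> m T \<in> carrier M" "\<And>T. T \<in> idx (p - 1) \<Longrightarrow> m' T \<in> carrier M"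
  shows "koszul_diff t (\<lambda>T. m T \<ominus>\<^bsub>M\<^esub> m' T) S = koszul_diff t m S \<ominus>\<^bsub>M\<^esub> koszul_diff t m' S"
proof -
  have "koszul_diff t (\<lambda>T. m T \<ominus>\<^bsub>M\<^esub> m' T) S = koszul_diff t (\<lambda>T. m T \<oplus>\<^bsub>M\<^esub> (\<ominus> \<one>) \<odot>\<^bsub>M\<^esub> m' T) S"
    by (rule koszul_diff_cong[OF _ _ assms(1)]) (auto simp: assms smult_l_minus M.minus_eq)
  also have "\<dots> = koszul_diff t m S \<oplus>\<^bsub>M\<^esub> (\<ominus> \<one>) \<odot>\<^bsub>M\<^esub> koszul_diff t m' S"
    using assms by (simp add: koszul_diff_add koszul_diff_smult)
  finally show ?thesis using koszul_diff_closed[OF assms(1,3)] by (simp add: smult_l_minus M.minus_eq)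
qed

text \<open>The factor \<open>xprod S [^] u\<close> splits for each \<open>i\<close> into the power
  of \<open>xprod (S - {i})\<close>, which goes into the cochain, and x_i^u, which raises the
  exponent of the differential. Thus the transition maps between stages are cochain maps.\<close>

lemma xprod_pow_koszul_diff:
  assumes "S \<in> idx p" "\<And>T. T \<in> idx (p - 1) \<Longrightarrow> m T \<in> carrier M"
  shows "xprod S [^] u \<odot>\<^bsub>M\<^esub> koszul_diff t m S = koszul_diff (t + u) (\<lambda>T. xprod T [^] u \<odot>\<^bsub>M\<^esub> m T) S"
proof -
  have *: "xprod S [^] u \<odot>\<^bsub>M\<^esub> ((koszul_sign R S i \<otimes> (xs ! i) [^] t) \<odot>\<^bsub>M\<^esub> m (S - {i})) =
     (koszul_sign R S i \<otimes> (xs ! i) [^] (t + u)) \<odot>\<^bsub>M\<^esub> (xprod (S - {i}) [^] u \<odot>\<^bsub>M\<^esub> m (S - {i}))"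
    if "i \<in> S" for i
  proof -
    have c: "xs ! i \<in> carrier R" "xprod (S - {i}) \<in> carrier R" "m (S - {i}) \<in> carrier M"
      using assms that idx_diff idx_nth_closed xprod_closed by blast+
    have "xprod S [^] u \<otimes> (koszul_sign R S i \<otimes> (xs ! i) [^] t) =
      (koszul_sign R S i \<otimes> (xs ! i) [^] (t + u)) \<otimes> xprod (S - {i}) [^] u"
      using c by (simp add: xprod_remove[OF assms(1) that] nat_pow_distrib m_ac flip: nat_pow_mult)
    then show ?thesis using c xprod_closed[OF assms(1)] by (simp flip: smult_assoc1)
  qed
  have c2: "xprod T [^] u \<odot>\<^bsub>M\<^esub> m T \<in> carrier M" if "T \<in> idx (p - 1)" for T
    using that assms xprod_closed by simp
  show ?thesis unfolding koszul_diff_def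
    using koszul_diff_term_closed[of S p _ m] koszul_diff_term_closed[of S p _ "\<lambda>T. xprod T [^] u \<odot>\<^bsub>M\<^esub> m T"]  c2 assms idx_finite
    by (subst finsum_smult) (auto simp: * xprod_closed intro!: M.finsum_cong')
qed

text \<open>In the double sum the summands for (i, j) and (j, i) involve the same entry of
  \<open>m\<close> and the same powers, with opposite signs by
  \<open>koszul_sign_swap\<close>.\<close>

lemma koszul_diff_koszul_diff:
  assumes S: "S \<in> idx p" and m: "\<And>T. T \<in> idx (p - 2) \<Longrightarrow> m T \<in> carrier M"
  shows "koszul_diff t (koszul_diff t m) S = \<zero>\<^bsub>M\<^esub>"
proof -
  define F where "F i j = (koszul_sign R S i \<otimes> (xs ! i) [^] t) \<odot>\<^bsub>M\<^esub>
     ((koszul_sign R (S - {i}) j \<otimes> (xs ! j) [^] t) \<odot>\<^bsub>M\<^esub> m (S - {i} - {j}))" for i j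
  have m': "m (S - {i} - {j}) \<in> carrier M" if "i \<in> S" "j \<in> S" "i \<noteq> j" for i j
    using m idx_diff[OF idx_diff[OF S, of i], of j] that by (simp add: m)
  have x: "xs ! i \<in> carrier R" if "i \<in> S" for i using S that by (rule idx_nth_closed)
  have Fc: "F i j \<in> carrier M" if "i \<in> S" "j \<in> S" "i \<noteq> j" for i j
    unfolding F_def using m'[OF that] x that by simp
  have "koszul_diff t (koszul_diff t m) S = (\<Oplus>\<^bsub>M\<^esub>i\<in>S. \<Oplus>\<^bsub>M\<^esub>j\<in>S - {i}. F i j)"
    unfolding koszul_diff_def[of t "koszul_diff t m"]
  proof (rule M.finsum_cong'[OF refl])
    fix i assume i: "i \<in> S"
    show "(koszul_sign R S i \<otimes> (xs ! i) [^] t) \<odot>\<^bsub>M\<^esub> koszul_diff t m (S - {i}) = (\<Oplus>\<^bsub>M\<^esub>j\<in>S - {i}. F i j)"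
      unfolding koszul_diff_def F_def
      using i x m' idx_finite[OF S] by (subst finsum_smult) auto
  qed (use Fc in \<open>auto intro!: M.finsum_closed\<close>)
  also have "\<dots> = \<zero>\<^bsub>M\<^esub>"
  proof (rule M.finsum_antisym_pairs[OF idx_finite[OF S]])
    fix i j assume ij: "i \<in> S" "j \<in> S" "i \<noteq> j"
    show "F i j \<in> carrier M" by (rule Fc[OF ij])
    have e: "S - {j} - {i} = S - {i} - {j}" by auto
    have F1: "F i j = ((koszul_sign R S i \<otimes> koszul_sign R (S - {i}) j) \<otimes> ((xs ! i) [^] t \<otimes> (xs ! j) [^] t)) \<odot>\<^bsub>M\<^esub> m (S - {i} - {j})"
      unfolding F_def using m'[OF ij] x ij by (simp add: m_ac flip: smult_assoc1)
    have F2: "F j i = ((koszul_sign R S j \<otimes> koszul_sign R (S - {j}) i) \<otimes> ((xs ! i) [^] t \<otimes> (xs ! j) [^] t)) \<odot>\<^bsub>M\<^esub> m (S - {i} - {j})"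
      unfolding F_def e using m'[OF ij] x ij by (simp add: m_ac flip: smult_assoc1)
    have "F i j \<oplus>\<^bsub>M\<^esub> F j i = ((koszul_sign R S i \<otimes> koszul_sign R (S - {i}) j \<oplus> koszul_sign R S j \<otimes> koszul_sign R (S - {j}) i) \<otimes> ((xs ! i) [^] t \<otimes> (xs ! j) [^] t)) \<odot>\<^bsub>M\<^esub> m (S - {i} - {j})"
      unfolding F1 F2 using m'[OF ij] x ij by (simp add: l_distr smult_l_distr)
    also have "\<dots> = \<zero>\<^bsub>M\<^esub>"
      using m'[OF ij] x ij by (simp add: koszul_sign_swap[OF idx_finite[OF S] ij] R.l_neg)
    finally show "F i j \<oplus>\<^bsub>M\<^esub> F j i = \<zero>\<^bsub>M\<^esub>" .
  qed
  finally show ?thesis .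
qed

text \<open>Contraction against the \<open>i\<close>-th generator is a null homotopy for \<open>x\<^sub>i\<^sup>t\<close>.\<close>

definition koszul_homotopy :: "nat \<Rightarrow> (nat set \<Rightarrow> 'b) \<Rightarrow> nat set \<Rightarrow> 'b" where
  "koszul_homotopy i m S = (if i \<in> S then \<zero>\<^bsub>M\<^esub> else koszul_sign R (insert i S) i \<odot>\<^bsub>M\<^esub> m (insert i S))"

text \<open>If \<open>i\<close> lies in \<open>S\<close>, the homotopy vanishes on all sets
  containing \<open>i\<close>, and only the summand that deletes \<open>i\<close> survives.
  Otherwise that summand comes from the second term, and all remaining summands cancel in
  pairs.\<close>

lemma koszul_diff_koszul_homotopy:
  assumes S: "S \<in> idx p" and m: "\<And>T. T \<in> idx p \<Longrightarrow> m T \<in> carrier M" and i: "i < length xs"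
  shows "koszul_diff t (koszul_homotopy i m) S \<oplus>\<^bsub>M\<^esub> koszul_homotopy i (koszul_diff t m) S = (xs ! i) [^] t \<odot>\<^bsub>M\<^esub> m S"
proof (cases "i \<in> S")
  case True
  have xi: "xs ! i \<in> carrier R" using xs_closed i by auto
  have ins: "insert i (S - {i}) = S" using True by auto
  have z: "(koszul_sign R S j \<otimes> (xs ! j) [^] t) \<odot>\<^bsub>M\<^esub> koszul_homotopy i m (S - {j}) = (if i = j then (xs ! i) [^] t \<odot>\<^bsub>M\<^esub> m S else \<zero>\<^bsub>M\<^esub>)"
    if "j \<in> S" for j
  proof (cases "i = j")
    case True
    have "(koszul_sign R S i \<otimes> (xs ! i) [^] t) \<otimes> koszul_sign R S i =
       (koszul_sign R S i \<otimes> koszul_sign R S i) \<otimes> (xs ! i) [^] t" using xi by (simp add: m_ac)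
    then show ?thesis using True ins xi m[OF S] by (simp add: koszul_homotopy_def koszul_sign_sq flip: smult_assoc1)
  next
    case False
    then show ?thesis using True \<open>i \<in> S\<close> that idx_nth_closed[OF S] by (simp add: koszul_homotopy_def)
  qed
  have "koszul_diff t (koszul_homotopy i m) S = (\<Oplus>\<^bsub>M\<^esub>j\<in>S. if i = j then (xs ! i) [^] t \<odot>\<^bsub>M\<^esub> m S else \<zero>\<^bsub>M\<^esub>)"
    unfolding koszul_diff_def using xi m[OF S] by (intro M.finsum_cong') (auto simp: z)
  also have "\<dots> = (xs ! i) [^] t \<odot>\<^bsub>M\<^esub> m S"
    using M.add.finprod_singleton[OF True idx_finite[OF S], of "\<lambda>_. (xs ! i) [^] t \<odot>\<^bsub>M\<^esub> m S"] xi m[OF S] by simp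
  finally show ?thesis using True xi m[OF S] by (simp add: koszul_homotopy_def)
next
  case False
  define T where "T = insert i S"
  have xi: "xs ! i \<in> carrier R" using xs_closed i by auto
  have T: "T \<in> idx (p + 1)" unfolding T_def by (rule idx_insert[OF S i False])
  have TS: "T - {i} = S" using False by (auto simp: T_def)
  have fS: "finite S" by (rule idx_finite[OF S])
  have mT: "m (T - {j}) \<in> carrier M" if "j \<in> S" for j
    using idx_diff[OF T, of j] that m by (auto simp: T_def)
  have x: "xs ! j \<in> carrier R" if "j \<in> S" for j using S that by (rule idx_nth_closed)
  define G where "G j = ((koszul_sign R T i \<otimes> koszul_sign R T j) \<otimes> (xs ! j) [^] t) \<odot>\<^bsub>M\<^esub> m (T - {j})" for j
  have G: "G j \<in> carrier M" if "j \<in> S" for j unfolding G_def using mT x that by simp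
  have "koszul_diff t m T = (koszul_sign R T i \<otimes> (xs ! i) [^] t) \<odot>\<^bsub>M\<^esub> m (T - {i}) \<oplus>\<^bsub>M\<^esub> (\<Oplus>\<^bsub>M\<^esub>j\<in>S. (koszul_sign R T j \<otimes> (xs ! j) [^] t) \<odot>\<^bsub>M\<^esub> m (T - {j}))"
    unfolding koszul_diff_def T_def using mT x xi m[OF S] TS False fS
    by (intro M.finsum_insert) (auto simp: T_def)
  then have "koszul_homotopy i (koszul_diff t m) S = koszul_sign R T i \<odot>\<^bsub>M\<^esub> ((koszul_sign R T i \<otimes> (xs ! i) [^] t) \<odot>\<^bsub>M\<^esub> m S) \<oplus>\<^bsub>M\<^esub> koszul_sign R T i \<odot>\<^bsub>M\<^esub> (\<Oplus>\<^bsub>M\<^esub>j\<in>S. (koszul_sign R T j \<otimes> (xs ! j) [^] t) \<odot>\<^bsub>M\<^esub> m (T - {j}))"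
    using False xi x mT m[OF S] by (simp add: koszul_homotopy_def T_def[symmetric] TS smult_r_distr M.finsum_closed Pi_def)
  also have "koszul_sign R T i \<odot>\<^bsub>M\<^esub> ((koszul_sign R T i \<otimes> (xs ! i) [^] t) \<odot>\<^bsub>M\<^esub> m S) = (xs ! i) [^] t \<odot>\<^bsub>M\<^esub> m S"
    using xi m[OF S] by (simp add: koszul_sign_sq flip: smult_assoc1 R.m_assoc)
  also have "koszul_sign R T i \<odot>\<^bsub>M\<^esub> (\<Oplus>\<^bsub>M\<^esub>j\<in>S. (koszul_sign R T j \<otimes> (xs ! j) [^] t) \<odot>\<^bsub>M\<^esub> m (T - {j})) = (\<Oplus>\<^bsub>M\<^esub>j\<in>S. G j)"
    unfolding G_def using fS x mT by (subst finsum_smult) (auto simp: R.m_assoc simp flip: smult_assoc1 intro!: M.finsum_cong')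
  finally have 1: "koszul_homotopy i (koszul_diff t m) S = (xs ! i) [^] t \<odot>\<^bsub>M\<^esub> m S \<oplus>\<^bsub>M\<^esub> (\<Oplus>\<^bsub>M\<^esub>j\<in>S. G j)" .
  \<comment> \<open>Inserting \<open>i\<close> and deleting \<open>j\<close> commute. The swap rule
    on \<open>T = insert i S\<close> gives the relative sign -1, after squares of signs are
    removed.\<close>
  have 2: "(koszul_sign R S j \<otimes> (xs ! j) [^] t) \<odot>\<^bsub>M\<^esub> koszul_homotopy i m (S - {j}) = (\<ominus> \<one>) \<odot>\<^bsub>M\<^esub> G j" if j: "j \<in> S" for j
  proof -
    have ji: "j \<noteq> i" and iT: "i \<in> T" and jT: "j \<in> T" using j False by (auto simp: T_def)
    have e: "insert i (S - {j}) = T - {j}" using ji by (auto simp: T_def)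
    have nin: "i \<notin> S - {j}" using False by auto
    let ?a = "koszul_sign R T i" and ?b = "koszul_sign R S j"
      and ?c = "koszul_sign R T j" and ?d = "koszul_sign R (T - {j}) i"
    have sw: "?a \<otimes> ?b = \<ominus> (?c \<otimes> ?d)"
      using koszul_sign_swap[OF idx_finite[OF T] iT jT] ji by (simp add: TS)
    have "?b \<otimes> ?d = (?a \<otimes> ?a) \<otimes> ?b \<otimes> ?d" by (simp add: koszul_sign_sq)
    also have "\<dots> = ?a \<otimes> (?a \<otimes> ?b) \<otimes> ?d" by (simp add: m_assoc)
    also have "\<dots> = \<ominus> (?a \<otimes> ?c \<otimes> (?d \<otimes> ?d))" unfolding sw by (simp add: l_minus r_minus m_assoc)
    finally have "?b \<otimes> ?d = \<ominus> \<one> \<otimes> (?a \<otimes> ?c)" by (simp add: koszul_sign_sq l_minus)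
    then have "(?b \<otimes> ?d) \<otimes> (xs ! j) [^] t = (\<ominus> \<one> \<otimes> (?a \<otimes> ?c)) \<otimes> (xs ! j) [^] t"
      by simp
    then have "(?b \<otimes> (xs ! j) [^] t) \<otimes> ?d = (\<ominus> \<one>) \<otimes> (?a \<otimes> ?c \<otimes> (xs ! j) [^] t)"
      using x[OF j] by (simp add: m_ac)
    then show ?thesis using nin x[OF j] mT[OF j] unfolding G_def koszul_homotopy_def e if_not_P[OF nin]
      by (simp flip: smult_assoc1 del: insert_Diff_single)
  qed
  have "koszul_diff t (koszul_homotopy i m) S = (\<ominus> \<one>) \<odot>\<^bsub>M\<^esub> (\<Oplus>\<^bsub>M\<^esub>j\<in>S. G j)"
    unfolding koszul_diff_def using fS G by (subst finsum_smult) (auto simp: 2 intro!: M.finsum_cong')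
  moreover have "(\<Oplus>\<^bsub>M\<^esub>j\<in>S. G j) \<in> carrier M" using G by (auto intro!: M.finsum_closed)
  ultimately show ?thesis unfolding 1 using xi m[OF S]
      M.a_lcomm[of "\<ominus>\<^bsub>M\<^esub> (\<Oplus>\<^bsub>M\<^esub>j\<in>S. G j)" "(xs ! i) [^] t \<odot>\<^bsub>M\<^esub> m S" "\<Oplus>\<^bsub>M\<^esub>j\<in>S. G j"]
    by (simp add: smult_l_minus M.l_neg)
qed

end

section \<open>Vanishing of the colimit of Koszul cohomologies\<close>

context module
begin

text \<open>Stands for equality in the quotient by \<open>N\<close>. Membership in the carrier is
  included, so a congruence brings its own closure facts along.\<close>

definition mcong :: "'c set \<Rightarrow> 'c \<Rightarrow> 'c \<Rightarrow> bool" where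
  "mcong N a b \<longleftrightarrow> a \<in> carrier M \<and> b \<in> carrier M \<and> a \<ominus>\<^bsub>M\<^esub> b \<in> N"

lemma mcong_closed: "mcong N a b \<Longrightarrow> a \<in> carrier M" "mcong N a b \<Longrightarrow> b \<in> carrier M"
  by (auto simp: mcong_def)

lemma submodule_zero: "submodule N R M \<Longrightarrow> \<zero>\<^bsub>M\<^esub> \<in> N"
  using submodule.axioms(1) subgroup.one_closed by fastforce

lemma submodule_minus: "submodule N R M \<Longrightarrow> a \<in> N \<Longrightarrow> b \<in> N \<Longrightarrow> a \<ominus>\<^bsub>M\<^esub> b \<in> N"
  by (simp add: M.minus_eq submoduleE(3,5))

lemma submodule_carrier: "submodule N R M \<Longrightarrow> a \<in> N \<Longrightarrow> a \<in> carrier M"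
  using submoduleE(1) by blast

lemma zero_submodule: "submodule {\<zero>\<^bsub>M\<^esub>} R M"
  by (rule submoduleI) auto

lemma mcong_refl: "submodule N R M \<Longrightarrow> a \<in> carrier M \<Longrightarrow> mcong N a a"
  by (simp add: mcong_def M.minus_eq M.r_neg submodule_zero)

lemma mcong_add:
  assumes "submodule N R M" "mcong N a b" "mcong N c d"
  shows "mcong N (a \<oplus>\<^bsub>M\<^esub> c) (b \<oplus>\<^bsub>M\<^esub> d)"
proof -
  have "(a \<oplus>\<^bsub>M\<^esub> c) \<ominus>\<^bsub>M\<^esub> (b \<oplus>\<^bsub>M\<^esub> d) = (a \<ominus>\<^bsub>M\<^esub> b) \<oplus>\<^bsub>M\<^esub> (c \<ominus>\<^bsub>M\<^esub> d)"
    using assms by (simp add: mcong_def M.minus_eq M.minus_add M.a_ac)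
  then show ?thesis using assms by (auto simp: mcong_def submoduleE(5))
qed

lemma mcong_trans:
  assumes "submodule N R M" "mcong N a b" "mcong N b c"
  shows "mcong N a c"
proof -
  have "a \<ominus>\<^bsub>M\<^esub> c = (a \<ominus>\<^bsub>M\<^esub> b) \<oplus>\<^bsub>M\<^esub> (b \<ominus>\<^bsub>M\<^esub> c)"
    using assms by (simp add: mcong_def M.minus_eq M.a_assoc M.r_neg1)
  then show ?thesis using assms by (auto simp: mcong_def submoduleE(5))
qed

lemma mcong_smult:
  assumes "submodule N R M" "mcong N a b" "r \<in> carrier R"
  shows "mcong N (r \<odot>\<^bsub>M\<^esub> a) (r \<odot>\<^bsub>M\<^esub> b)"
proof -
  have "r \<odot>\<^bsub>M\<^esub> a \<ominus>\<^bsub>M\<^esub> r \<odot>\<^bsub>M\<^esub> b = r \<odot>\<^bsub>M\<^esub> (a \<ominus>\<^bsub>M\<^esub> b)"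
    using assms by (simp add: mcong_def M.minus_eq smult_r_distr smult_r_minus)
  then show ?thesis using assms by (auto simp: mcong_def submoduleE(4))
qed

lemma mcong_mono: "mcong N a b \<Longrightarrow> N \<subseteq> N' \<Longrightarrow> mcong N' a b"
  by (auto simp: mcong_def)

lemma mcong_zero: "a \<in> carrier M \<Longrightarrow> mcong N a \<zero>\<^bsub>M\<^esub> \<longleftrightarrow> a \<in> N"
  by (metis mcong_def M.minus_eq M.minus_equality M.r_zero M.zero_closed)

lemma minus_cancel: "a \<in> carrier M \<Longrightarrow> b \<in> carrier M \<Longrightarrow> (a \<ominus>\<^bsub>M\<^esub> b) \<oplus>\<^bsub>M\<^esub> b = a"
  by (simp add: M.minus_eq M.a_assoc M.l_neg)

lemma mcong_mem:
  assumes "submodule L R M" "mcong L a b"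
  shows "a \<in> L \<longleftrightarrow> b \<in> L"
proof -
  have "a = (a \<ominus>\<^bsub>M\<^esub> b) \<oplus>\<^bsub>M\<^esub> b"
    using assms by (simp add: mcong_def minus_cancel)
  moreover have "b = \<ominus>\<^bsub>M\<^esub> (a \<ominus>\<^bsub>M\<^esub> b) \<oplus>\<^bsub>M\<^esub> a"
    using assms by (simp add: mcong_def M.minus_eq M.minus_add M.a_comm[of "\<ominus>\<^bsub>M\<^esub> a"] M.a_assoc M.l_neg)
  ultimately
  show ?thesis using assms unfolding mcong_def by (metis submoduleE(3,5))
qed

text \<open>For \<open>N\<close> contained in \<open>L\<close>, \<open>colon N L y\<close> modulo
  \<open>N\<close> is the kernel of \<open>y\<close> on L/N, and \<open>L\<close> modulo
  \<open>padd N L y\<close>, which is N + yL, is its cokernel.\<close>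

definition colon :: "'c set \<Rightarrow> 'c set \<Rightarrow> 'a \<Rightarrow> 'c set" where
  "colon N L y = {l \<in> L. y \<odot>\<^bsub>M\<^esub> l \<in> N}"

definition padd :: "'c set \<Rightarrow> 'c set \<Rightarrow> 'a \<Rightarrow> 'c set" where
  "padd N L y = {n \<oplus>\<^bsub>M\<^esub> y \<odot>\<^bsub>M\<^esub> l | n l. n \<in> N \<and> l \<in> L}"

lemma colon_submodule:
  assumes "submodule N R M" "submodule L R M" "y \<in> carrier R"
  shows "submodule (colon N L y) R M"
proof (rule submoduleI)
  show "colon N L y \<subseteq> carrier M" using submoduleE(1)[OF assms(2)] by (auto simp: colon_def)
  show "\<zero>\<^bsub>M\<^esub> \<in> colon N L y" using assms by (simp add: colon_def submodule_zero)
  show "\<ominus>\<^bsub>M\<^esub> a \<in> colon N L y" if "a \<in> colon N L y" for a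
    using that assms submodule_carrier[OF assms(2)] by (auto simp: colon_def submoduleE(3) smult_r_minus)
  show "a \<oplus>\<^bsub>M\<^esub> b \<in> colon N L y" if "a \<in> colon N L y" "b \<in> colon N L y" for a b
    using that assms submodule_carrier[OF assms(2)] by (auto simp: colon_def submoduleE(5) smult_r_distr)
  show "r \<odot>\<^bsub>M\<^esub> a \<in> colon N L y" if "r \<in> carrier R" "a \<in> colon N L y" for r a
  proof -
    have "y \<odot>\<^bsub>M\<^esub> (r \<odot>\<^bsub>M\<^esub> a) = r \<odot>\<^bsub>M\<^esub> (y \<odot>\<^bsub>M\<^esub> a)"
      using that assms submodule_carrier[OF assms(2)] by (simp add: colon_def R.m_comm flip: smult_assoc1)
    then show ?thesis using that assms by (auto simp: colon_def submoduleE(4))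
  qed
qed

lemma padd_submodule:
  assumes "submodule N R M" "submodule L R M" "y \<in> carrier R"
  shows "submodule (padd N L y) R M"
proof (rule submoduleI)
  note c = submodule_carrier[OF assms(1)] submodule_carrier[OF assms(2)]
  show "padd N L y \<subseteq> carrier M" using assms c by (auto simp: padd_def)
  have "\<zero>\<^bsub>M\<^esub> = \<zero>\<^bsub>M\<^esub> \<oplus>\<^bsub>M\<^esub> y \<odot>\<^bsub>M\<^esub> \<zero>\<^bsub>M\<^esub>" using assms by simp
  then show "\<zero>\<^bsub>M\<^esub> \<in> padd N L y" using assms submodule_zero unfolding padd_def by blast
  show "\<ominus>\<^bsub>M\<^esub> a \<in> padd N L y" if "a \<in> padd N L y" for a
  proof -
    obtain n l where a: "a = n \<oplus>\<^bsub>M\<^esub> y \<odot>\<^bsub>M\<^esub> l" "n \<in> N" "l \<in> L" using \<open>a \<in> padd N L y\<close> by (auto simp: padd_def)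
    then have "\<ominus>\<^bsub>M\<^esub> a = \<ominus>\<^bsub>M\<^esub> n \<oplus>\<^bsub>M\<^esub> y \<odot>\<^bsub>M\<^esub> (\<ominus>\<^bsub>M\<^esub> l)" using assms c by (simp add: M.minus_add smult_r_minus)
    then show ?thesis using a assms submoduleE(3) unfolding padd_def by blast
  qed
  show "a \<oplus>\<^bsub>M\<^esub> b \<in> padd N L y" if ab: "a \<in> padd N L y" "b \<in> padd N L y" for a b
  proof -
    obtain n l where a: "a = n \<oplus>\<^bsub>M\<^esub> y \<odot>\<^bsub>M\<^esub> l" "n \<in> N" "l \<in> L" using ab by (auto simp: padd_def)
    obtain n' l' where b: "b = n' \<oplus>\<^bsub>M\<^esub> y \<odot>\<^bsub>M\<^esub> l'" "n' \<in> N" "l' \<in> L" using ab by (auto simp: padd_def)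
    have "a \<oplus>\<^bsub>M\<^esub> b = (n \<oplus>\<^bsub>M\<^esub> n') \<oplus>\<^bsub>M\<^esub> y \<odot>\<^bsub>M\<^esub> (l \<oplus>\<^bsub>M\<^esub> l')"
      using a b assms c by (simp add: M.a_ac smult_r_distr)
    then show ?thesis using a b assms submoduleE(5) unfolding padd_def by blast
  qed
  show "r \<odot>\<^bsub>M\<^esub> a \<in> padd N L y" if r: "r \<in> carrier R" and "a \<in> padd N L y" for r a
  proof -
    obtain n l where a: "a = n \<oplus>\<^bsub>M\<^esub> y \<odot>\<^bsub>M\<^esub> l" "n \<in> N" "l \<in> L" using \<open>a \<in> padd N L y\<close> by (auto simp: padd_def)
    then have "r \<odot>\<^bsub>M\<^esub> a = r \<odot>\<^bsub>M\<^esub> n \<oplus>\<^bsub>M\<^esub> y \<odot>\<^bsub>M\<^esub> (r \<odot>\<^bsub>M\<^esub> l)"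
      using r assms c by (simp add: smult_r_distr R.m_comm flip: smult_assoc1)
    then show ?thesis using a r assms submoduleE(4) unfolding padd_def by blast
  qed
qed

lemma padd_incl:
  assumes "submodule N R M" "submodule L R M" "y \<in> carrier R"
  shows "N \<subseteq> padd N L y"
proof
  fix n assume "n \<in> N"
  moreover have "n = n \<oplus>\<^bsub>M\<^esub> y \<odot>\<^bsub>M\<^esub> \<zero>\<^bsub>M\<^esub>" using assms submodule_carrier[OF assms(1)] \<open>n \<in> N\<close> by simp
  ultimately show "n \<in> padd N L y" using submodule_zero[OF assms(2)] unfolding padd_def by blast
qed

text \<open>Degree is expressed by how multiplication commutes with the projections. If all
  projections are the identity, every ring element is homogeneous of every degree.\<close>

definition homog_elt :: "(int \<Rightarrow> 'c \<Rightarrow> 'c) \<Rightarrow> int \<Rightarrow> 'a \<Rightarrow> bool" where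
  "homog_elt pr d r \<longleftrightarrow> r \<in> carrier R \<and>
     (\<forall>e. \<forall>m\<in>carrier M. pr (e + d) (r \<odot>\<^bsub>M\<^esub> m) = r \<odot>\<^bsub>M\<^esub> pr e m)"

text \<open>Only additivity and idempotence are recorded. This admits the family of identities,
  which a direct sum decomposition would exclude.\<close>

definition grading_proj :: "(int \<Rightarrow> 'c \<Rightarrow> 'c) \<Rightarrow> bool" where
  "grading_proj pr \<longleftrightarrow> (\<forall>e. \<forall>m\<in>carrier M. pr e m \<in> carrier M) \<and>
     (\<forall>e. \<forall>m\<in>carrier M. \<forall>n\<in>carrier M. pr e (m \<oplus>\<^bsub>M\<^esub> n) = pr e m \<oplus>\<^bsub>M\<^esub> pr e n) \<and>
     (\<forall>e. \<forall>m\<in>carrier M. pr e (pr e m) = pr e m)"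

definition graded_sub :: "(int \<Rightarrow> 'c \<Rightarrow> 'c) \<Rightarrow> 'c set \<Rightarrow> bool" where
  "graded_sub pr N \<longleftrightarrow> submodule N R M \<and> (\<forall>e. \<forall>m\<in>N. pr e m \<in> N)"

lemma graded_subD: "graded_sub pr N \<Longrightarrow> submodule N R M" "graded_sub pr N \<Longrightarrow> m \<in> N \<Longrightarrow> pr e m \<in> N"
  by (auto simp: graded_sub_def)

lemma grading_projD:
  assumes "grading_proj pr" "m \<in> carrier M"
  shows "pr e m \<in> carrier M" "n \<in> carrier M \<Longrightarrow> pr e (m \<oplus>\<^bsub>M\<^esub> n) = pr e m \<oplus>\<^bsub>M\<^esub> pr e n" "pr e (pr e m) = pr e m"
  using assms by (auto simp: grading_proj_def)

lemma grading_proj_zero: "grading_proj pr \<Longrightarrow> pr e \<zero>\<^bsub>M\<^esub> = \<zero>\<^bsub>M\<^esub>"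
  using grading_projD[of pr "\<zero>\<^bsub>M\<^esub>"] by (metis M.add.r_cancel_one' M.r_zero M.zero_closed)

lemma grading_proj_inv: "grading_proj pr \<Longrightarrow> m \<in> carrier M \<Longrightarrow> pr e (\<ominus>\<^bsub>M\<^esub> m) = \<ominus>\<^bsub>M\<^esub> pr e m"
proof -
  assume a: "grading_proj pr" "m \<in> carrier M"
  have "pr e (\<ominus>\<^bsub>M\<^esub> m) \<oplus>\<^bsub>M\<^esub> pr e m = \<zero>\<^bsub>M\<^esub>"
    using a by (simp add: M.l_neg grading_proj_zero flip: grading_projD(2))
  then show ?thesis using a by (intro M.minus_equality[symmetric]) (auto simp: grading_projD)
qed

lemma grading_proj_minus:
  "grading_proj pr \<Longrightarrow> m \<in> carrier M \<Longrightarrow> n \<in> carrier M \<Longrightarrow> pr e (m \<ominus>\<^bsub>M\<^esub> n) = pr e m \<ominus>\<^bsub>M\<^esub> pr e n"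
  by (simp add: M.minus_eq grading_projD grading_proj_inv)

lemma grading_proj_finsum:
  assumes "grading_proj pr" "finite A" "\<And>i. i \<in> A \<Longrightarrow> f i \<in> carrier M"
  shows "pr e (\<Oplus>\<^bsub>M\<^esub>i\<in>A. f i) = (\<Oplus>\<^bsub>M\<^esub>i\<in>A. pr e (f i))"
  using assms(2,3)
  by (induction A rule: finite_induct)
     (auto simp: assms(1) grading_proj_zero grading_projD M.finsum_insert Pi_def)

lemma mcong_proj:
  assumes "grading_proj pr" "graded_sub pr N" "mcong N a b"
  shows "mcong N (pr e a) (pr e b)"
  using assms unfolding mcong_def graded_sub_def
  by (metis grading_proj_minus grading_projD(1))

lemma homog_eltD: "homog_elt pr d r \<Longrightarrow> r \<in> carrier R"
  "homog_elt pr d r \<Longrightarrow> m \<in> carrier M \<Longrightarrow> pr (e + d) (r \<odot>\<^bsub>M\<^esub> m) = r \<odot>\<^bsub>M\<^esub> pr e m"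
  by (auto simp: homog_elt_def)

lemma homog_elt_mult:
  assumes "grading_proj pr" "homog_elt pr d r" "homog_elt pr d' r'"
  shows "homog_elt pr (d + d') (r \<otimes> r')"
proof -
  have "pr (e + (d + d')) ((r \<otimes> r') \<odot>\<^bsub>M\<^esub> m) = (r \<otimes> r') \<odot>\<^bsub>M\<^esub> pr e m" if "m \<in> carrier M" for e m
  proof -
    have "pr (e + d' + d) (r \<odot>\<^bsub>M\<^esub> (r' \<odot>\<^bsub>M\<^esub> m)) = r \<odot>\<^bsub>M\<^esub> (r' \<odot>\<^bsub>M\<^esub> pr e m)"
      using that assms by (simp add: homog_eltD)
    then show ?thesis using that assms by (simp add: homog_eltD smult_assoc1 grading_projD algebra_simps)
  qed
  then show ?thesis using assms by (simp add: homog_elt_def)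
qed

lemma homog_elt_one: "grading_proj pr \<Longrightarrow> homog_elt pr 0 \<one>"
  by (simp add: homog_elt_def grading_projD)

lemma homog_elt_pow:
  assumes "grading_proj pr" "homog_elt pr d r"
  shows "homog_elt pr (int t * d) (r [^] (t::nat))"
proof (induction t)
  case 0
  then show ?case using homog_elt_one[OF assms(1)] by simp
next
  case (Suc t)
  then show ?case using homog_elt_mult[OF assms(1) Suc assms(2)] by (simp add: algebra_simps)
qed

lemma homog_elt_sign: "grading_proj pr \<Longrightarrow> homog_elt pr 0 (koszul_sign R S i)"
proof -
  assume g: "grading_proj pr"
  have "homog_elt pr 0 (\<ominus> \<one>)" using g by (simp add: homog_elt_def smult_l_minus grading_proj_inv grading_projD)
  from homog_elt_pow[OF g this, of "card {j \<in> S. j < i}"] show ?thesis by (simp add: koszul_sign_def)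
qed

lemma colon_graded:
  assumes "grading_proj pr" "graded_sub pr N" "graded_sub pr L" "homog_elt pr d y"
  shows "graded_sub pr (colon N L y)"
  unfolding graded_sub_def
proof (intro conjI allI ballI)
  show "submodule (colon N L y) R M" using assms by (simp add: colon_submodule graded_sub_def homog_eltD)
  fix e m assume m: "m \<in> colon N L y"
  have "y \<odot>\<^bsub>M\<^esub> pr e m = pr (e + d) (y \<odot>\<^bsub>M\<^esub> m)"
    using m assms submodule_carrier[of L m] by (simp add: colon_def homog_eltD graded_sub_def)
  then show "pr e m \<in> colon N L y" using m assms by (simp add: colon_def graded_sub_def)
qed

text \<open>Apply the projection to any decomposition of \<open>a\<close>. It passes through
  \<open>y\<close> with a shift by \<open>d\<close>, so the preimage under \<open>y\<close> can be
  chosen homogeneous.\<close>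

lemma padd_lift:
  assumes "grading_proj pr" "graded_sub pr N" "graded_sub pr L" "homog_elt pr d y"
    and a: "a \<in> padd N L y" "pr (e + d) a = a"
  shows "\<exists>n l. n \<in> N \<and> l \<in> L \<and> pr e l = l \<and> a = n \<oplus>\<^bsub>M\<^esub> y \<odot>\<^bsub>M\<^esub> l"
proof -
  obtain n l where nl: "a = n \<oplus>\<^bsub>M\<^esub> y \<odot>\<^bsub>M\<^esub> l" "n \<in> N" "l \<in> L" using a by (auto simp: padd_def)
  have c: "n \<in> carrier M" "l \<in> carrier M" using nl assms submodule_carrier by (auto simp: graded_sub_def)
  have "a = pr (e + d) a" using a by simp
  also have "\<dots> = pr (e + d) n \<oplus>\<^bsub>M\<^esub> y \<odot>\<^bsub>M\<^esub> pr e l" using nl c assms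
    by (simp add: grading_projD homog_eltD)
  finally show ?thesis using nl assms c
    by (intro exI[of _ "pr (e + d) n"] exI[of _ "pr e l"]) (simp add: graded_sub_def grading_projD)
qed

lemma padd_graded:
  assumes "grading_proj pr" "graded_sub pr N" "graded_sub pr L" "homog_elt pr d y"
  shows "graded_sub pr (padd N L y)"
  unfolding graded_sub_def
proof (intro conjI allI ballI)
  show "submodule (padd N L y) R M" using assms by (simp add: padd_submodule graded_sub_def homog_eltD)
  fix e m assume "m \<in> padd N L y"
  then obtain n l where nl: "m = n \<oplus>\<^bsub>M\<^esub> y \<odot>\<^bsub>M\<^esub> l" "n \<in> N" "l \<in> L" by (auto simp: padd_def)
  have c: "n \<in> carrier M" "l \<in> carrier M" using nl assms submodule_carrier by (auto simp: graded_sub_def)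
  \<comment> \<open>Writing \<open>e\<close> as \<open>e - d + d\<close> brings the shift rule for
    \<open>y\<close> into play. The factor behind \<open>y\<close> is then projected to degree
    \<open>e - d\<close>.\<close>
  have "pr (e - d + d) m = pr (e - d + d) n \<oplus>\<^bsub>M\<^esub> y \<odot>\<^bsub>M\<^esub> pr (e - d) l" using nl c assms
    by (simp only: grading_projD homog_eltD smult_closed)
  then have "pr e m = pr e n \<oplus>\<^bsub>M\<^esub> y \<odot>\<^bsub>M\<^esub> pr (e - d) l" by simp
  moreover have "pr e n \<in> N" "pr (e - d) l \<in> L" using nl assms by (auto simp: graded_sub_def)
  ultimately show "pr e m \<in> padd N L y" unfolding padd_def by blast
qed

end

section \<open>Cocycles and coboundaries in the colimit\<close>

context koszul
begin

text \<open>
  Local cohomology is the colimit over \<open>t\<close> of the Koszul cohomologies for \<open>x\<^sub>1\<^sup>t, \<dots>, x\<^sub>n\<^sup>t\<close>, where the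
  transition from \<open>t\<close> to \<open>t + u\<close> multiplies the component at \<open>S\<close> by \<open>x\<^sub>S\<^sup>u\<close>. A cochain \<open>m\<close> at stage \<open>t\<close>
  stands for the family of fractions \<open>m\<^sub>S / x\<^sub>S\<^sup>t\<close>. All subquotients \<open>L/N\<close> are handled inside one module,
  by computing in \<open>L\<close> modulo \<open>N\<close>. The maps \<open>pr e\<close> project to degree \<open>e\<close>, and taking all of them
  to be the identity gives the ungraded theory.
\<close>

definition is_coboundary :: "'b set \<Rightarrow> 'b set \<Rightarrow> int \<Rightarrow> nat \<Rightarrow> (nat set \<Rightarrow> 'b) \<Rightarrow> bool" where
  "is_coboundary L N p t m \<longleftrightarrow> (\<exists>u b. (\<forall>S\<in>idx (p - 1). b S \<in> L) \<and>
     (\<forall>S\<in>idx p. mcong N (xprod S [^] u \<odot>\<^bsub>M\<^esub> m S) (koszul_diff (t + u) b S)))"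

text \<open>The condition is imposed at stage \<open>t\<close> itself. A cocycle of the colimit
  satisfies it after a further transition, as \<open>cocycle_rep\<close> shows.\<close>

definition is_cocycle :: "'b set \<Rightarrow> 'b set \<Rightarrow> int \<Rightarrow> nat \<Rightarrow> (nat set \<Rightarrow> 'b) \<Rightarrow> bool" where
  "is_cocycle L N p t m \<longleftrightarrow> (\<forall>S\<in>idx p. m S \<in> L) \<and> (\<forall>S\<in>idx (p + 1). koszul_diff t m S \<in> N)"

text \<open>Here \<open>j\<close> is the degree of the fraction. For \<open>S\<close> of size
  \<open>p\<close> the denominator \<open>xprod S [^] t\<close> has degree t p, which is added to
  obtain the degree of the numerator.\<close>

definition is_homogeneous :: "(int \<Rightarrow> 'b \<Rightarrow> 'b) \<Rightarrow> int \<Rightarrow> int \<Rightarrow> nat \<Rightarrow> (nat set \<Rightarrow> 'b) \<Rightarrow> bool" where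
  "is_homogeneous pr p j t m \<longleftrightarrow> (\<forall>S\<in>idx p. pr (j + int t * p) (m S) = m S)"

text \<open>Expresses H^p(L/N)_j = 0 in the colimit, by quantifying over representatives at all
  stages.\<close>

definition vanishes :: "(int \<Rightarrow> 'b \<Rightarrow> 'b) \<Rightarrow> 'b set \<Rightarrow> 'b set \<Rightarrow> int \<Rightarrow> int \<Rightarrow> bool" where
  "vanishes pr L N p j \<longleftrightarrow> (\<forall>t m. is_cocycle L N p t m \<longrightarrow> is_homogeneous pr p j t m \<longrightarrow> is_coboundary L N p t m)"

lemma koszul_diff_mcong:
  assumes N: "submodule N R M" and S: "S \<in> idx p" and m: "\<And>T. T \<in> idx (p - 1) \<Longrightarrow> mcong N (m T) (m' T)"
  shows "mcong N (koszul_diff t m S) (koszul_diff t m' S)"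
proof -
  have c: "\<And>T. T \<in> idx (p - 1) \<Longrightarrow> m T \<in> carrier M" "\<And>T. T \<in> idx (p - 1) \<Longrightarrow> m' T \<in> carrier M"
    using m mcong_closed by blast+
  have "koszul_diff t m S \<ominus>\<^bsub>M\<^esub> koszul_diff t m' S \<in> N"
    using koszul_diff_minus[OF S, of m m' t] c koszul_diff_in_submodule[OF N S, of "\<lambda>T. m T \<ominus>\<^bsub>M\<^esub> m' T" t] m
    by (simp add: mcong_def)
  then show ?thesis using koszul_diff_closed[OF S] c by (simp add: mcong_def)
qed

lemma xpow_closed [simp]: "S \<in> idx p \<Longrightarrow> xprod S [^] (u::nat) \<in> carrier R"
  by (simp add: xprod_closed)

lemma is_coboundary_mono:
  assumes "is_coboundary L N p t m" "L \<subseteq> L'" "N \<subseteq> N'"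
  shows "is_coboundary L' N' p t m"
  using assms unfolding is_coboundary_def by (meson mcong_mono subsetD)

lemma is_coboundary_cong: "is_coboundary L N p t m \<Longrightarrow> (\<And>S. S \<in> idx p \<Longrightarrow> m S = m' S) \<Longrightarrow> is_coboundary L N p t m'"
  unfolding is_coboundary_def by simp

text \<open>A cochain and its transition to stage \<open>t + u\<close> are the same family of
  fractions.\<close>

lemma is_coboundary_twist:
  assumes "is_coboundary L N p (t + u) (\<lambda>S. xprod S [^] u \<odot>\<^bsub>M\<^esub> m S)" "\<And>S. S \<in> idx p \<Longrightarrow> m S \<in> carrier M"
  shows "is_coboundary L N p t m"
proof -
  obtain v b where b: "\<forall>S\<in>idx (p - 1). b S \<in> L"
    "\<forall>S\<in>idx p. mcong N (xprod S [^] v \<odot>\<^bsub>M\<^esub> (xprod S [^] u \<odot>\<^bsub>M\<^esub> m S)) (koszul_diff (t + u + v) b S)"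
    using assms unfolding is_coboundary_def by auto
  show ?thesis unfolding is_coboundary_def
  proof (intro exI conjI)
    show "\<forall>S\<in>idx p. mcong N (xprod S [^] (u + v) \<odot>\<^bsub>M\<^esub> m S) (koszul_diff (t + (u + v)) b S)"
      using b(2) assms(2) by (simp add: R.m_comm xprod_closed add.assoc flip: smult_assoc1 R.nat_pow_mult)
  qed (fact b(1))
qed

text \<open>Bounding persists at later stages, because transitions commute with the differential.
  This brings two coboundaries to a common stage, so that they can be added.\<close>

lemma is_coboundary_raise:
  assumes N: "submodule N R M" and L: "submodule L R M"
    and b: "\<forall>S\<in>idx (p - 1). b S \<in> L" "\<forall>S\<in>idx p. mcong N (xprod S [^] u \<odot>\<^bsub>M\<^esub> m S) (koszul_diff (t + u) b S)"
    and m: "\<And>S. S \<in> idx p \<Longrightarrow> m S \<in> carrier M"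
  shows "\<exists>b. (\<forall>S\<in>idx (p - 1). b S \<in> L) \<and>
     (\<forall>S\<in>idx p. mcong N (xprod S [^] (u + v) \<odot>\<^bsub>M\<^esub> m S) (koszul_diff (t + (u + v)) b S))"
proof (intro exI conjI ballI)
  show "xprod S [^] v \<odot>\<^bsub>M\<^esub> b S \<in> L" if "S \<in> idx (p - 1)" for S
    using b(1) that L by (simp add: submoduleE(4))
  fix S assume S: "S \<in> idx p"
  have "mcong N (xprod S [^] v \<odot>\<^bsub>M\<^esub> (xprod S [^] u \<odot>\<^bsub>M\<^esub> m S)) (xprod S [^] v \<odot>\<^bsub>M\<^esub> koszul_diff (t + u) b S)"
    using N b(2) S by (simp add: mcong_smult)
  moreover have "xprod S [^] v \<odot>\<^bsub>M\<^esub> koszul_diff (t + u) b S = koszul_diff (t + (u + v)) (\<lambda>S. xprod S [^] v \<odot>\<^bsub>M\<^esub> b S) S"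
    using xprod_pow_koszul_diff[OF S, of b v "t + u"] b(1) submodule_carrier[OF L] by (simp add: add.assoc)
  ultimately show "mcong N (xprod S [^] (u + v) \<odot>\<^bsub>M\<^esub> m S) (koszul_diff (t + (u + v)) (\<lambda>S. xprod S [^] v \<odot>\<^bsub>M\<^esub> b S) S)"
    using m[OF S] S by (simp add: R.m_comm xprod_closed flip: smult_assoc1 R.nat_pow_mult)
qed

lemma is_coboundary_add:
  assumes N: "submodule N R M" and L: "submodule L R M"
    and "is_coboundary L N p t m" "is_coboundary L N p t m'"
    and m: "\<And>S. S \<in> idx p \<Longrightarrow> m S \<in> carrier M" "\<And>S. S \<in> idx p \<Longrightarrow> m' S \<in> carrier M"
  shows "is_coboundary L N p t (\<lambda>S. m S \<oplus>\<^bsub>M\<^esub> m' S)"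
proof -
  obtain u b u' b' where "\<forall>S\<in>idx (p - 1). b S \<in> L" "\<forall>S\<in>idx p. mcong N (xprod S [^] u \<odot>\<^bsub>M\<^esub> m S) (koszul_diff (t + u) b S)"
    "\<forall>S\<in>idx (p - 1). b' S \<in> L" "\<forall>S\<in>idx p. mcong N (xprod S [^] u' \<odot>\<^bsub>M\<^esub> m' S) (koszul_diff (t + u') b' S)"
    using assms(3,4) unfolding is_coboundary_def by blast
  note b = this
  obtain c where c: "\<forall>S\<in>idx (p - 1). c S \<in> L" "\<forall>S\<in>idx p. mcong N (xprod S [^] (u + u') \<odot>\<^bsub>M\<^esub> m S) (koszul_diff (t + (u + u')) c S)"
    using is_coboundary_raise[OF N L b(1,2) m(1)] by blast
  obtain c' where c': "\<forall>S\<in>idx (p - 1). c' S \<in> L" "\<forall>S\<in>idx p. mcong N (xprod S [^] (u + u') \<odot>\<^bsub>M\<^esub> m' S) (koszul_diff (t + (u + u')) c' S)"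
    using is_coboundary_raise[OF N L b(3,4) m(2), of u] unfolding add.commute[of u' u] by blast
  show ?thesis unfolding is_coboundary_def
  proof (intro exI conjI ballI)
    show "c S \<oplus>\<^bsub>M\<^esub> c' S \<in> L" if "S \<in> idx (p - 1)" for S using that c(1) c'(1) L by (simp add: submoduleE(5))
    fix S assume S: "S \<in> idx p"
    have "koszul_diff (t + (u + u')) (\<lambda>S. c S \<oplus>\<^bsub>M\<^esub> c' S) S = koszul_diff (t + (u + u')) c S \<oplus>\<^bsub>M\<^esub> koszul_diff (t + (u + u')) c' S"
      using koszul_diff_add[OF S] c(1) c'(1) submodule_carrier[OF L] by simp
    then show "mcong N (xprod S [^] (u + u') \<odot>\<^bsub>M\<^esub> (m S \<oplus>\<^bsub>M\<^esub> m' S)) (koszul_diff (t + (u + u')) (\<lambda>S. c S \<oplus>\<^bsub>M\<^esub> c' S) S)"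
      using c(2) c'(2) S m[OF S] N by (simp add: smult_r_distr mcong_add)
  qed
qed

lemma is_coboundary_smult:
  assumes N: "submodule N R M" and L: "submodule L R M" and "is_coboundary L N p t m"
    and m: "\<And>S. S \<in> idx p \<Longrightarrow> m S \<in> carrier M" and r: "r \<in> carrier R"
  shows "is_coboundary L N p t (\<lambda>S. r \<odot>\<^bsub>M\<^esub> m S)"
proof -
  obtain u b where b: "\<forall>S\<in>idx (p - 1). b S \<in> L" "\<forall>S\<in>idx p. mcong N (xprod S [^] u \<odot>\<^bsub>M\<^esub> m S) (koszul_diff (t + u) b S)"
    using assms(3) unfolding is_coboundary_def by blast
  show ?thesis unfolding is_coboundary_def
  proof (intro exI conjI ballI)
    show "r \<odot>\<^bsub>M\<^esub> b S \<in> L" if "S \<in> idx (p - 1)" for S using that b(1) r L by (simp add: submoduleE(4))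
    fix S assume S: "S \<in> idx p"
    have "koszul_diff (t + u) (\<lambda>S. r \<odot>\<^bsub>M\<^esub> b S) S = r \<odot>\<^bsub>M\<^esub> koszul_diff (t + u) b S"
      using koszul_diff_smult[OF S] b(1) r submodule_carrier[OF L] by simp
    moreover have "xprod S [^] u \<odot>\<^bsub>M\<^esub> (r \<odot>\<^bsub>M\<^esub> m S) = r \<odot>\<^bsub>M\<^esub> (xprod S [^] u \<odot>\<^bsub>M\<^esub> m S)"
      using S m r by (simp add: R.m_comm flip: smult_assoc1)
    ultimately show "mcong N (xprod S [^] u \<odot>\<^bsub>M\<^esub> (r \<odot>\<^bsub>M\<^esub> m S)) (koszul_diff (t + u) (\<lambda>S. r \<odot>\<^bsub>M\<^esub> b S) S)"
      using b(2) S r N by (simp add: mcong_smult)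
  qed
qed

lemma is_coboundary_koszul_diff:
  assumes N: "submodule N R M" and L: "submodule L R M" and b: "\<And>S. S \<in> idx (p - 1) \<Longrightarrow> b S \<in> L"
    and m: "\<And>S. S \<in> idx p \<Longrightarrow> mcong N (m S) (koszul_diff t b S)"
  shows "is_coboundary L N p t m"
  unfolding is_coboundary_def using b m mcong_closed[OF m]
  by (intro exI[of _ 0] exI[of _ b]) simp

lemma is_coboundary_mod:
  assumes N: "submodule N R M" and L: "submodule L R M" and m: "\<And>S. S \<in> idx p \<Longrightarrow> m S \<in> N"
  shows "is_coboundary L N p t m"
proof (rule is_coboundary_koszul_diff[OF N L])
  show "\<zero>\<^bsub>M\<^esub> \<in> L" by (rule submodule_zero[OF L])
  fix S assume S: "S \<in> idx p"
  have "koszul_diff t (\<lambda>_. \<zero>\<^bsub>M\<^esub>) S = \<zero>\<^bsub>M\<^esub>"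
    unfolding koszul_diff_def using idx_nth_closed[OF S] by (intro M.add.finprod_one_eqI) auto
  then show "mcong N (m S) (koszul_diff t (\<lambda>_. \<zero>\<^bsub>M\<^esub>) S)"
    using m[OF S] submodule_carrier[OF N] by (simp add: mcong_zero)
qed

lemma xprod_homog:
  assumes g: "grading_proj pr" and x: "\<And>x. x \<in> set xs \<Longrightarrow> homog_elt pr 1 x" and S: "S \<in> idx p"
  shows "homog_elt pr p (xprod S)"
proof -
  have "homog_elt pr (int (card S)) (xprod S)" if "finite S" "S \<subseteq> {..<length xs}" for S
    using that
  proof (induction S rule: finite_induct)
    case empty
    then show ?case using g by (simp add: xprod_def homog_elt_one)
  next
    case (insert i S)
    have xi: "xs ! i \<in> set xs" using insert.prems by simp
    have "xprod (insert i S) = xs ! i \<otimes> xprod S"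
      unfolding xprod_def using insert.hyps insert.prems
      by (intro R.finprod_insert) (auto intro: nth_closed)
    then show ?case using homog_elt_mult[OF g x[OF xi] insert.IH] insert by simp
  qed
  then show ?thesis using S idx_finite[OF S] by (auto simp: idx_def)
qed

end

locale graded_koszul = koszul +
  fixes pr :: "int \<Rightarrow> 'c \<Rightarrow> 'c"
  assumes proj: "grading_proj pr"
    and xs_homog: "\<And>x. x \<in> set xs \<Longrightarrow> homog_elt pr 1 x"
begin

text \<open>The factor x_i^t has degree \<open>t\<close>, which is exactly the growth of the degree
  of the denominator from t (p - 1) to t p. So the differential preserves the degree
  \<open>j\<close> of fractions.\<close>

lemma proj_koszul_diff:
  assumes S: "S \<in> idx p" and m: "\<And>T. T \<in> idx (p - 1) \<Longrightarrow> m T \<in> carrier M"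
  shows "pr (j + int t * p) (koszul_diff t m S) = koszul_diff t (\<lambda>T. pr (j + int t * (p - 1)) (m T)) S"
proof -
  have *: "pr (j + int t * p) ((koszul_sign R S i \<otimes> (xs ! i) [^] t) \<odot>\<^bsub>M\<^esub> m (S - {i})) =
    (koszul_sign R S i \<otimes> (xs ! i) [^] t) \<odot>\<^bsub>M\<^esub> pr (j + int t * (p - 1)) (m (S - {i}))"
    if i: "i \<in> S" for i
  proof -
    have "xs ! i \<in> set xs" using S i by (auto simp: idx_def)
    then have "homog_elt pr (0 + int t * 1) (koszul_sign R S i \<otimes> (xs ! i) [^] t)"
      using proj xs_homog by (intro homog_elt_mult homog_elt_sign homog_elt_pow)
    from homog_eltD(2)[OF this m[OF idx_diff[OF S i]], of "j + int t * (p - 1)"]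
    show ?thesis by (simp add: algebra_simps)
  qed
  have c: "pr (j + int t * (p - 1)) (m T) \<in> carrier M" if "T \<in> idx (p - 1)" for T
    using m[OF that] proj by (simp add: grading_projD)
  show ?thesis unfolding koszul_diff_def
    using S m proj idx_finite koszul_diff_term_closed[OF S _ m] koszul_diff_term_closed[OF S _ c]
    by (subst grading_proj_finsum) (auto simp: * intro!: M.finsum_cong')
qed

lemma proj_xpow:
  assumes S: "S \<in> idx p" and m: "m \<in> carrier M"
  shows "pr (j + int (t + u) * p) (xprod S [^] u \<odot>\<^bsub>M\<^esub> m) = xprod S [^] u \<odot>\<^bsub>M\<^esub> pr (j + int t * p) m"
  using homog_eltD(2)[OF homog_elt_pow[OF proj xprod_homog[OF proj xs_homog S]] m, of "j + int t * p" u]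
  by (simp add: algebra_simps)

text \<open>Replace the bounding cochain by its part of degree \<open>j\<close>. Since the
  projections commute with the differential and with transitions, this part still bounds the
  homogeneous \<open>m\<close>.\<close>

lemma is_coboundary_homog:
  assumes N: "graded_sub pr N" and L: "graded_sub pr L" and b: "is_coboundary L N p t m"
    and h: "is_homogeneous pr p j t m" and m: "\<And>S. S \<in> idx p \<Longrightarrow> m S \<in> carrier M"
  shows "\<exists>u b. (\<forall>S\<in>idx (p - 1). b S \<in> L) \<and> is_homogeneous pr (p - 1) j (t + u) b \<and>
     (\<forall>S\<in>idx p. mcong N (xprod S [^] u \<odot>\<^bsub>M\<^esub> m S) (koszul_diff (t + u) b S))"
proof -
  obtain u b where b: "\<forall>S\<in>idx (p - 1). b S \<in> L" "\<forall>S\<in>idx p. mcong N (xprod S [^] u \<odot>\<^bsub>M\<^esub> m S) (koszul_diff (t + u) b S)"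
    using b unfolding is_coboundary_def by blast
  have bc: "b S \<in> carrier M" if "S \<in> idx (p - 1)" for S using b(1) that L submodule_carrier by (auto simp: graded_sub_def)
  let ?b = "\<lambda>S. pr (j + int (t + u) * (p - 1)) (b S)"
  show ?thesis
  proof (intro exI conjI ballI)
    show "?b S \<in> L" if "S \<in> idx (p - 1)" for S using b(1) that L by (simp add: graded_sub_def)
    show "is_homogeneous pr (p - 1) j (t + u) ?b" using bc proj by (simp add: is_homogeneous_def grading_projD)
    fix S assume S: "S \<in> idx p"
    have "mcong N (pr (j + int (t + u) * p) (xprod S [^] u \<odot>\<^bsub>M\<^esub> m S)) (pr (j + int (t + u) * p) (koszul_diff (t + u) b S))"
      using b(2) S by (intro mcong_proj[OF proj N]) blast
    then show "mcong N (xprod S [^] u \<odot>\<^bsub>M\<^esub> m S) (koszul_diff (t + u) ?b S)"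
      using h S proj_xpow[OF S m[OF S], of j t u] proj_koszul_diff[of S p b j "t + u", OF S bc]
      by (simp add: is_homogeneous_def del: of_nat_add)
  qed
qed

lemma is_homogeneous_twist:
  assumes "is_homogeneous pr p j t m" "\<And>S. S \<in> idx p \<Longrightarrow> m S \<in> carrier M"
  shows "is_homogeneous pr p j (t + u) (\<lambda>S. xprod S [^] u \<odot>\<^bsub>M\<^esub> m S)"
  unfolding is_homogeneous_def
proof
  fix S assume S: "S \<in> idx p"
  show "pr (j + int (t + u) * p) (xprod S [^] u \<odot>\<^bsub>M\<^esub> m S) = xprod S [^] u \<odot>\<^bsub>M\<^esub> m S"
    unfolding proj_xpow[OF S assms(2)[OF S]] using assms(1) S by (simp add: is_homogeneous_def)
qed

lemma is_homogeneous_koszul_diff: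
  assumes "is_homogeneous pr (p - 1) j t m" "\<And>S. S \<in> idx (p - 1) \<Longrightarrow> m S \<in> carrier M"
  shows "is_homogeneous pr p j t (koszul_diff t m)"
  unfolding is_homogeneous_def
proof
  fix S assume S: "S \<in> idx p"
  have "pr (j + int t * p) (koszul_diff t m S) = koszul_diff t (\<lambda>T. pr (j + int t * (p - 1)) (m T)) S"
    by (rule proj_koszul_diff[OF S assms(2)])
  also have "\<dots> = koszul_diff t m S" by (rule koszul_diff_cong[OF _ _ S]) (use assms in \<open>auto simp: is_homogeneous_def\<close>)
  finally show "pr (j + int t * p) (koszul_diff t m S) = koszul_diff t m S" .
qed

lemma is_homogeneous_minus:
  assumes "is_homogeneous pr p j t m" "is_homogeneous pr p j t m'" "\<And>S. S \<in> idx p \<Longrightarrow> m S \<in> carrier M"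
    "\<And>S. S \<in> idx p \<Longrightarrow> m' S \<in> carrier M"
  shows "is_homogeneous pr p j t (\<lambda>S. m S \<ominus>\<^bsub>M\<^esub> m' S)"
  using assms proj by (simp add: is_homogeneous_def grading_proj_minus)

end

section \<open>Long exact sequences and torsion\<close>

context graded_koszul
begin

lemma xpow_xpow_commute:
  "S \<in> idx p \<Longrightarrow> r \<in> carrier R \<Longrightarrow> m \<in> carrier M \<Longrightarrow> r \<odot>\<^bsub>M\<^esub> (xprod S [^] (u::nat) \<odot>\<^bsub>M\<^esub> m) = xprod S [^] u \<odot>\<^bsub>M\<^esub> (r \<odot>\<^bsub>M\<^esub> m)"
  by (simp add: R.m_comm flip: smult_assoc1)

lemma minus_zero_right: "a \<in> carrier M \<Longrightarrow> a \<ominus>\<^bsub>M\<^esub> \<zero>\<^bsub>M\<^esub> = a"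
  by (metis M.minus_eq M.minus_equality M.r_zero M.zero_closed)

lemma graded_sub_carrier: "graded_sub pr N \<Longrightarrow> m \<in> N \<Longrightarrow> m \<in> carrier M"
  by (meson graded_subD(1) submodule_carrier)

lemma vanD:
  assumes "vanishes pr L N p j" "\<And>S. S \<in> idx p \<Longrightarrow> m S \<in> L" "\<And>S. S \<in> idx (p + 1) \<Longrightarrow> koszul_diff t m S \<in> N" "is_homogeneous pr p j t m"
  shows "is_coboundary L N p t m"
  using assms unfolding vanishes_def is_cocycle_def by blast

text \<open>The next three lemmas are exactness of the long exact sequence of \<open>N \<subseteq> P \<subseteq> L\<close> at its three kinds of terms.\<close>

lemma vanishes_trans:
  assumes N: "graded_sub pr N" and P: "graded_sub pr P" and L: "graded_sub pr L" and "N \<subseteq> P" "P \<subseteq> L"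
    and PN: "vanishes pr P N p j" and LP: "vanishes pr L P p j"
  shows "vanishes pr L N p j"
  unfolding vanishes_def
proof (intro allI impI)
  fix t m assume m: "is_cocycle L N p t m" "is_homogeneous pr p j t m"
  note sN = graded_subD(1)[OF N] and sP = graded_subD(1)[OF P] and sL = graded_subD(1)[OF L]
  have mc: "m S \<in> carrier M" if "S \<in> idx p" for S using m(1) that L graded_sub_carrier by (auto simp: is_cocycle_def)
  have "is_coboundary L P p t m" by (rule vanD[OF LP]) (use m \<open>N \<subseteq> P\<close> in \<open>auto simp: is_cocycle_def\<close>)
  from is_coboundary_homog[OF P L this m(2) mc] obtain u b where
    b: "\<forall>S\<in>idx (p - 1). b S \<in> L" "is_homogeneous pr (p - 1) j (t + u) b"
    "\<forall>S\<in>idx p. mcong P (xprod S [^] u \<odot>\<^bsub>M\<^esub> m S) (koszul_diff (t + u) b S)" by blast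
  have bc: "b S \<in> carrier M" if "S \<in> idx (p - 1)" for S using b(1) that L graded_sub_carrier by auto
  have kbc: "koszul_diff (t + u) b S \<in> carrier M" if "S \<in> idx p" for S using koszul_diff_closed[OF that bc] .
  \<comment> \<open>At a later stage, \<open>m\<close> is corrected by the boundary of
    \<open>b\<close>. The result takes its values in \<open>P\<close> and has the same differential
    as the twisted \<open>m\<close>.\<close>
  define m' where "m' S = xprod S [^] u \<odot>\<^bsub>M\<^esub> m S \<ominus>\<^bsub>M\<^esub> koszul_diff (t + u) b S" for S
  have m'P: "m' S \<in> P" if "S \<in> idx p" for S using b(3) that by (auto simp: m'_def mcong_def)
  have xmc: "xprod S [^] u \<odot>\<^bsub>M\<^esub> m S \<in> carrier M" if "S \<in> idx p" for S using that mc by simp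
  have "koszul_diff (t + u) m' S \<in> N" if S: "S \<in> idx (p + 1)" for S
  proof -
    have S': "S \<in> idx (p + 1 - 1 + 1)" using S by simp
    have "koszul_diff (t + u) m' S = koszul_diff (t + u) (\<lambda>S. xprod S [^] u \<odot>\<^bsub>M\<^esub> m S) S \<ominus>\<^bsub>M\<^esub> koszul_diff (t + u) (koszul_diff (t + u) b) S"
      unfolding m'_def using xmc kbc by (intro koszul_diff_minus[OF S]) auto
    also have "koszul_diff (t + u) (koszul_diff (t + u) b) S = \<zero>\<^bsub>M\<^esub>" using bc by (intro koszul_diff_koszul_diff[OF S]) (auto simp: algebra_simps)
    also have "koszul_diff (t + u) (\<lambda>S. xprod S [^] u \<odot>\<^bsub>M\<^esub> m S) S = xprod S [^] u \<odot>\<^bsub>M\<^esub> koszul_diff t m S"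
      using mc by (intro xprod_pow_koszul_diff[OF S, symmetric]) auto
    also have "\<dots> \<ominus>\<^bsub>M\<^esub> \<zero>\<^bsub>M\<^esub> \<in> N"
      using m(1) S sN by (auto simp: is_cocycle_def intro!: submodule_minus submoduleE(4) submodule_zero)
    finally show ?thesis .
  qed
  moreover have "is_homogeneous pr p j (t + u) m'"
    unfolding m'_def using mc bc b(2) m(2) xmc kbc by (intro is_homogeneous_minus is_homogeneous_twist is_homogeneous_koszul_diff) auto
  ultimately have "is_coboundary P N p (t + u) m'" using vanD[OF PN] m'P by blast
  then have "is_coboundary L N p (t + u) m'" using \<open>P \<subseteq> L\<close> is_coboundary_mono by blast
  moreover have "is_coboundary L N p (t + u) (koszul_diff (t + u) b)"
    using b(1) kbc mcong_refl[OF sN] by (intro is_coboundary_koszul_diff[OF sN sL]) auto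
  ultimately have "is_coboundary L N p (t + u) (\<lambda>S. m' S \<oplus>\<^bsub>M\<^esub> koszul_diff (t + u) b S)"
    using m'P kbc P graded_sub_carrier by (intro is_coboundary_add[OF sN sL]) auto
  then have "is_coboundary L N p (t + u) (\<lambda>S. xprod S [^] u \<odot>\<^bsub>M\<^esub> m S)"
    by (rule is_coboundary_cong) (use xmc kbc in \<open>simp add: m'_def minus_cancel\<close>)
  then show "is_coboundary L N p t m" using is_coboundary_twist mc by blast
qed

lemma vanishes_sub:
  assumes N: "graded_sub pr N" and P: "graded_sub pr P" and L: "graded_sub pr L" and "N \<subseteq> P" "P \<subseteq> L"
    and LN: "vanishes pr L N p j" and LP: "vanishes pr L P (p - 1) j"
  shows "vanishes pr P N p j"
  unfolding vanishes_def
proof (intro allI impI)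
  fix t m assume m: "is_cocycle P N p t m" "is_homogeneous pr p j t m"
  note sN = graded_subD(1)[OF N] and sP = graded_subD(1)[OF P] and sL = graded_subD(1)[OF L]
  have mc: "m S \<in> carrier M" if "S \<in> idx p" for S using m(1) that P graded_sub_carrier by (auto simp: is_cocycle_def)
  have "is_coboundary L N p t m" by (rule vanD[OF LN]) (use m \<open>P \<subseteq> L\<close> in \<open>auto simp: is_cocycle_def\<close>)
  from is_coboundary_homog[OF N L this m(2) mc] obtain u b where
    b: "\<forall>S\<in>idx (p - 1). b S \<in> L" "is_homogeneous pr (p - 1) j (t + u) b"
    "\<forall>S\<in>idx p. mcong N (xprod S [^] u \<odot>\<^bsub>M\<^esub> m S) (koszul_diff (t + u) b S)" by blast
  have bc: "b S \<in> carrier M" if "S \<in> idx (p - 1)" for S using b(1) that L graded_sub_carrier by auto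
  have kbP: "koszul_diff (t + u) b S \<in> P" if "S \<in> idx p" for S
  proof -
    have "xprod S [^] u \<odot>\<^bsub>M\<^esub> m S \<in> P" using m(1) sP that by (auto simp: is_cocycle_def intro!: submoduleE(4))
    then show ?thesis using mcong_mem[OF sP] mcong_mono[OF b(3)[rule_format, OF that] \<open>N \<subseteq> P\<close>] by blast
  qed
  have "is_coboundary L P (p - 1) (t + u) b" by (rule vanD[OF LP]) (use b kbP in auto)
  then obtain v c where c: "\<forall>S\<in>idx (p - 1 - 1). c S \<in> L"
    "\<forall>S\<in>idx (p - 1). mcong P (xprod S [^] v \<odot>\<^bsub>M\<^esub> b S) (koszul_diff (t + u + v) c S)" unfolding is_coboundary_def by blast
  have cc: "c S \<in> carrier M" if "S \<in> idx (p - 1 - 1)" for S using c(1) that L graded_sub_carrier by auto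
  have kcc: "koszul_diff (t + u + v) c S \<in> carrier M" if "S \<in> idx (p - 1)" for S using koszul_diff_closed[OF that cc] .
  \<comment> \<open>Modulo \<open>P\<close>, the cochain \<open>b\<close> is itself a boundary.
    Subtracting the boundary of \<open>c\<close> moves it into \<open>P\<close> without changing its
    differential, since the differential squares to zero.\<close>
  define e where "e S = xprod S [^] v \<odot>\<^bsub>M\<^esub> b S \<ominus>\<^bsub>M\<^esub> koszul_diff (t + u + v) c S" for S
  have eP: "e S \<in> P" if "S \<in> idx (p - 1)" for S using c(2) that by (auto simp: e_def mcong_def)
  have ke: "koszul_diff (t + u + v) e S = xprod S [^] v \<odot>\<^bsub>M\<^esub> koszul_diff (t + u) b S" if S: "S \<in> idx p" for S
  proof -
    have "koszul_diff (t + u + v) e S = koszul_diff (t + u + v) (\<lambda>S. xprod S [^] v \<odot>\<^bsub>M\<^esub> b S) S \<ominus>\<^bsub>M\<^esub> koszul_diff (t + u + v) (koszul_diff (t + u + v) c) S"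
      unfolding e_def using bc kcc by (intro koszul_diff_minus[OF S]) auto
    also have "koszul_diff (t + u + v) (koszul_diff (t + u + v) c) S = \<zero>\<^bsub>M\<^esub>" using cc by (intro koszul_diff_koszul_diff[OF S]) (auto simp: algebra_simps)
    also have "koszul_diff (t + u + v) (\<lambda>S. xprod S [^] v \<odot>\<^bsub>M\<^esub> b S) S = xprod S [^] v \<odot>\<^bsub>M\<^esub> koszul_diff (t + u) b S"
      using bc by (intro xprod_pow_koszul_diff[OF S, symmetric]) auto
    finally show ?thesis using S koszul_diff_closed[OF S bc] by (simp add: minus_zero_right)
  qed
  have "is_coboundary P N p (t + u + v) (\<lambda>S. xprod S [^] v \<odot>\<^bsub>M\<^esub> (xprod S [^] u \<odot>\<^bsub>M\<^esub> m S))"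
    by (rule is_coboundary_koszul_diff[OF sN sP eP]) (use b(3) in \<open>auto simp: ke intro!: mcong_smult[OF sN]\<close>)
  then have "is_coboundary P N p (t + u) (\<lambda>S. xprod S [^] u \<odot>\<^bsub>M\<^esub> m S)" using is_coboundary_twist mc by simp
  then show "is_coboundary P N p t m" using is_coboundary_twist mc by blast
qed

lemma vanishes_quot:
  assumes N: "graded_sub pr N" and P: "graded_sub pr P" and L: "graded_sub pr L" and "N \<subseteq> P" "P \<subseteq> L"
    and LN: "vanishes pr L N p j" and PN: "vanishes pr P N (p + 1) j"
  shows "vanishes pr L P p j"
  unfolding vanishes_def
proof (intro allI impI)
  fix t m assume m: "is_cocycle L P p t m" "is_homogeneous pr p j t m"
  note sN = graded_subD(1)[OF N] and sP = graded_subD(1)[OF P] and sL = graded_subD(1)[OF L]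
  have mc: "m S \<in> carrier M" if "S \<in> idx p" for S using m(1) that L graded_sub_carrier by (auto simp: is_cocycle_def)
  have kk: "koszul_diff t (koszul_diff t m) S \<in> N" if S: "S \<in> idx (p + 1 + 1)" for S
  proof -
    have "koszul_diff t (koszul_diff t m) S = \<zero>\<^bsub>M\<^esub>" using mc by (intro koszul_diff_koszul_diff[OF S]) auto
    then show ?thesis using submodule_zero[OF sN] by simp
  qed
  have hk: "is_homogeneous pr (p + 1) j t (koszul_diff t m)" using m(2) mc by (intro is_homogeneous_koszul_diff) auto
  have kmc: "koszul_diff t m S \<in> carrier M" if "S \<in> idx (p + 1)" for S using mc by (intro koszul_diff_closed[OF that]) auto
  have "is_coboundary P N (p + 1) t (koszul_diff t m)" by (rule vanD[OF PN]) (use m(1) kk hk in \<open>auto simp: is_cocycle_def\<close>)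
  from is_coboundary_homog[OF N P this hk kmc] obtain u b where
    b: "\<forall>S\<in>idx p. b S \<in> P" "is_homogeneous pr p j (t + u) b"
    "\<forall>S\<in>idx (p + 1). mcong N (xprod S [^] u \<odot>\<^bsub>M\<^esub> koszul_diff t m S) (koszul_diff (t + u) b S)" by auto
  have bc: "b S \<in> carrier M" if "S \<in> idx p" for S using b(1) that P graded_sub_carrier by auto
  have xmc: "xprod S [^] u \<odot>\<^bsub>M\<^esub> m S \<in> carrier M" if "S \<in> idx p" for S using that mc by simp
  \<comment> \<open>The differential of \<open>m\<close> takes its values in \<open>P\<close> and
    represents the image of \<open>m\<close> under the connecting map. It is bounded modulo
    \<open>N\<close> by \<open>b\<close> in \<open>P\<close>, so \<open>m\<close> minus
    \<open>b\<close> is a cocycle modulo \<open>N\<close>.\<close>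
  define m' where "m' S = xprod S [^] u \<odot>\<^bsub>M\<^esub> m S \<ominus>\<^bsub>M\<^esub> b S" for S
  have m'L: "m' S \<in> L" if "S \<in> idx p" for S unfolding m'_def
    using m(1) that b(1) \<open>P \<subseteq> L\<close> by (auto simp: is_cocycle_def intro!: submodule_minus[OF sL] submoduleE(4)[OF sL])
  have "koszul_diff (t + u) m' S \<in> N" if S: "S \<in> idx (p + 1)" for S
  proof -
    have "koszul_diff (t + u) m' S = koszul_diff (t + u) (\<lambda>S. xprod S [^] u \<odot>\<^bsub>M\<^esub> m S) S \<ominus>\<^bsub>M\<^esub> koszul_diff (t + u) b S"
      unfolding m'_def using xmc bc by (intro koszul_diff_minus[OF S]) auto
    also have "koszul_diff (t + u) (\<lambda>S. xprod S [^] u \<odot>\<^bsub>M\<^esub> m S) S = xprod S [^] u \<odot>\<^bsub>M\<^esub> koszul_diff t m S"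
      using mc by (intro xprod_pow_koszul_diff[OF S, symmetric]) auto
    finally show ?thesis using b(3) S by (auto simp: mcong_def)
  qed
  moreover have "is_homogeneous pr p j (t + u) m'"
    unfolding m'_def using mc bc b(2) m(2) xmc by (intro is_homogeneous_minus is_homogeneous_twist) auto
  ultimately have "is_coboundary L N p (t + u) m'" using vanD[OF LN] m'L by blast
  then have "is_coboundary L P p (t + u) m'" using \<open>N \<subseteq> P\<close> is_coboundary_mono by blast
  moreover have "is_coboundary L P p (t + u) b" using b(1) by (intro is_coboundary_mod[OF sP sL]) auto
  ultimately have "is_coboundary L P p (t + u) (\<lambda>S. m' S \<oplus>\<^bsub>M\<^esub> b S)"
    using m'L bc L graded_sub_carrier by (intro is_coboundary_add[OF sP sL]) auto
  then have "is_coboundary L P p (t + u) (\<lambda>S. xprod S [^] u \<odot>\<^bsub>M\<^esub> m S)"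
    by (rule is_coboundary_cong) (use xmc bc in \<open>simp add: m'_def minus_cancel\<close>)
  then show "is_coboundary L P p t m" using is_coboundary_twist mc by blast
qed

text \<open>Multiplication by \<open>y\<close> induces an isomorphism from L/(N : y) to (N + yL)/N
  that raises degrees by \<open>d\<close>. A cochain of the target is lifted entry by entry with
  \<open>padd_lift\<close>, a bounding cochain found there, and the result multiplied by
  \<open>y\<close>.\<close>

lemma vanishes_padd:
  assumes N: "graded_sub pr N" and L: "graded_sub pr L" and y: "homog_elt pr d y"
    and V: "vanishes pr L (colon N L y) p j"
  shows "vanishes pr (padd N L y) N p (j + d)"
  unfolding vanishes_def
proof (intro allI impI)
  fix t m assume m: "is_cocycle (padd N L y) N p t m" "is_homogeneous pr p (j + d) t m"
  note sN = graded_subD(1)[OF N] and sL = graded_subD(1)[OF L] and yc = homog_eltD(1)[OF y]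
  note sC = colon_submodule[OF sN sL yc] and sA = padd_submodule[OF sN sL yc]
  have "\<forall>S\<in>idx p. \<exists>n l. n \<in> N \<and> l \<in> L \<and> pr (j + int t * p) l = l \<and> m S = n \<oplus>\<^bsub>M\<^esub> y \<odot>\<^bsub>M\<^esub> l"
    using m by (intro ballI padd_lift[OF proj N L y]) (auto simp: is_cocycle_def is_homogeneous_def algebra_simps)
  then obtain n l where nl: "\<And>S. S \<in> idx p \<Longrightarrow> n S \<in> N" "\<And>S. S \<in> idx p \<Longrightarrow> l S \<in> L" "is_homogeneous pr p j t l"
    "\<And>S. S \<in> idx p \<Longrightarrow> m S = n S \<oplus>\<^bsub>M\<^esub> y \<odot>\<^bsub>M\<^esub> l S" unfolding is_homogeneous_def by metis
  have nc: "n S \<in> carrier M" and lc: "l S \<in> carrier M" if "S \<in> idx p" for S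
    using nl that N L graded_sub_carrier by auto
  \<comment> \<open>Modulo \<open>N\<close>, the differential of \<open>m\<close> is
    \<open>y\<close> times that of \<open>l\<close>.\<close>
  have klC: "koszul_diff t l S \<in> colon N L y" if S: "S \<in> idx (p + 1)" for S
  proof -
    have "koszul_diff t m S = koszul_diff t (\<lambda>S. n S \<oplus>\<^bsub>M\<^esub> y \<odot>\<^bsub>M\<^esub> l S) S"
      using nl(4) nc lc yc by (intro koszul_diff_cong[OF _ _ S]) auto
    also have "\<dots> = koszul_diff t n S \<oplus>\<^bsub>M\<^esub> koszul_diff t (\<lambda>S. y \<odot>\<^bsub>M\<^esub> l S) S" using nc lc yc by (intro koszul_diff_add[OF S]) auto
    also have "koszul_diff t (\<lambda>S. y \<odot>\<^bsub>M\<^esub> l S) S = y \<odot>\<^bsub>M\<^esub> koszul_diff t l S" using lc yc by (intro koszul_diff_smult[OF S]) auto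
    finally have 1: "koszul_diff t m S = koszul_diff t n S \<oplus>\<^bsub>M\<^esub> y \<odot>\<^bsub>M\<^esub> koszul_diff t l S" .
    have kn: "koszul_diff t n S \<in> N" using nl(1) by (intro koszul_diff_in_submodule[OF sN S]) auto
    have kl: "koszul_diff t l S \<in> L" using nl(2) by (intro koszul_diff_in_submodule[OF sL S]) auto
    have c: "koszul_diff t n S \<in> carrier M" "koszul_diff t l S \<in> carrier M" using kn kl N L graded_sub_carrier by auto
    have "y \<odot>\<^bsub>M\<^esub> koszul_diff t l S = koszul_diff t m S \<ominus>\<^bsub>M\<^esub> koszul_diff t n S" unfolding 1 using c yc
      by (simp add: M.minus_eq M.a_comm[of "koszul_diff t n S"] M.a_assoc M.r_neg)
    then show ?thesis using kn kl m(1) S submodule_minus[OF sN] by (auto simp: colon_def is_cocycle_def)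
  qed
  have "is_coboundary L (colon N L y) p t l" using vanD[OF V] nl klC by blast
  then obtain u b where b: "\<forall>S\<in>idx (p - 1). b S \<in> L"
    "\<forall>S\<in>idx p. mcong (colon N L y) (xprod S [^] u \<odot>\<^bsub>M\<^esub> l S) (koszul_diff (t + u) b S)" unfolding is_coboundary_def by blast
  have bc: "b S \<in> carrier M" if "S \<in> idx (p - 1)" for S using b(1) that L graded_sub_carrier by auto
  have "is_coboundary (padd N L y) N p (t + u) (\<lambda>S. xprod S [^] u \<odot>\<^bsub>M\<^esub> (y \<odot>\<^bsub>M\<^esub> l S))"
  proof (rule is_coboundary_koszul_diff[OF sN sA])
    show "y \<odot>\<^bsub>M\<^esub> b S \<in> padd N L y" if "S \<in> idx (p - 1)" for S
    proof -
      have "y \<odot>\<^bsub>M\<^esub> b S = \<zero>\<^bsub>M\<^esub> \<oplus>\<^bsub>M\<^esub> y \<odot>\<^bsub>M\<^esub> b S" using bc that yc by simp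
      then show ?thesis using b(1) that submodule_zero[OF sN] unfolding padd_def by blast
    qed
    fix S assume S: "S \<in> idx p"
    have *: "mcong (colon N L y) (xprod S [^] u \<odot>\<^bsub>M\<^esub> l S) (koszul_diff (t + u) b S)" using b(2) S by blast
    have "y \<odot>\<^bsub>M\<^esub> (xprod S [^] u \<odot>\<^bsub>M\<^esub> l S) \<ominus>\<^bsub>M\<^esub> y \<odot>\<^bsub>M\<^esub> koszul_diff (t + u) b S = y \<odot>\<^bsub>M\<^esub> (xprod S [^] u \<odot>\<^bsub>M\<^esub> l S \<ominus>\<^bsub>M\<^esub> koszul_diff (t + u) b S)"
      using mcong_closed[OF *] yc by (simp add: M.minus_eq smult_r_distr smult_r_minus)
    then have "mcong N (y \<odot>\<^bsub>M\<^esub> (xprod S [^] u \<odot>\<^bsub>M\<^esub> l S)) (y \<odot>\<^bsub>M\<^esub> koszul_diff (t + u) b S)"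
      using * yc by (auto simp: mcong_def colon_def)
    then show "mcong N (xprod S [^] u \<odot>\<^bsub>M\<^esub> (y \<odot>\<^bsub>M\<^esub> l S)) (koszul_diff (t + u) (\<lambda>S. y \<odot>\<^bsub>M\<^esub> b S) S)"
      using koszul_diff_smult[OF S, of b y "t + u"] bc yc S lc by (simp add: xpow_xpow_commute)
  qed
  then have "is_coboundary (padd N L y) N p t (\<lambda>S. y \<odot>\<^bsub>M\<^esub> l S)" using is_coboundary_twist lc yc by simp
  moreover have "is_coboundary (padd N L y) N p t n" using nl(1) by (intro is_coboundary_mod[OF sN sA])
  ultimately have "is_coboundary (padd N L y) N p t (\<lambda>S. n S \<oplus>\<^bsub>M\<^esub> y \<odot>\<^bsub>M\<^esub> l S)"
    using nc lc yc by (intro is_coboundary_add[OF sN sA]) auto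
  then show "is_coboundary (padd N L y) N p t m" by (rule is_coboundary_cong) (use nl(4) in simp)
qed

text \<open>The same isomorphism in the other direction: multiply the cocycle by \<open>y\<close>,
  bound it in N + yL, and take off the factor \<open>y\<close> from the bounding cochain. The
  summands in \<open>N\<close> do not matter modulo \<open>N\<close>.\<close>

lemma vanishes_colon:
  assumes N: "graded_sub pr N" and L: "graded_sub pr L" and y: "homog_elt pr d y" and "N \<subseteq> L"
    and V: "vanishes pr (padd N L y) N p (j + d)"
  shows "vanishes pr L (colon N L y) p j"
  unfolding vanishes_def
proof (intro allI impI)
  fix t l assume l: "is_cocycle L (colon N L y) p t l" "is_homogeneous pr p j t l"
  note sN = graded_subD(1)[OF N] and sL = graded_subD(1)[OF L] and yc = homog_eltD(1)[OF y]
  note sC = colon_submodule[OF sN sL yc] and sA = padd_submodule[OF sN sL yc]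
  have lc: "l S \<in> carrier M" if "S \<in> idx p" for S
    using l(1) that L graded_sub_carrier by (auto simp: is_cocycle_def)
  have ylA: "y \<odot>\<^bsub>M\<^esub> l' \<in> padd N L y" if "l' \<in> L" for l'
  proof -
    have "y \<odot>\<^bsub>M\<^esub> l' = \<zero>\<^bsub>M\<^esub> \<oplus>\<^bsub>M\<^esub> y \<odot>\<^bsub>M\<^esub> l'" using that yc L graded_sub_carrier by simp
    then show ?thesis using that submodule_zero[OF sN] unfolding padd_def by blast
  qed
  have "is_cocycle (padd N L y) N p t (\<lambda>S. y \<odot>\<^bsub>M\<^esub> l S)"
    unfolding is_cocycle_def
  proof (intro conjI ballI)
    show "y \<odot>\<^bsub>M\<^esub> l S \<in> padd N L y" if "S \<in> idx p" for S using l(1) that ylA by (auto simp: is_cocycle_def)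
    fix S assume S: "S \<in> idx (p + 1)"
    have "koszul_diff t (\<lambda>S. y \<odot>\<^bsub>M\<^esub> l S) S = y \<odot>\<^bsub>M\<^esub> koszul_diff t l S" using lc yc by (intro koszul_diff_smult[OF S]) auto
    then show "koszul_diff t (\<lambda>S. y \<odot>\<^bsub>M\<^esub> l S) S \<in> N" using l(1) S by (auto simp: is_cocycle_def colon_def)
  qed
  moreover have "is_homogeneous pr p (j + d) t (\<lambda>S. y \<odot>\<^bsub>M\<^esub> l S)"
    unfolding is_homogeneous_def
  proof
    fix S assume S: "S \<in> idx p"
    show "pr (j + d + int t * p) (y \<odot>\<^bsub>M\<^esub> l S) = y \<odot>\<^bsub>M\<^esub> l S"
      using homog_eltD(2)[OF y lc[OF S], of "j + int t * p"] l(2) S by (simp add: is_homogeneous_def algebra_simps)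
  qed
  ultimately have "is_coboundary (padd N L y) N p t (\<lambda>S. y \<odot>\<^bsub>M\<^esub> l S)" using V by (auto simp: vanishes_def)
  then obtain u b where b: "\<forall>S\<in>idx (p - 1). b S \<in> padd N L y"
    "\<forall>S\<in>idx p. mcong N (xprod S [^] u \<odot>\<^bsub>M\<^esub> (y \<odot>\<^bsub>M\<^esub> l S)) (koszul_diff (t + u) b S)" unfolding is_coboundary_def by blast
  have "\<forall>S\<in>idx (p - 1). \<exists>n l. n \<in> N \<and> l \<in> L \<and> b S = n \<oplus>\<^bsub>M\<^esub> y \<odot>\<^bsub>M\<^esub> l" using b(1) unfolding padd_def by blast
  then obtain n c where nc: "\<And>S. S \<in> idx (p - 1) \<Longrightarrow> n S \<in> N" "\<And>S. S \<in> idx (p - 1) \<Longrightarrow> c S \<in> L"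
    "\<And>S. S \<in> idx (p - 1) \<Longrightarrow> b S = n S \<oplus>\<^bsub>M\<^esub> y \<odot>\<^bsub>M\<^esub> c S" by metis
  have ncc: "n S \<in> carrier M" "c S \<in> carrier M" if "S \<in> idx (p - 1)" for S
    using nc that N L graded_sub_carrier by auto
  have "mcong (colon N L y) (xprod S [^] u \<odot>\<^bsub>M\<^esub> l S) (koszul_diff (t + u) c S)" if S: "S \<in> idx p" for S
  proof -
    have kcL: "koszul_diff (t + u) c S \<in> L" using nc(2) by (intro koszul_diff_in_submodule[OF sL S])
    have kcc: "koszul_diff (t + u) c S \<in> carrier M" using kcL L graded_sub_carrier by auto
    have "mcong N (koszul_diff (t + u) b S) (koszul_diff (t + u) (\<lambda>S. y \<odot>\<^bsub>M\<^esub> c S) S)"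
    proof (rule koszul_diff_mcong[OF sN S])
      fix T assume T: "T \<in> idx (p - 1)"
      have "mcong N (n T \<oplus>\<^bsub>M\<^esub> y \<odot>\<^bsub>M\<^esub> c T) (\<zero>\<^bsub>M\<^esub> \<oplus>\<^bsub>M\<^esub> y \<odot>\<^bsub>M\<^esub> c T)"
        using ncc[OF T] nc(1)[OF T] yc mcong_zero mcong_refl[OF sN] by (intro mcong_add[OF sN]) auto
      then show "mcong N (b T) (y \<odot>\<^bsub>M\<^esub> c T)" using nc(3)[OF T] ncc[OF T] yc by simp
    qed
    then have "mcong N (xprod S [^] u \<odot>\<^bsub>M\<^esub> (y \<odot>\<^bsub>M\<^esub> l S)) (koszul_diff (t + u) (\<lambda>S. y \<odot>\<^bsub>M\<^esub> c S) S)"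
      using b(2) S mcong_trans[OF sN] by blast
    then have *: "mcong N (y \<odot>\<^bsub>M\<^esub> (xprod S [^] u \<odot>\<^bsub>M\<^esub> l S)) (y \<odot>\<^bsub>M\<^esub> koszul_diff (t + u) c S)"
      using koszul_diff_smult[OF S, of c y "t + u"] ncc yc S lc by (simp add: xpow_xpow_commute)
    have xl: "xprod S [^] u \<odot>\<^bsub>M\<^esub> l S \<in> L" using l(1) S by (auto simp: is_cocycle_def intro!: submoduleE(4)[OF sL])
    have "y \<odot>\<^bsub>M\<^esub> (xprod S [^] u \<odot>\<^bsub>M\<^esub> l S) \<ominus>\<^bsub>M\<^esub> y \<odot>\<^bsub>M\<^esub> koszul_diff (t + u) c S = y \<odot>\<^bsub>M\<^esub> (xprod S [^] u \<odot>\<^bsub>M\<^esub> l S \<ominus>\<^bsub>M\<^esub> koszul_diff (t + u) c S)"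
      using lc[OF S] S kcc yc by (simp add: M.minus_eq smult_r_distr smult_r_minus)
    then show ?thesis using * kcc lc[OF S] S submodule_minus[OF sL xl kcL]
      by (auto simp: mcong_def colon_def)
  qed
  then show "is_coboundary L (colon N L y) p t l" using nc(2) unfolding is_coboundary_def by blast
qed

text \<open>
  Multiplication by \<open>y\<close> is injective on \<open>H\<^sup>p(L/N)\<^sub>j\<close> as soon as \<open>H\<^sup>p\<close> of its kernel on \<open>L/N\<close> and \<open>H\<^sup>p\<^sup>-\<^sup>1\<close> of its
  cokernel vanish in the appropriate degrees.
\<close>

lemma is_coboundary_cancel:
  assumes N: "graded_sub pr N" and L: "graded_sub pr L" and y: "homog_elt pr d y" and "N \<subseteq> L"
    and V1: "vanishes pr (colon N L y) N p j" and V2: "vanishes pr L (padd N L y) (p - 1) (j + d)"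
    and m: "is_cocycle L N p t m" "is_homogeneous pr p j t m" and ym: "is_coboundary L N p t (\<lambda>S. y \<odot>\<^bsub>M\<^esub> m S)"
  shows "is_coboundary L N p t m"
proof -
  note sN = graded_subD(1)[OF N] and sL = graded_subD(1)[OF L] and yc = homog_eltD(1)[OF y]
  note sC = colon_submodule[OF sN sL yc] and sA = padd_submodule[OF sN sL yc]
  note gA = padd_graded[OF proj N L y] and gC = colon_graded[OF proj N L y]
  have mc: "m S \<in> carrier M" if "S \<in> idx p" for S
    using m(1) that L graded_sub_carrier by (auto simp: is_cocycle_def)
  have h: "is_homogeneous pr p (j + d) t (\<lambda>S. y \<odot>\<^bsub>M\<^esub> m S)"
    unfolding is_homogeneous_def
  proof
    fix S assume S: "S \<in> idx p"
    show "pr (j + d + int t * p) (y \<odot>\<^bsub>M\<^esub> m S) = y \<odot>\<^bsub>M\<^esub> m S"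
      using homog_eltD(2)[OF y mc[OF S], of "j + int t * p"] m(2) S by (simp add: is_homogeneous_def algebra_simps)
  qed
  obtain u b where b: "\<forall>S\<in>idx (p - 1). b S \<in> L" "is_homogeneous pr (p - 1) (j + d) (t + u) b"
    "\<forall>S\<in>idx p. mcong N (xprod S [^] u \<odot>\<^bsub>M\<^esub> (y \<odot>\<^bsub>M\<^esub> m S)) (koszul_diff (t + u) b S)"
    using is_coboundary_homog[OF N L ym h] mc yc by auto
  have bc: "b S \<in> carrier M" if "S \<in> idx (p - 1)" for S using b(1) that L graded_sub_carrier by auto
  \<comment> \<open>The boundary of \<open>b\<close> agrees with a multiple of \<open>y\<close>
    modulo \<open>N\<close>, so \<open>b\<close> is a cocycle of the cokernel of \<open>y\<close> in
    cohomological degree \<open>p - 1\<close>.\<close>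
  have kbA: "koszul_diff (t + u) b S \<in> padd N L y" if S: "S \<in> idx p" for S
  proof -
    have "y \<odot>\<^bsub>M\<^esub> (xprod S [^] u \<odot>\<^bsub>M\<^esub> m S) = \<zero>\<^bsub>M\<^esub> \<oplus>\<^bsub>M\<^esub> y \<odot>\<^bsub>M\<^esub> (xprod S [^] u \<odot>\<^bsub>M\<^esub> m S)" using mc[OF S] S yc by simp
    moreover have "xprod S [^] u \<odot>\<^bsub>M\<^esub> m S \<in> L" using m(1) S by (auto simp: is_cocycle_def intro!: submoduleE(4)[OF sL])
    ultimately have "y \<odot>\<^bsub>M\<^esub> (xprod S [^] u \<odot>\<^bsub>M\<^esub> m S) \<in> padd N L y" using submodule_zero[OF sN] unfolding padd_def by blast
    then show ?thesis
      using mcong_mem[OF sA] mcong_mono[OF b(3)[rule_format, OF S] padd_incl[OF sN sL yc]] mc[OF S] S yc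
      by (simp add: xpow_xpow_commute)
  qed
  have "is_coboundary L (padd N L y) (p - 1) (t + u) b" by (rule vanD[OF V2]) (use b kbA in auto)
  from is_coboundary_homog[OF gA L this b(2) bc] obtain v c where c: "\<forall>S\<in>idx (p - 1 - 1). c S \<in> L"
    "is_homogeneous pr (p - 1 - 1) (j + d) (t + u + v) c"
    "\<forall>S\<in>idx (p - 1). mcong (padd N L y) (xprod S [^] v \<odot>\<^bsub>M\<^esub> b S) (koszul_diff (t + u + v) c S)" by blast
  have cc: "c S \<in> carrier M" if "S \<in> idx (p - 1 - 1)" for S using c(1) that L graded_sub_carrier by auto
  have kcc: "koszul_diff (t + u + v) c S \<in> carrier M" if "S \<in> idx (p - 1)" for S using koszul_diff_closed[OF that cc] .
  \<comment> \<open>Since \<open>b\<close> is a boundary in the cokernel, this correction takes its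
    values in N + yL. Up to \<open>N\<close> it is then \<open>y\<close> times a cochain
    \<open>e\<close> of degree \<open>j\<close>.\<close>
  define w where "w S = xprod S [^] v \<odot>\<^bsub>M\<^esub> b S \<ominus>\<^bsub>M\<^esub> koszul_diff (t + u + v) c S" for S
  have hw: "is_homogeneous pr (p - 1) (j + d) (t + u + v) w"
    unfolding w_def using bc kcc b(2) c(2) cc by (intro is_homogeneous_minus is_homogeneous_twist is_homogeneous_koszul_diff) auto
  have "\<forall>S\<in>idx (p - 1). \<exists>n l. n \<in> N \<and> l \<in> L \<and> pr (j + int (t + u + v) * (p - 1)) l = l \<and> w S = n \<oplus>\<^bsub>M\<^esub> y \<odot>\<^bsub>M\<^esub> l"
  proof
    fix S assume S: "S \<in> idx (p - 1)"
    have 1: "w S \<in> padd N L y" using c(3) S by (auto simp: w_def mcong_def)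
    have 2: "pr (j + int (t + u + v) * (p - 1) + d) (w S) = w S"
      using hw S by (simp add: is_homogeneous_def algebra_simps)
    show "\<exists>n l. n \<in> N \<and> l \<in> L \<and> pr (j + int (t + u + v) * (p - 1)) l = l \<and> w S = n \<oplus>\<^bsub>M\<^esub> y \<odot>\<^bsub>M\<^esub> l"
      by (rule padd_lift[OF proj N L y 1 2])
  qed
  then obtain n e where ne: "\<And>S. S \<in> idx (p - 1) \<Longrightarrow> n S \<in> N" "\<And>S. S \<in> idx (p - 1) \<Longrightarrow> e S \<in> L"
    "is_homogeneous pr (p - 1) j (t + u + v) e" "\<And>S. S \<in> idx (p - 1) \<Longrightarrow> w S = n S \<oplus>\<^bsub>M\<^esub> y \<odot>\<^bsub>M\<^esub> e S" unfolding is_homogeneous_def by metis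
  have nec: "n S \<in> carrier M" "e S \<in> carrier M" if "S \<in> idx (p - 1)" for S
    using ne that N L graded_sub_carrier by auto
  define s where "s = t + u + v"
  define X where "X S = xprod S [^] v \<odot>\<^bsub>M\<^esub> (xprod S [^] u \<odot>\<^bsub>M\<^esub> m S)" for S
  have XL: "X S \<in> L" if "S \<in> idx p" for S
    using m(1) that by (auto simp: X_def is_cocycle_def intro!: submoduleE(4)[OF sL])
  have Xc: "X S \<in> carrier M" if "S \<in> idx p" for S using XL that L graded_sub_carrier by auto
  have kec: "koszul_diff s e S \<in> carrier M" if "S \<in> idx p" for S using koszul_diff_closed[OF that nec(2)] .
  have keL: "koszul_diff s e S \<in> L" if "S \<in> idx p" for S using koszul_diff_in_submodule[OF sL that ne(2)] .
  \<comment> \<open>Modulo \<open>N\<close>, \<open>y\<close> times the twisted \<open>m\<close> is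
    the boundary of \<open>w\<close>, hence \<open>y\<close> times the boundary of \<open>e\<close>.
    The difference is therefore killed by \<open>y\<close>, and the vanishing for the kernel applies
    to it.\<close>
  define m' where "m' S = X S \<ominus>\<^bsub>M\<^esub> koszul_diff s e S" for S
  have m'C: "m' S \<in> colon N L y" if S: "S \<in> idx p" for S
  proof -
    have "koszul_diff s w S = koszul_diff s (\<lambda>S. xprod S [^] v \<odot>\<^bsub>M\<^esub> b S) S \<ominus>\<^bsub>M\<^esub> koszul_diff s (koszul_diff s c) S"
      unfolding w_def s_def using bc kcc by (intro koszul_diff_minus[OF S]) auto
    also have "koszul_diff s (koszul_diff s c) S = \<zero>\<^bsub>M\<^esub>" using cc by (intro koszul_diff_koszul_diff[OF S]) (auto simp: algebra_simps)
    also have "koszul_diff s (\<lambda>S. xprod S [^] v \<odot>\<^bsub>M\<^esub> b S) S = xprod S [^] v \<odot>\<^bsub>M\<^esub> koszul_diff (t + u) b S"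
      unfolding s_def using bc by (intro xprod_pow_koszul_diff[OF S, symmetric]) auto
    finally have w1: "koszul_diff s w S = xprod S [^] v \<odot>\<^bsub>M\<^esub> koszul_diff (t + u) b S" using S koszul_diff_closed[OF S bc] by (simp add: minus_zero_right)
    have w2: "mcong N (koszul_diff s w S) (koszul_diff s (\<lambda>S. y \<odot>\<^bsub>M\<^esub> e S) S)"
    proof (rule koszul_diff_mcong[OF sN S])
      fix T assume T: "T \<in> idx (p - 1)"
      have "mcong N (n T \<oplus>\<^bsub>M\<^esub> y \<odot>\<^bsub>M\<^esub> e T) (\<zero>\<^bsub>M\<^esub> \<oplus>\<^bsub>M\<^esub> y \<odot>\<^bsub>M\<^esub> e T)"
        using nec[OF T] ne(1)[OF T] yc mcong_zero mcong_refl[OF sN] by (intro mcong_add[OF sN]) auto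
      then show "mcong N (w T) (y \<odot>\<^bsub>M\<^esub> e T)" using ne(4)[OF T] nec[OF T] yc by simp
    qed
    have w3: "koszul_diff s (\<lambda>S. y \<odot>\<^bsub>M\<^esub> e S) S = y \<odot>\<^bsub>M\<^esub> koszul_diff s e S" using nec yc by (intro koszul_diff_smult[OF S]) auto
    have "mcong N (xprod S [^] v \<odot>\<^bsub>M\<^esub> (xprod S [^] u \<odot>\<^bsub>M\<^esub> (y \<odot>\<^bsub>M\<^esub> m S))) (xprod S [^] v \<odot>\<^bsub>M\<^esub> koszul_diff (t + u) b S)"
      using b(3) S by (intro mcong_smult[OF sN]) auto
    then have "mcong N (y \<odot>\<^bsub>M\<^esub> X S) (y \<odot>\<^bsub>M\<^esub> koszul_diff s e S)"
      using w1 w2 w3 mcong_trans[OF sN] mc[OF S] S yc by (simp add: X_def xpow_xpow_commute[OF S yc])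
    moreover have "y \<odot>\<^bsub>M\<^esub> X S \<ominus>\<^bsub>M\<^esub> y \<odot>\<^bsub>M\<^esub> koszul_diff s e S = y \<odot>\<^bsub>M\<^esub> (X S \<ominus>\<^bsub>M\<^esub> koszul_diff s e S)"
      using Xc[OF S] kec[OF S] yc by (simp add: M.minus_eq smult_r_distr smult_r_minus)
    ultimately show ?thesis using XL[OF S] keL[OF S] submodule_minus[OF sL] by (simp add: mcong_def colon_def m'_def)
  qed
  have Xt: "X S = xprod S [^] (u + v) \<odot>\<^bsub>M\<^esub> m S" if "S \<in> idx p" for S
    using mc[OF that] that xprod_closed[OF that] by (simp add: X_def R.m_comm flip: smult_assoc1 R.nat_pow_mult)
  have "koszul_diff s m' S \<in> N" if S: "S \<in> idx (p + 1)" for S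
  proof -
    have "koszul_diff s m' S = koszul_diff s X S \<ominus>\<^bsub>M\<^esub> koszul_diff s (koszul_diff s e) S"
      unfolding m'_def using Xc kec by (intro koszul_diff_minus[OF S]) auto
    also have "koszul_diff s (koszul_diff s e) S = \<zero>\<^bsub>M\<^esub>" using nec by (intro koszul_diff_koszul_diff[OF S]) (auto simp: algebra_simps)
    also have "koszul_diff s X S = koszul_diff (t + (u + v)) (\<lambda>S. xprod S [^] (u + v) \<odot>\<^bsub>M\<^esub> m S) S"
      unfolding s_def add.assoc using Xt mc by (intro koszul_diff_cong[OF _ _ S]) auto
    also have "\<dots> = xprod S [^] (u + v) \<odot>\<^bsub>M\<^esub> koszul_diff t m S"
      using mc by (intro xprod_pow_koszul_diff[OF S, symmetric]) auto
    also have "\<dots> \<ominus>\<^bsub>M\<^esub> \<zero>\<^bsub>M\<^esub> \<in> N"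
      using m(1) S sN by (auto simp: is_cocycle_def intro!: submodule_minus submoduleE(4) submodule_zero)
    finally show ?thesis .
  qed
  moreover have "is_homogeneous pr p j s X"
    using is_homogeneous_twist[OF m(2) mc, of "u + v"] Xt by (simp add: s_def is_homogeneous_def add.assoc)
  then have "is_homogeneous pr p j s m'"
    unfolding m'_def using Xc kec ne(3) nec by (intro is_homogeneous_minus is_homogeneous_koszul_diff) (auto simp: s_def)
  ultimately have "is_coboundary (colon N L y) N p s m'" using vanD[OF V1] m'C by blast
  then have "is_coboundary L N p s m'" by (rule is_coboundary_mono) (auto simp: colon_def)
  moreover have "is_coboundary L N p s (koszul_diff s e)"
    using ne(2) kec mcong_refl[OF sN] by (intro is_coboundary_koszul_diff[OF sN sL]) auto
  ultimately have "is_coboundary L N p s (\<lambda>S. m' S \<oplus>\<^bsub>M\<^esub> koszul_diff s e S)"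
    using m'C kec graded_sub_carrier[OF gC] by (intro is_coboundary_add[OF sN sL]) auto
  then have "is_coboundary L N p (t + (u + v)) (\<lambda>S. xprod S [^] (u + v) \<odot>\<^bsub>M\<^esub> m S)"
    unfolding s_def add.assoc by (rule is_coboundary_cong) (use Xc kec Xt in \<open>simp add: m'_def minus_cancel s_def add.assoc\<close>)
  then show ?thesis using is_coboundary_twist mc by blast
qed

end

text \<open>The factor \<open>c\<close> lets the induction absorb one factor \<open>a\<close> or \<open>b\<close> at a time, without the binomial theorem.\<close>

lemma (in cring) radical_sum:
  assumes "ideal I R" "a \<in> carrier R" "b \<in> carrier R" "c \<in> carrier R"
    and "c \<otimes> a [^] (e::nat) \<in> I" "c \<otimes> b [^] (f::nat) \<in> I"
  shows "c \<otimes> (a \<oplus> b) [^] (e + f) \<in> I"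
  using assms(4-6)
proof (induction "e + f" arbitrary: c e f)
  case 0
  then show ?case by simp
next
  case (Suc n)
  interpret I: ideal I R by fact
  consider "e = 0" | "f = 0" | e' f' where "e = Suc e'" "f = Suc f'" by (metis not0_implies_Suc)
  then show ?case
  proof cases
    case 1
    then show ?thesis using Suc assms(2,3) I.I_r_closed by simp
  next
    case 2
    then show ?thesis using Suc assms(2,3) I.I_r_closed by simp
  next
    case 3
    let ?k = "(a \<oplus> b) [^] (e' + f)"
    have ef: "n = e' + f" "n = e + f'" using Suc.hyps(2) 3 by auto
    have A: "(c \<otimes> a) \<otimes> (a \<oplus> b) [^] (e' + f) \<in> I"
    proof (rule Suc.hyps(1)[OF ef(1)])
      show "c \<otimes> a \<in> carrier R" using Suc assms by simp
      have "c \<otimes> a \<otimes> a [^] e' = c \<otimes> a [^] e" using 3 Suc assms by (simp add: m_ac)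
      then show "c \<otimes> a \<otimes> a [^] e' \<in> I" using Suc by simp
      have "c \<otimes> a \<otimes> b [^] f = a \<otimes> (c \<otimes> b [^] f)" using Suc assms by (simp add: m_ac)
      then show "c \<otimes> a \<otimes> b [^] f \<in> I" using Suc assms I.I_l_closed by simp
    qed
    have B: "(c \<otimes> b) \<otimes> (a \<oplus> b) [^] (e + f') \<in> I"
    proof (rule Suc.hyps(1)[OF ef(2)])
      show "c \<otimes> b \<in> carrier R" using Suc assms by simp
      have "c \<otimes> b \<otimes> b [^] f' = c \<otimes> b [^] f" using 3 Suc assms by (simp add: m_ac)
      then show "c \<otimes> b \<otimes> b [^] f' \<in> I" using Suc by simp
      have "c \<otimes> b \<otimes> a [^] e = b \<otimes> (c \<otimes> a [^] e)" using Suc assms by (simp add: m_ac)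
      then show "c \<otimes> b \<otimes> a [^] e \<in> I" using Suc assms I.I_l_closed by simp
    qed
    have "e + f' = e' + f" using 3 by simp
    then have "c \<otimes> (a \<oplus> b) [^] (e + f) = (c \<otimes> a) \<otimes> ?k \<oplus> (c \<otimes> b) \<otimes> ?k"
      using 3 Suc.prems assms by (simp add: r_distr l_distr m_ac)
    then show ?thesis using A B \<open>e + f' = e' + f\<close> by simp
  qed
qed

text \<open>The radical \<open>J\<close> of \<open>I\<close> is an ideal containing
  \<open>X\<close>, hence containing the ideal generated by \<open>X\<close>.\<close>

lemma (in cring) pow_mem_if_gens:
  assumes I: "ideal I R" and X: "X \<subseteq> carrier R" and p: "\<And>x. x \<in> X \<Longrightarrow> \<exists>e::nat. x [^] e \<in> I"
    and y: "y \<in> Idl X"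
  shows "\<exists>e::nat. y [^] e \<in> I"
proof -
  interpret I: ideal I R by fact
  define J where "J = {r \<in> carrier R. \<exists>e::nat. r [^] e \<in> I}"
  have J: "ideal J R"
  proof (rule idealI[OF ring_axioms])
    show "subgroup J (add_monoid R)"
    proof (rule add.subgroupI)
      show "J \<subseteq> carrier R" by (auto simp: J_def)
      have "\<zero> [^] (1::nat) \<in> I" by simp
      then show "J \<noteq> {}" unfolding J_def by blast
      show "\<ominus> a \<in> J" if "a \<in> J" for a
      proof -
        obtain e :: nat where e: "a \<in> carrier R" "a [^] e \<in> I" using \<open>a \<in> J\<close> by (auto simp: J_def)
        have "\<ominus> a = (\<ominus> \<one>) \<otimes> a" using e by (simp add: l_minus)
        then have "(\<ominus> a) [^] e = (\<ominus> \<one>) [^] e \<otimes> a [^] e" using e by (simp add: nat_pow_distrib)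
        then have "(\<ominus> a) [^] e \<in> I" using e I.I_l_closed by simp
        then show ?thesis using e(1) unfolding J_def by blast
      qed
      show "a \<oplus> b \<in> J" if ab: "a \<in> J" "b \<in> J" for a b
      proof -
        obtain e f :: nat where "a \<in> carrier R" "a [^] e \<in> I" "b \<in> carrier R" "b [^] f \<in> I"
          using ab by (auto simp: J_def)
        then have "a \<oplus> b \<in> carrier R" "(a \<oplus> b) [^] (e + f) \<in> I" using radical_sum[OF I, of a b \<one> e f] by auto
        then show ?thesis unfolding J_def by blast
      qed
    qed
    fix a r assume a: "a \<in> J" and r: "r \<in> carrier R"
    obtain e :: nat where e: "a \<in> carrier R" "a [^] e \<in> I" using \<open>a \<in> J\<close> by (auto simp: J_def)
    show "r \<otimes> a \<in> J" "a \<otimes> r \<in> J"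
      using e r I.I_l_closed I.I_r_closed by (auto simp: J_def nat_pow_distrib intro!: exI[of _ e])
  qed
  have "X \<subseteq> J" using X p by (auto simp: J_def)
  then have "Idl X \<subseteq> J" using genideal_minimal[OF J] by blast
  then show ?thesis using y by (auto simp: J_def)
qed

section \<open>Torsion of cohomology classes\<close>

context koszul
begin

text \<open>The ring elements \<open>r\<close> for which r m is a coboundary form an ideal. It
  contains x_i^t for every generator: in the homotopy formula the term with the differential of
  \<open>m\<close> lies in \<open>N\<close>. Hence \<open>y\<close> lies in its radical.\<close>

lemma is_coboundary_torsion:
  assumes N: "submodule N R M" and L: "submodule L R M" and NL: "N \<subseteq> L" and m: "is_cocycle L N p t m"
    and y: "y \<in> Idl (set xs)"
  shows "\<exists>e::nat. is_coboundary L N p t (\<lambda>S. y [^] e \<odot>\<^bsub>M\<^esub> m S)"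
proof -
  have mc: "m S \<in> carrier M" if "S \<in> idx p" for S
    using m(1) that L submodule_carrier by (auto simp: is_cocycle_def)
  define I where "I = {r \<in> carrier R. is_coboundary L N p t (\<lambda>S. r \<odot>\<^bsub>M\<^esub> m S)}"
  have I: "ideal I R"
  proof (rule idealI[OF R.ring_axioms])
    have sm: "r \<otimes> a \<in> I" if "a \<in> I" "r \<in> carrier R" for a r
    proof -
      have "is_coboundary L N p t (\<lambda>S. r \<odot>\<^bsub>M\<^esub> (a \<odot>\<^bsub>M\<^esub> m S))"
        using that mc by (intro is_coboundary_smult[OF N L, where m = "\<lambda>S. a \<odot>\<^bsub>M\<^esub> m S"]) (auto simp: I_def)
      then have "is_coboundary L N p t (\<lambda>S. (r \<otimes> a) \<odot>\<^bsub>M\<^esub> m S)"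
        by (rule is_coboundary_cong) (use that mc in \<open>auto simp: I_def smult_assoc1\<close>)
      then show ?thesis using that by (simp add: I_def)
    qed
    then show "\<And>a r. a \<in> I \<Longrightarrow> r \<in> carrier R \<Longrightarrow> r \<otimes> a \<in> I" "\<And>a r. a \<in> I \<Longrightarrow> r \<in> carrier R \<Longrightarrow> a \<otimes> r \<in> I"
      using R.m_comm by (auto simp: I_def)
    show "subgroup I (add_monoid R)"
    proof (rule R.add.subgroupI)
      show "I \<subseteq> carrier R" by (auto simp: I_def)
      have "is_coboundary L N p t (\<lambda>S. \<zero> \<odot>\<^bsub>M\<^esub> m S)" using mc submodule_zero[OF N] by (intro is_coboundary_mod[OF N L]) simp
      then show "I \<noteq> {}" unfolding I_def by blast
      show "\<ominus> a \<in> I" if a: "a \<in> I" for a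
      proof -
        have "\<ominus> a = (\<ominus> \<one>) \<otimes> a" using a by (simp add: R.l_minus I_def)
        then show ?thesis using sm[OF a, of "\<ominus> \<one>"] by simp
      qed
      show "a \<oplus> b \<in> I" if ab: "a \<in> I" "b \<in> I" for a b
      proof -
        have "is_coboundary L N p t (\<lambda>S. a \<odot>\<^bsub>M\<^esub> m S \<oplus>\<^bsub>M\<^esub> b \<odot>\<^bsub>M\<^esub> m S)"
          using ab mc by (intro is_coboundary_add[OF N L]) (auto simp: I_def)
        then have "is_coboundary L N p t (\<lambda>S. (a \<oplus> b) \<odot>\<^bsub>M\<^esub> m S)"
          by (rule is_coboundary_cong) (use ab mc in \<open>auto simp: I_def smult_l_distr\<close>)
        then show ?thesis using ab by (simp add: I_def)
      qed
    qed
  qed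
  have "\<exists>e::nat. x [^] e \<in> I" if x: "x \<in> set xs" for x
  proof -
    obtain i where i: "i < length xs" "x = xs ! i" using x by (auto simp: in_set_conv_nth)
    have xc: "x \<in> carrier R" using x xs_closed by auto
    have "is_coboundary L N p t (\<lambda>S. x [^] t \<odot>\<^bsub>M\<^esub> m S)"
    proof (rule is_coboundary_koszul_diff[OF N L])
      show "koszul_homotopy i m S \<in> L" if S: "S \<in> idx (p - 1)" for S
        using m S idx_insert[OF S i(1)] submodule_zero[OF L]
        by (auto simp: koszul_homotopy_def is_cocycle_def intro!: submoduleE(4)[OF L])
      fix S assume S: "S \<in> idx p"
      have koszul_homotopy: "koszul_homotopy i (koszul_diff t m) S \<in> N"
        using m S idx_insert[OF S i(1)] submodule_zero[OF N]
        by (auto simp: koszul_homotopy_def is_cocycle_def intro!: submoduleE(4)[OF N])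
      have c: "koszul_diff t (koszul_homotopy i m) S \<in> carrier M"
        using mc idx_insert[OF _ i(1), of _ "p - 1"] by (intro koszul_diff_closed[OF S]) (auto simp: koszul_homotopy_def)
      have "mcong N (koszul_diff t (koszul_homotopy i m) S \<oplus>\<^bsub>M\<^esub> koszul_homotopy i (koszul_diff t m) S) (koszul_diff t (koszul_homotopy i m) S \<oplus>\<^bsub>M\<^esub> \<zero>\<^bsub>M\<^esub>)"
        using c koszul_homotopy mcong_zero submodule_carrier[OF N] mcong_refl[OF N] by (intro mcong_add[OF N]) auto
      then show "mcong N (x [^] t \<odot>\<^bsub>M\<^esub> m S) (koszul_diff t (koszul_homotopy i m) S)"
        using koszul_diff_koszul_homotopy[of S p m i t, OF S mc i(1)] c i(2) by simp
    qed
    then show ?thesis using xc by (auto simp: I_def)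
  qed
  then obtain e :: nat where "y [^] e \<in> I" using R.pow_mem_if_gens[OF I xs_closed _ y] by blast
  then show ?thesis by (auto simp: I_def)
qed

end

section \<open>Vanishing above the dimension and below the depth\<close>

context graded_koszul
begin

lemma vanishes_refl:
  assumes "graded_sub pr N"
  shows "vanishes pr N N p j"
  unfolding vanishes_def using graded_subD(1)[OF assms] by (auto simp: is_cocycle_def intro!: is_coboundary_mod)

text \<open>Some power of \<open>y\<close> kills the class of \<open>m\<close>, and its factors are
  cancelled one at a time by \<open>is_coboundary_cancel\<close>. Each factor raises the degree by
  \<open>d\<close>, so the kernel and the cokernel have to vanish along the whole progression j + k
  d.\<close>

lemma vanishes_torsion:
  assumes N: "graded_sub pr N" and L: "graded_sub pr L" and y: "homog_elt pr d y" and NL: "N \<subseteq> L"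
    and yI: "y \<in> Idl (set xs)"
    and V1: "\<And>k. vanishes pr (colon N L y) N p (j + int k * d)"
    and V2: "\<And>k. vanishes pr L (padd N L y) (p - 1) (j + int k * d + d)"
  shows "vanishes pr L N p j"
  unfolding vanishes_def
proof (intro allI impI)
  note sN = graded_subD(1)[OF N] and sL = graded_subD(1)[OF L] and yc = homog_eltD(1)[OF y]
  have descend: "is_coboundary L N p t m"
    if "is_coboundary L N p t (\<lambda>S. y [^] e \<odot>\<^bsub>M\<^esub> m S)" "is_cocycle L N p t m" "is_homogeneous pr p (j + int k * d) t m" for e k :: nat and t m
    using that
  proof (induction e arbitrary: k m)
    case 0
    have "m S \<in> carrier M" if "S \<in> idx p" for S
      using 0(2) that L graded_sub_carrier by (auto simp: is_cocycle_def)
    with 0(1) show ?case by (auto intro: is_coboundary_cong)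
  next
    case (Suc e)
    have mc: "m S \<in> carrier M" if "S \<in> idx p" for S
      using Suc.prems(2) that L graded_sub_carrier by (auto simp: is_cocycle_def)
    have "is_coboundary L N p t (\<lambda>S. y [^] e \<odot>\<^bsub>M\<^esub> (y \<odot>\<^bsub>M\<^esub> m S))"
      by (rule is_coboundary_cong[OF Suc.prems(1)]) (use mc yc in \<open>simp add: smult_assoc1\<close>)
    moreover have "is_cocycle L N p t (\<lambda>S. y \<odot>\<^bsub>M\<^esub> m S)"
      unfolding is_cocycle_def
    proof (intro conjI ballI)
      show "y \<odot>\<^bsub>M\<^esub> m S \<in> L" if "S \<in> idx p" for S
        using Suc.prems(2) that yc by (auto simp: is_cocycle_def intro!: submoduleE(4)[OF sL])
      fix S assume S: "S \<in> idx (p + 1)"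
      have "koszul_diff t (\<lambda>S. y \<odot>\<^bsub>M\<^esub> m S) S = y \<odot>\<^bsub>M\<^esub> koszul_diff t m S" using mc yc by (intro koszul_diff_smult[OF S]) auto
      then show "koszul_diff t (\<lambda>S. y \<odot>\<^bsub>M\<^esub> m S) S \<in> N"
        using Suc.prems(2) S yc by (auto simp: is_cocycle_def intro!: submoduleE(4)[OF sN])
    qed
    moreover have "is_homogeneous pr p (j + int (Suc k) * d) t (\<lambda>S. y \<odot>\<^bsub>M\<^esub> m S)"
      unfolding is_homogeneous_def
    proof
      fix S assume S: "S \<in> idx p"
      show "pr (j + int (Suc k) * d + int t * p) (y \<odot>\<^bsub>M\<^esub> m S) = y \<odot>\<^bsub>M\<^esub> m S"
        using homog_eltD(2)[OF y mc[OF S], of "j + int k * d + int t * p"] Suc.prems(3) S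
        by (simp add: is_homogeneous_def algebra_simps)
    qed
    ultimately have "is_coboundary L N p t (\<lambda>S. y \<odot>\<^bsub>M\<^esub> m S)" by (rule Suc.IH)
    then show ?case
      using is_coboundary_cancel[OF N L y NL V1 V2 Suc.prems(2,3)] by simp
  qed
  fix t m assume m: "is_cocycle L N p t m" "is_homogeneous pr p j t m"
  obtain e :: nat where "is_coboundary L N p t (\<lambda>S. y [^] e \<odot>\<^bsub>M\<^esub> m S)" using is_coboundary_torsion[OF sN sL NL m(1) yI] by blast
  then show "is_coboundary L N p t m" using descend[of t e m 0] m by simp
qed

end

text \<open>Chains of primes of R above \<open>I\<close> replace chains in R/I, so that the
  induction over ideals stays in one ring. \<open>krull_dim_Quot_ge\<close> links them to
  \<open>krull_dim\<close>.\<close>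

definition prime_chain :: "('a, 'm) ring_scheme \<Rightarrow> 'a set \<Rightarrow> nat \<Rightarrow> bool" where
  "prime_chain R I n \<longleftrightarrow>
     (\<exists>P. (\<forall>i\<le>n. primeideal (P i) R \<and> I \<subseteq> P i) \<and> (\<forall>i<n. P i \<subset> P (Suc i)))"

lemma prime_chain_mono: "prime_chain R J n \<Longrightarrow> I \<subseteq> J \<Longrightarrow> prime_chain R I n"
  unfolding prime_chain_def by blast

lemma prime_chain_0: "primeideal I R \<Longrightarrow> prime_chain R I 0"
  unfolding prime_chain_def by (intro exI[of _ "\<lambda>_. I"]) simp

lemma prime_chain_Suc:
  assumes "primeideal I R" "prime_chain R J n" "I \<subset> J"
  shows "prime_chain R I (Suc n)"
proof -
  obtain P where P: "\<forall>i\<le>n. primeideal (P i) R \<and> J \<subseteq> P i" "\<forall>i<n. P i \<subset> P (Suc i)"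
    using assms(2) unfolding prime_chain_def by blast
  let ?Q = "\<lambda>i. case i of 0 \<Rightarrow> I | Suc k \<Rightarrow> P k"
  have "primeideal (?Q i) R \<and> I \<subseteq> ?Q i" if "i \<le> Suc n" for i
    using that assms P(1) by (cases i) auto
  moreover have "?Q i \<subset> ?Q (Suc i)" if "i < Suc n" for i
  proof (cases i)
    case 0 then show ?thesis using assms(3) P(1) by auto
  next
    case (Suc k) then show ?thesis using P(2) that by auto
  qed
  ultimately show ?thesis unfolding prime_chain_def by blast
qed

context module
begin

definition adj :: "'c set \<Rightarrow> 'c \<Rightarrow> 'c set" where
  "adj N v = {n \<oplus>\<^bsub>M\<^esub> r \<odot>\<^bsub>M\<^esub> v | n r. n \<in> N \<and> r \<in> carrier R}"

definition elt_colon :: "'c set \<Rightarrow> 'c \<Rightarrow> 'a set" where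
  "elt_colon N v = {r \<in> carrier R. r \<odot>\<^bsub>M\<^esub> v \<in> N}"

lemma adjI: "n \<in> N \<Longrightarrow> r \<in> carrier R \<Longrightarrow> n \<oplus>\<^bsub>M\<^esub> r \<odot>\<^bsub>M\<^esub> v \<in> adj N v"
  unfolding adj_def by blast

lemma adj_submodule:
  assumes N: "submodule N R M" and v: "v \<in> carrier M"
  shows "submodule (adj N v) R M"
proof (rule submoduleI)
  note c = submodule_carrier[OF N]
  show "adj N v \<subseteq> carrier M" using c v by (auto simp: adj_def)
  show "\<zero>\<^bsub>M\<^esub> \<in> adj N v" using adjI[OF submodule_zero[OF N] R.zero_closed, of v] v by simp
  show "\<ominus>\<^bsub>M\<^esub> a \<in> adj N v" if a: "a \<in> adj N v" for a
  proof -
    obtain n r where nr: "a = n \<oplus>\<^bsub>M\<^esub> r \<odot>\<^bsub>M\<^esub> v" "n \<in> N" "r \<in> carrier R" using a by (auto simp: adj_def)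
    have "\<ominus>\<^bsub>M\<^esub> a = \<ominus>\<^bsub>M\<^esub> n \<oplus>\<^bsub>M\<^esub> (\<ominus> r) \<odot>\<^bsub>M\<^esub> v" using nr c v by (simp add: M.minus_add smult_l_minus)
    then show ?thesis using nr adjI[of "\<ominus>\<^bsub>M\<^esub> n" N "\<ominus> r" v] submoduleE(3)[OF N] by simp
  qed
  show "a \<oplus>\<^bsub>M\<^esub> b \<in> adj N v" if ab: "a \<in> adj N v" "b \<in> adj N v" for a b
  proof -
    obtain n r where nr: "a = n \<oplus>\<^bsub>M\<^esub> r \<odot>\<^bsub>M\<^esub> v" "n \<in> N" "r \<in> carrier R" using ab by (auto simp: adj_def)
    obtain n' r' where nr': "b = n' \<oplus>\<^bsub>M\<^esub> r' \<odot>\<^bsub>M\<^esub> v" "n' \<in> N" "r' \<in> carrier R" using ab by (auto simp: adj_def)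
    have "a \<oplus>\<^bsub>M\<^esub> b = (n \<oplus>\<^bsub>M\<^esub> n') \<oplus>\<^bsub>M\<^esub> (r \<oplus> r') \<odot>\<^bsub>M\<^esub> v" using nr nr' c v by (simp add: smult_l_distr M.a_ac)
    then show ?thesis using nr nr' adjI[of "n \<oplus>\<^bsub>M\<^esub> n'" N "r \<oplus> r'" v] submoduleE(5)[OF N] by simp
  qed
  show "s \<odot>\<^bsub>M\<^esub> a \<in> adj N v" if s: "s \<in> carrier R" and a: "a \<in> adj N v" for s a
  proof -
    obtain n r where nr: "a = n \<oplus>\<^bsub>M\<^esub> r \<odot>\<^bsub>M\<^esub> v" "n \<in> N" "r \<in> carrier R" using a by (auto simp: adj_def)
    have "s \<odot>\<^bsub>M\<^esub> a = s \<odot>\<^bsub>M\<^esub> n \<oplus>\<^bsub>M\<^esub> (s \<otimes> r) \<odot>\<^bsub>M\<^esub> v" using nr c v s by (simp add: smult_r_distr smult_assoc1)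
    then show ?thesis using nr s adjI[of "s \<odot>\<^bsub>M\<^esub> n" N "s \<otimes> r" v] submoduleE(4)[OF N] by simp
  qed
qed

lemma adj_incl: "submodule N R M \<Longrightarrow> v \<in> carrier M \<Longrightarrow> N \<subseteq> adj N v"
  using adjI[of _ N \<zero> v] submodule_carrier[of N] by fastforce

lemma adj_self: "submodule N R M \<Longrightarrow> v \<in> carrier M \<Longrightarrow> v \<in> adj N v"
  using adjI[of "\<zero>\<^bsub>M\<^esub>" N \<one> v] submodule_zero by fastforce

lemma adj_subset: "submodule K R M \<Longrightarrow> N \<subseteq> K \<Longrightarrow> v \<in> K \<Longrightarrow> adj N v \<subseteq> K"
  by (auto simp: adj_def intro!: submoduleE(4,5))

lemma elt_colon_ideal:
  assumes N: "submodule N R M" and v: "v \<in> carrier M"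
  shows "ideal (elt_colon N v) R"
proof (rule idealI[OF R.ring_axioms])
  show "subgroup (elt_colon N v) (add_monoid R)"
  proof (rule R.add.subgroupI)
    show "elt_colon N v \<subseteq> carrier R" by (auto simp: elt_colon_def)
    have "\<zero> \<in> elt_colon N v" using v submodule_zero[OF N] by (simp add: elt_colon_def)
    then show "elt_colon N v \<noteq> {}" by blast
  qed (use v submoduleE(3,5)[OF N] in \<open>auto simp: elt_colon_def smult_l_minus smult_l_distr\<close>)
  fix a r assume ar: "a \<in> elt_colon N v" "r \<in> carrier R"
  then show "r \<otimes> a \<in> elt_colon N v" using v submoduleE(4)[OF N] by (auto simp: elt_colon_def smult_assoc1)
  then show "a \<otimes> r \<in> elt_colon N v" using ar by (simp add: elt_colon_def R.m_comm)
qed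

end

text \<open>The order is reversed, larger ideals being smaller in the relation, which is the form
  that well-founded induction takes.\<close>

definition acc_ideals :: "('a, 'm) ring_scheme \<Rightarrow> bool" where
  "acc_ideals R \<longleftrightarrow> wf {(J, I). ideal I R \<and> ideal J R \<and> I \<subset> J}"

context koszul
begin

text \<open>With identity projections every cochain is homogeneous of every degree, so the degree 0
  is only a placeholder.\<close>

abbreviation vanishes_ungraded :: "'b set \<Rightarrow> 'b set \<Rightarrow> int \<Rightarrow> bool" where
  "vanishes_ungraded L N p \<equiv> vanishes (\<lambda>_ m. m) L N p 0"

lemma is_homogeneous_ungraded: "is_homogeneous (\<lambda>_ m. m) p j t m"
  by (simp add: is_homogeneous_def)

text \<open>Homogeneity occurs only as a hypothesis on cocycles, and the conclusion
  \<open>is_coboundary\<close> does not mention the grading.\<close>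

lemma vanishes_ungraded_imp: "vanishes_ungraded L N p \<Longrightarrow> vanishes pr L N p j"
  unfolding vanishes_def using is_homogeneous_ungraded by blast

lemma graded_sub_ungraded: "submodule N R M \<Longrightarrow> graded_sub (\<lambda>_ m. m) N"
  by (simp add: graded_sub_def)

lemma homog_elt_ungraded: "r \<in> carrier R \<Longrightarrow> homog_elt (\<lambda>_ m. m) d r"
  by (simp add: homog_elt_def)

lemma graded_koszul_ungraded: "graded_koszul R M xs (\<lambda>_ m. m)"
  using koszul_axioms xs_closed
  by (auto simp: graded_koszul_def graded_koszul_axioms_def grading_proj_def homog_elt_def)

text \<open>The torsion argument with zero kernel: for a nonzerodivisor \<open>y\<close> on L/N,
  vanishing for the cokernel one cohomological degree lower is enough. With \<open>y\<close> given
  degree 0 the whole progression of hypotheses collapses to a single one.\<close>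

lemma vanishes_ungraded_nonzerodiv:
  assumes N: "submodule N R M" and L: "submodule L R M" and NL: "N \<subseteq> L" and y: "y \<in> Idl (set xs)"
    and reg: "colon N L y = N" and V: "vanishes_ungraded L (padd N L y) (p - 1)"
  shows "vanishes_ungraded L N p"
proof -
  interpret T: graded_koszul R M xs "\<lambda>_ m. m" by (rule graded_koszul_ungraded)
  have yc: "y \<in> carrier R" using y R.genideal_ideal[OF xs_closed] ideal.Icarr by metis
  show ?thesis
  proof (rule T.vanishes_torsion[OF _ _ homog_elt_ungraded[OF yc, of 0] NL y])
    fix k :: nat
    show "vanishes (\<lambda>_ m. m) (colon N L y) N p (0 + int k * 0)"
      unfolding reg by (rule T.vanishes_refl[OF graded_sub_ungraded[OF N]])
    show "vanishes (\<lambda>_ m. m) L (padd N L y) (p - 1) (0 + int k * 0 + 0)" using V by simp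
  qed (simp_all add: graded_sub_ungraded N L)
qed

text \<open>
  Noetherian induction on \<open>I = (N : v)\<close>, where \<open>(N + Rv)/N\<close> is isomorphic to \<open>R/I\<close>. If \<open>I\<close> is not prime, two larger
  ideals give a filtration. If \<open>I\<close> is prime, either the generators act as zero, or one of them is a
  nonzerodivisor on \<open>R/I\<close> and passing to its cokernel drops the dimension.
\<close>

lemma cyclic_vanishes:
  assumes acc: "acc_ideals R" and N: "submodule N R M" and v: "v \<in> carrier M"
    and ch: "\<not> prime_chain R (elt_colon N v) p"
  shows "vanishes_ungraded (adj N v) N (int p)"
  using N v ch
proof (induction "elt_colon N v" arbitrary: N v p rule: wf_induct_rule[OF acc[unfolded acc_ideals_def]])
  case (1 N v p)
  interpret T: graded_koszul R M xs "\<lambda>_ m. m" by (rule graded_koszul_ungraded)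
  note N = 1(2) and v = 1(3) and ch = 1(4)
  have IH: "vanishes_ungraded (adj N' v') N' (int p')"
    if "elt_colon N v \<subset> elt_colon N' v'" "submodule N' R M" "v' \<in> carrier M"
      "\<not> prime_chain R (elt_colon N' v') p'" for N' v' p'
    using 1(1) that N v elt_colon_ideal by blast
  define I where "I = elt_colon N v"
  have I: "ideal I R" unfolding I_def using N v by (rule elt_colon_ideal)
  have A: "submodule (adj N v) R M" using N v by (rule adj_submodule)
  have NA: "N \<subseteq> adj N v" using N v by (rule adj_incl)
  note Nc = submodule_carrier[OF N]
  consider "I = carrier R" | "primeideal I R" | "I \<noteq> carrier R" "\<not> primeideal I R" by blast
  then show ?case
  proof cases
    case 1
    then have "\<one> \<in> I" by simp
    then have "v \<in> N" using v by (simp add: I_def elt_colon_def)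
    then have "adj N v = N" using NA adj_subset[OF N] by blast
    then show ?thesis using T.vanishes_refl[OF graded_sub_ungraded[OF N]] by simp
  next
    case 2
    \<comment> \<open>The prime \<open>I\<close> alone is a chain of length 0.\<close>
    then have p: "p \<noteq> 0" using ch prime_chain_0 unfolding I_def by metis
    show ?thesis
    proof (cases "set xs \<subseteq> I")
      case True
      show ?thesis unfolding vanishes_def
      proof (intro allI impI)
        fix t m assume m: "is_cocycle (adj N v) N (int p) t m"
        have mc: "m S \<in> carrier M" if "S \<in> idx (int p)" for S
          using m that submodule_carrier[OF A] by (auto simp: is_cocycle_def)
        \<comment> \<open>As \<open>p\<close> is positive, \<open>S\<close> is nonempty, so
          \<open>xprod S\<close> lies in \<open>I\<close> and kills \<open>v\<close> modulo
          \<open>N\<close>. A single transition already makes the cochain zero modulo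
          \<open>N\<close>.\<close>
        have "is_coboundary (adj N v) N (int p) (t + 1) (\<lambda>S. xprod S [^] (1::nat) \<odot>\<^bsub>M\<^esub> m S)"
        proof (rule is_coboundary_mod[OF N A])
          fix S assume S: "S \<in> idx (int p)"
          then have "card S \<noteq> 0" using p by (simp add: idx_def)
          then obtain i where i: "i \<in> S" by fastforce
          have "i < length xs" using S i by (auto simp: idx_def)
          then have xi: "xs ! i \<in> I" using True nth_mem by blast
          have "xprod S \<in> I" unfolding xprod_remove[OF S i]
            using xi xprod_closed[OF idx_diff[OF S i]] ideal.I_l_closed[OF I] by blast
          then have xI: "xprod S \<odot>\<^bsub>M\<^esub> v \<in> N" by (simp add: I_def elt_colon_def)
          obtain n r where nr: "m S = n \<oplus>\<^bsub>M\<^esub> r \<odot>\<^bsub>M\<^esub> v" "n \<in> N" "r \<in> carrier R"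
            using m S by (auto simp: is_cocycle_def adj_def)
          have "xprod S \<odot>\<^bsub>M\<^esub> m S = xprod S \<odot>\<^bsub>M\<^esub> n \<oplus>\<^bsub>M\<^esub> r \<odot>\<^bsub>M\<^esub> (xprod S \<odot>\<^bsub>M\<^esub> v)"
            using nr Nc v xprod_closed[OF S] by (simp add: smult_r_distr R.m_comm flip: smult_assoc1)
          also have "\<dots> \<in> N" using nr xI xprod_closed[OF S] submoduleE(4,5)[OF N] by simp
          finally show "xprod S [^] (1::nat) \<odot>\<^bsub>M\<^esub> m S \<in> N" using xprod_closed[OF S] by simp
        qed
        then show "is_coboundary (adj N v) N (int p) t m" using is_coboundary_twist mc by blast
      qed
    next
      case False
      then obtain x where x: "x \<in> set xs" "x \<notin> I" by blast
      have xc: "x \<in> carrier R" using x xs_closed by auto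
      have xI: "x \<in> Idl (set xs)" using R.genideal_self[OF xs_closed] x by auto
      define w where "w = x \<odot>\<^bsub>M\<^esub> v"
      have w: "w \<in> carrier M" using xc v by (simp add: w_def)
      \<comment> \<open>The submodule N + Rxv is what \<open>x\<close> makes of (N + Rv)/N, so
        \<open>adj N v\<close> modulo \<open>N'\<close> is the cokernel of \<open>x\<close>. It is
        again cyclic on \<open>v\<close>, with the larger ideal
        \<open>elt_colon N' v\<close>.\<close>
      define N' where "N' = adj N w"
      have N': "submodule N' R M" unfolding N'_def using N w by (rule adj_submodule)
      have NN': "N \<subseteq> N'" unfolding N'_def using N w by (rule adj_incl)
      have "x \<in> elt_colon N' v" using adj_self[OF N w] xc by (simp add: elt_colon_def N'_def w_def)
      then have sub: "I \<subset> elt_colon N' v" using NN' x by (auto simp: I_def elt_colon_def)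
      obtain q where q: "p = Suc q" using p not0_implies_Suc by blast
      \<comment> \<open>Prepending the prime \<open>I\<close> to a chain of length \<open>q\<close>
        above the strictly larger ideal would give a chain of length \<open>p\<close> above
        \<open>I\<close>.\<close>
      have "\<not> prime_chain R (elt_colon N' v) q"
        using prime_chain_Suc[OF 2 _ sub] ch unfolding q I_def by blast
      then have V: "vanishes_ungraded (adj N' v) N' (int q)" using IH sub N' v unfolding I_def by blast
      have e1: "padd N (adj N v) x = N'"
      proof (intro equalityI subsetI)
        fix a assume "a \<in> padd N (adj N v) x"
        then obtain n n' r where a: "a = n \<oplus>\<^bsub>M\<^esub> x \<odot>\<^bsub>M\<^esub> (n' \<oplus>\<^bsub>M\<^esub> r \<odot>\<^bsub>M\<^esub> v)" "n \<in> N" "n' \<in> N" "r \<in> carrier R"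
          by (auto simp: padd_def adj_def)
        have "a = (n \<oplus>\<^bsub>M\<^esub> x \<odot>\<^bsub>M\<^esub> n') \<oplus>\<^bsub>M\<^esub> r \<odot>\<^bsub>M\<^esub> w"
          using a Nc v xc by (simp add: w_def smult_r_distr M.a_assoc R.m_comm flip: smult_assoc1)
        then show "a \<in> N'" using a xc submoduleE(4,5)[OF N] unfolding N'_def by (auto intro!: adjI)
      next
        fix a assume "a \<in> N'"
        then obtain n r where a: "a = n \<oplus>\<^bsub>M\<^esub> r \<odot>\<^bsub>M\<^esub> w" "n \<in> N" "r \<in> carrier R" by (auto simp: N'_def adj_def)
        have "a = n \<oplus>\<^bsub>M\<^esub> x \<odot>\<^bsub>M\<^esub> (\<zero>\<^bsub>M\<^esub> \<oplus>\<^bsub>M\<^esub> r \<odot>\<^bsub>M\<^esub> v)"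
          using a Nc v xc by (simp add: w_def R.m_comm flip: smult_assoc1)
        then show "a \<in> padd N (adj N v) x" using a adjI[OF submodule_zero[OF N] a(3), of v] unfolding padd_def by blast
      qed
      have e2: "adj N' v = adj N v"
      proof (intro equalityI)
        have "w \<in> adj N v" using submoduleE(4)[OF A xc adj_self[OF N v]] by (simp add: w_def)
        then have "N' \<subseteq> adj N v" unfolding N'_def using adj_subset[OF A NA] by blast
        then show "adj N' v \<subseteq> adj N v" using adj_subset[OF A] adj_self[OF N v] by blast
        show "adj N v \<subseteq> adj N' v" using NN' unfolding adj_def by blast
      qed
      have e3: "colon N (adj N v) x = N"
      proof (intro equalityI subsetI)
        show "a \<in> colon N (adj N v) x" if "a \<in> N" for a
          using that NA xc submoduleE(4)[OF N] by (auto simp: colon_def)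
        fix a assume a: "a \<in> colon N (adj N v) x"
        then obtain n r where nr: "a = n \<oplus>\<^bsub>M\<^esub> r \<odot>\<^bsub>M\<^esub> v" "n \<in> N" "r \<in> carrier R" "x \<odot>\<^bsub>M\<^esub> a \<in> N"
          by (auto simp: colon_def adj_def)
        have c: "n \<in> carrier M" using nr Nc by blast
        have "(x \<otimes> r) \<odot>\<^bsub>M\<^esub> v = x \<odot>\<^bsub>M\<^esub> a \<ominus>\<^bsub>M\<^esub> x \<odot>\<^bsub>M\<^esub> n"
          using nr(1,3) c v xc
          by (simp add: smult_r_distr M.minus_eq M.a_comm[of "x \<odot>\<^bsub>M\<^esub> n"] M.a_assoc M.r_neg smult_assoc1)
        also have "\<dots> \<in> N" using nr xc submoduleE(4)[OF N] submodule_minus[OF N] by simp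
        finally have "x \<otimes> r \<in> I" using xc nr by (simp add: I_def elt_colon_def)
        then have "r \<in> I" using primeideal.I_prime[OF 2 xc nr(3)] x by blast
        then show "a \<in> N" using nr submoduleE(5)[OF N] by (simp add: I_def elt_colon_def)
      qed
      show ?thesis
        by (rule vanishes_ungraded_nonzerodiv[OF N A NA xI e3]) (use V q in \<open>simp add: e1 e2\<close>)
    qed
  next
    case 3
    then have "\<not> (\<forall>a\<in>carrier R. \<forall>b\<in>carrier R. a \<otimes> b \<in> I \<longrightarrow> a \<in> I \<or> b \<in> I)"
      using I R.cring_axioms by (auto intro!: primeidealI)
    then obtain a b where ab: "a \<in> carrier R" "b \<in> carrier R" "a \<otimes> b \<in> I" "a \<notin> I" "b \<notin> I" by blast
    \<comment> \<open>Insert N + Rav between \<open>N\<close> and N + Rv. The ideal of the lower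
      layer gains \<open>b\<close>, that of the upper layer gains \<open>a\<close>, so the induction
      hypothesis applies to both.\<close>
    define w where "w = a \<odot>\<^bsub>M\<^esub> v"
    have w: "w \<in> carrier M" using ab v by (simp add: w_def)
    define N' where "N' = adj N w"
    have N': "submodule N' R M" unfolding N'_def using N w by (rule adj_submodule)
    have NN': "N \<subseteq> N'" unfolding N'_def using N w by (rule adj_incl)
    have "a \<in> elt_colon N' v" using adj_self[OF N w] ab by (simp add: elt_colon_def N'_def w_def)
    then have sub1: "I \<subset> elt_colon N' v" using NN' ab by (auto simp: I_def elt_colon_def)
    have "b \<in> elt_colon N w" using ab v by (simp add: I_def elt_colon_def w_def R.m_comm flip: smult_assoc1)
    moreover have "I \<subseteq> elt_colon N w"
    proof
      fix r assume r: "r \<in> I"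
      have "r \<odot>\<^bsub>M\<^esub> w = a \<odot>\<^bsub>M\<^esub> (r \<odot>\<^bsub>M\<^esub> v)" using r ab v by (simp add: I_def elt_colon_def w_def R.m_comm flip: smult_assoc1)
      then show "r \<in> elt_colon N w" using r ab submoduleE(4)[OF N] by (simp add: I_def elt_colon_def)
    qed
    ultimately have sub2: "I \<subset> elt_colon N w" using ab by blast
    have e2: "adj N' v = adj N v"
    proof (intro equalityI)
      have "w \<in> adj N v" using submoduleE(4)[OF A ab(1) adj_self[OF N v]] by (simp add: w_def)
      then have "N' \<subseteq> adj N v" unfolding N'_def using adj_subset[OF A NA] by blast
      then show "adj N' v \<subseteq> adj N v" using adj_subset[OF A] adj_self[OF N v] by blast
      show "adj N v \<subseteq> adj N' v" using NN' unfolding adj_def by blast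
    qed
    have V1: "vanishes_ungraded N' N (int p)"
      unfolding N'_def using sub2 ch prime_chain_mono unfolding I_def by (intro IH[OF _ N w]) blast+
    have V2: "vanishes_ungraded (adj N v) N' (int p)"
      unfolding e2[symmetric] using sub1 ch prime_chain_mono unfolding I_def by (intro IH[OF _ N' v]) blast+
    have "N' \<subseteq> adj N v" using e2 adj_incl[OF N' v] by simp
    then show ?thesis
      using T.vanishes_trans[OF graded_sub_ungraded[OF N] graded_sub_ungraded[OF N'] graded_sub_ungraded[OF A] NN' _ V1 V2] by blast
  qed
qed

text \<open>A cochain has finitely many entries, so it lives in a submodule of \<open>K\<close>
  obtained by adjoining them one at a time. Each layer is cyclic, and its ideal contains the
  annihilator of \<open>K\<close>, hence admits no longer chains of primes.\<close>

theorem vanishes_above_dim: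
  assumes acc: "acc_ideals R" and K: "submodule K R M"
    and ch: "\<not> prime_chain R {r \<in> carrier R. \<forall>m\<in>K. r \<odot>\<^bsub>M\<^esub> m = \<zero>\<^bsub>M\<^esub>} p"
  shows "vanishes_ungraded K {\<zero>\<^bsub>M\<^esub>} (int p)"
proof -
  interpret T: graded_koszul R M xs "\<lambda>_ m. m" by (rule graded_koszul_ungraded)
  have fin: "\<exists>N. submodule N R M \<and> F \<subseteq> N \<and> N \<subseteq> K \<and> vanishes_ungraded N {\<zero>\<^bsub>M\<^esub>} (int p)" if "finite F" "F \<subseteq> K" for F
    using that
  proof (induction F rule: finite_induct)
    case empty
    have "vanishes_ungraded {\<zero>\<^bsub>M\<^esub>} {\<zero>\<^bsub>M\<^esub>} (int p)" by (rule T.vanishes_refl[OF graded_sub_ungraded[OF zero_submodule]])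
    then show ?case using zero_submodule submodule_zero[OF K] by blast
  next
    case (insert v F)
    then obtain N where N: "submodule N R M" "F \<subseteq> N" "N \<subseteq> K" "vanishes_ungraded N {\<zero>\<^bsub>M\<^esub>} (int p)" by auto
    have vK: "v \<in> K" and v: "v \<in> carrier M" using insert.prems submodule_carrier[OF K] by auto
    have A: "submodule (adj N v) R M" using N(1) v by (rule adj_submodule)
    have NA: "N \<subseteq> adj N v" using N(1) v by (rule adj_incl)
    have "{r \<in> carrier R. \<forall>m\<in>K. r \<odot>\<^bsub>M\<^esub> m = \<zero>\<^bsub>M\<^esub>} \<subseteq> elt_colon N v"
      using vK submodule_zero[OF N(1)] by (auto simp: elt_colon_def)
    then have "vanishes_ungraded (adj N v) N (int p)"
      using ch prime_chain_mono by (intro cyclic_vanishes[OF acc N(1) v]) blast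
    then have "vanishes_ungraded (adj N v) {\<zero>\<^bsub>M\<^esub>} (int p)"
      using T.vanishes_trans[OF graded_sub_ungraded[OF zero_submodule] graded_sub_ungraded[OF N(1)] graded_sub_ungraded[OF A] _ NA N(4)]
        submodule_zero[OF N(1)] by blast
    moreover have "adj N v \<subseteq> K" by (rule adj_subset[OF K N(3) vK])
    moreover have "insert v F \<subseteq> adj N v" using NA N(2) adj_self[OF N(1) v] by blast
    ultimately show ?case using A by blast
  qed
  show ?thesis unfolding vanishes_def
  proof (intro allI impI)
    fix t m assume m: "is_cocycle K {\<zero>\<^bsub>M\<^esub>} (int p) t m"
    then have "m ` idx (int p) \<subseteq> K" by (auto simp: is_cocycle_def)
    then obtain N where N: "submodule N R M" "m ` idx (int p) \<subseteq> N" "N \<subseteq> K" "vanishes_ungraded N {\<zero>\<^bsub>M\<^esub>} (int p)"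
      using fin[of "m ` idx (int p)"] finite_idx by blast
    have "is_coboundary N {\<zero>\<^bsub>M\<^esub>} (int p) t m"
      by (rule T.vanD[OF N(4)]) (use m N(2) is_homogeneous_ungraded in \<open>auto simp: is_cocycle_def\<close>)
    then show "is_coboundary K {\<zero>\<^bsub>M\<^esub>} (int p) t m" using is_coboundary_mono N(3) by blast
  qed
qed

text \<open>Induction runs backwards along the sequence. After the last element only negative
  cohomological degrees are claimed, where there are no cochains, and each nonzerodivisor taken back
  gains one degree.\<close>

theorem vanishes_below_depth:
  assumes N: "\<And>i. i \<le> l \<Longrightarrow> submodule (N i) R M"
    and y: "\<And>i. i < l \<Longrightarrow> y i \<in> Idl (set xs)"
    and reg: "\<And>i. i < l \<Longrightarrow> colon (N i) (carrier M) (y i) = N i"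
    and step: "\<And>i. i < l \<Longrightarrow> padd (N i) (carrier M) (y i) = N (Suc i)"
  shows "i \<le> l \<Longrightarrow> p < int (l - i) \<Longrightarrow> vanishes_ungraded (carrier M) (N i) p"
proof (induction "l - i" arbitrary: i p)
  case 0
  then have "idx p = {}" by (intro idx_neg) simp
  then show ?case unfolding vanishes_def is_coboundary_def using idx_neg[of "p - 1"] 0 by simp
next
  case (Suc k)
  then have i: "i < l" by simp
  have "vanishes_ungraded (carrier M) (N (Suc i)) (p - 1)" using Suc i by (intro Suc.hyps(1)) auto
  then show ?case
    using vanishes_ungraded_nonzerodiv[OF N carrier_is_submodule _ y[OF i] reg[OF i]] i step[OF i] submoduleE(1)[OF N[of i]] by simp
qed

end

section \<open>Ascending chains of ideals\<close>

context cring
begin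

text \<open>Ideals of a subring \<open>A\<close> as plain subsets of R, so that the basis theorem
  can climb through subrings of one fixed ring. Negatives are obtained by multiplication with -1 in
  \<open>A\<close>.\<close>

definition subideal :: "'a set \<Rightarrow> 'a set \<Rightarrow> bool" where
  "subideal A I \<longleftrightarrow> I \<subseteq> A \<and> \<zero> \<in> I \<and> (\<forall>a\<in>I. \<forall>b\<in>I. a \<oplus> b \<in> I) \<and> (\<forall>r\<in>A. \<forall>a\<in>I. r \<otimes> a \<in> I)"

definition noetherian_subring :: "'a set \<Rightarrow> bool" where
  "noetherian_subring A \<longleftrightarrow> (\<forall>I::nat \<Rightarrow> 'a set. (\<forall>n. subideal A (I n)) \<and> (\<forall>n. I n \<subseteq> I (Suc n)) \<longrightarrow> (\<exists>N. \<forall>n\<ge>N. I n = I N))"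

lemma subidealD:
  assumes "subideal A I"
  shows "I \<subseteq> A" "\<zero> \<in> I" "a \<in> I \<Longrightarrow> b \<in> I \<Longrightarrow> a \<oplus> b \<in> I" "r \<in> A \<Longrightarrow> a \<in> I \<Longrightarrow> r \<otimes> a \<in> I"
  using assms by (auto simp: subideal_def)

lemma subideal_minus:
  assumes "subring A R" "subideal A I" "a \<in> I" "b \<in> I"
  shows "a \<ominus> b \<in> I"
proof -
  have c: "a \<in> carrier R" "b \<in> carrier R"
    using assms subringE(1) subidealD(1) by blast+
  have "\<ominus> \<one> \<in> A" using subringE(3,5)[OF assms(1)] by blast
  then have "(\<ominus> \<one>) \<otimes> b \<in> I" using assms by (intro subidealD(4)[OF assms(2)]) auto
  then show ?thesis using assms c subidealD(3)[OF assms(2), of a "\<ominus> b"] by (simp add: l_minus minus_eq)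
qed

text \<open>\<open>pol A u n\<close> consists of the values at \<open>u\<close> of the polynomials of degree less than \<open>n\<close> over \<open>A\<close>.\<close>

primrec pol :: "'a set \<Rightarrow> 'a \<Rightarrow> nat \<Rightarrow> 'a set" where
  "pol A u 0 = {\<zero>}"
| "pol A u (Suc n) = {c \<oplus> a \<otimes> u [^] n | c a. c \<in> pol A u n \<and> a \<in> A}"

lemma polI: "c \<in> pol A u n \<Longrightarrow> a \<in> A \<Longrightarrow> c \<oplus> a \<otimes> u [^] n \<in> pol A u (Suc n)"
  by auto

definition adj_ring :: "'a set \<Rightarrow> 'a \<Rightarrow> 'a set" where
  "adj_ring A u = (\<Union>n. pol A u n)"

context
  fixes A u
  assumes A: "subring A R" and u: "u \<in> carrier R"
begin

lemma A_carrier: "a \<in> A \<Longrightarrow> a \<in> carrier R"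
  using subringE(1)[OF A] by blast

lemma pol_carrier: "c \<in> pol A u n \<Longrightarrow> c \<in> carrier R"
  using A_carrier u by (induction n arbitrary: c) auto

lemma pol_zero: "\<zero> \<in> pol A u n"
proof (induction n)
  case (Suc n)
  then show ?case using polI[OF Suc subringE(2)[OF A]] u by simp
qed simp

lemma pol_add: "c \<in> pol A u n \<Longrightarrow> d \<in> pol A u n \<Longrightarrow> c \<oplus> d \<in> pol A u n"
proof (induction n arbitrary: c d)
  case (Suc n)
  obtain c' a where c: "c = c' \<oplus> a \<otimes> u [^] n" "c' \<in> pol A u n" "a \<in> A" using Suc.prems by auto
  obtain d' b where d: "d = d' \<oplus> b \<otimes> u [^] n" "d' \<in> pol A u n" "b \<in> A" using Suc.prems by auto
  have "c \<oplus> d = (c' \<oplus> d') \<oplus> (a \<oplus> b) \<otimes> u [^] n"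
    using c d pol_carrier A_carrier u by (simp add: l_distr a_ac)
  then show ?case using polI[OF Suc.IH[OF c(2) d(2)] subringE(7)[OF A c(3) d(3)]] by simp
qed simp

lemma pol_mult_A: "r \<in> A \<Longrightarrow> c \<in> pol A u n \<Longrightarrow> r \<otimes> c \<in> pol A u n"
proof (induction n arbitrary: c)
  case 0
  then show ?case using A_carrier by simp
next
  case (Suc n)
  obtain c' a where c: "c = c' \<oplus> a \<otimes> u [^] n" "c' \<in> pol A u n" "a \<in> A" using Suc.prems by auto
  have "r \<otimes> c = r \<otimes> c' \<oplus> (r \<otimes> a) \<otimes> u [^] n"
    using c Suc.prems pol_carrier A_carrier u by (simp add: r_distr m_assoc)
  then show ?case using polI[OF Suc.IH[OF Suc.prems(1) c(2)] subringE(6)[OF A Suc.prems(1) c(3)]] by simp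
qed

lemma pol_Suc: "pol A u n \<subseteq> pol A u (Suc n)"
proof
  fix c assume "c \<in> pol A u n"
  then show "c \<in> pol A u (Suc n)"
    using polI[of c A u n \<zero>] subringE(2)[OF A] pol_carrier u by simp
qed

lemma pol_mono: "n \<le> m \<Longrightarrow> pol A u n \<subseteq> pol A u m"
  using pol_Suc by (rule lift_Suc_mono_le)

lemma pol_mult_u: "c \<in> pol A u n \<Longrightarrow> u \<otimes> c \<in> pol A u (Suc n)"
proof (induction n arbitrary: c)
  case 0
  then show ?case using pol_zero[of "Suc 0"] u by simp
next
  case (Suc n)
  obtain c' a where c: "c = c' \<oplus> a \<otimes> u [^] n" "c' \<in> pol A u n" "a \<in> A" using Suc.prems by auto
  have "u \<otimes> c = u \<otimes> c' \<oplus> a \<otimes> u [^] (Suc n)"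
    using c pol_carrier A_carrier u by (simp add: r_distr m_ac)
  then show ?case using polI[OF Suc.IH[OF c(2)] c(3)] by simp
qed

lemma adj_ring_carrier: "adj_ring A u \<subseteq> carrier R"
  using pol_carrier by (auto simp: adj_ring_def)

lemma adj_ring_add: "c \<in> adj_ring A u \<Longrightarrow> d \<in> adj_ring A u \<Longrightarrow> c \<oplus> d \<in> adj_ring A u"
proof -
  assume "c \<in> adj_ring A u" "d \<in> adj_ring A u"
  then obtain n m where "c \<in> pol A u n" "d \<in> pol A u m" by (auto simp: adj_ring_def)
  then have "c \<in> pol A u (max n m)" "d \<in> pol A u (max n m)"
    using pol_mono[of n "max n m"] pol_mono[of m "max n m"] by auto
  then show ?thesis using pol_add by (auto simp: adj_ring_def)
qed

lemma adj_ring_mult_pow: "c \<in> adj_ring A u \<Longrightarrow> u [^] (n::nat) \<otimes> c \<in> adj_ring A u"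
proof (induction n)
  case 0
  then show ?case using adj_ring_carrier by auto
next
  case (Suc n)
  then obtain m where "u [^] n \<otimes> c \<in> pol A u m" by (auto simp: adj_ring_def)
  then have "u \<otimes> (u [^] n \<otimes> c) \<in> adj_ring A u" using pol_mult_u unfolding adj_ring_def by blast
  then show ?case using u Suc.prems adj_ring_carrier by (auto simp: m_ac)
qed

lemma adj_ring_mult_A: "a \<in> A \<Longrightarrow> c \<in> adj_ring A u \<Longrightarrow> a \<otimes> c \<in> adj_ring A u"
  using pol_mult_A unfolding adj_ring_def by blast

lemma adj_ring_mult: "c \<in> adj_ring A u \<Longrightarrow> d \<in> adj_ring A u \<Longrightarrow> c \<otimes> d \<in> adj_ring A u"
proof -
  assume c: "c \<in> adj_ring A u" and d: "d \<in> adj_ring A u"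
  have dc: "d \<in> carrier R" using d adj_ring_carrier by auto
  have "c \<otimes> d \<in> adj_ring A u" if "c \<in> pol A u n" for n c
    using that
  proof (induction n arbitrary: c)
    case 0
    have "\<zero> \<in> adj_ring A u" using pol_zero[of 0] unfolding adj_ring_def by blast
    with 0 show ?case using dc by simp
  next
    case (Suc n)
    obtain c' a where c: "c = c' \<oplus> a \<otimes> u [^] n" "c' \<in> pol A u n" "a \<in> A" using Suc.prems by auto
    have "c \<otimes> d = c' \<otimes> d \<oplus> a \<otimes> (u [^] n \<otimes> d)"
      using c pol_carrier A_carrier u dc by (simp add: l_distr m_assoc)
    then show ?case using Suc.IH[OF c(2)] c(3) d adj_ring_mult_A adj_ring_mult_pow adj_ring_add by simp
  qed
  then show ?thesis using c by (auto simp: adj_ring_def)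
qed

lemma adj_ring_incl: "A \<subseteq> adj_ring A u"
proof
  fix a assume a: "a \<in> A"
  have "\<zero> \<oplus> a \<otimes> u [^] (0::nat) \<in> pol A u (Suc 0)" using a by (intro polI) auto
  then have "a \<in> pol A u (Suc 0)" using A_carrier[OF a] by simp
  then show "a \<in> adj_ring A u" unfolding adj_ring_def by blast
qed

lemma adj_ring_gen: "u \<in> adj_ring A u"
proof -
  have "\<one> \<in> adj_ring A u" using adj_ring_incl subringE(3)[OF A] by blast
  then show ?thesis using adj_ring_mult_pow[of \<one> 1] u by simp
qed

lemma adj_ring_subring: "subring (adj_ring A u) R"
proof (rule subringI)
  show "\<ominus> h \<in> adj_ring A u" if h: "h \<in> adj_ring A u" for h
  proof -
    have "\<ominus> \<one> \<in> A" using subringE(3,5)[OF A] by blast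
    then have "(\<ominus> \<one>) \<otimes> h \<in> adj_ring A u" using h by (rule adj_ring_mult_A)
    then show ?thesis using h adj_ring_carrier by (auto simp: l_minus)
  qed
qed (use adj_ring_carrier adj_ring_incl subringE(3)[OF A] adj_ring_add adj_ring_mult in auto)

definition lead :: "'a set \<Rightarrow> nat \<Rightarrow> 'a set" where
  "lead I n = {a \<in> A. \<exists>c\<in>pol A u n. c \<oplus> a \<otimes> u [^] n \<in> I}"

lemma lead_subideal:
  assumes "subideal (adj_ring A u) I"
  shows "subideal A (lead I n)"
  unfolding subideal_def
proof (intro conjI ballI)
  show "lead I n \<subseteq> A" by (auto simp: lead_def)
  have "\<zero> \<oplus> \<zero> \<otimes> u [^] n \<in> I" using subidealD(2)[OF assms] u by simp
  then show "\<zero> \<in> lead I n" using pol_zero subringE(2)[OF A] unfolding lead_def by blast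
  show "a \<oplus> b \<in> lead I n" if ab: "a \<in> lead I n" "b \<in> lead I n" for a b
  proof -
    obtain c d where c: "a \<in> A" "c \<in> pol A u n" "c \<oplus> a \<otimes> u [^] n \<in> I"
      and d: "b \<in> A" "d \<in> pol A u n" "d \<oplus> b \<otimes> u [^] n \<in> I" using ab by (auto simp: lead_def)
    have "(c \<oplus> a \<otimes> u [^] n) \<oplus> (d \<oplus> b \<otimes> u [^] n) = (c \<oplus> d) \<oplus> (a \<oplus> b) \<otimes> u [^] n"
      using c d pol_carrier A_carrier u by (simp add: l_distr a_ac)
    then have "(c \<oplus> d) \<oplus> (a \<oplus> b) \<otimes> u [^] n \<in> I" using subidealD(3)[OF assms c(3) d(3)] by simp
    then show ?thesis using c d pol_add subringE(7)[OF A] unfolding lead_def by blast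
  qed
  show "r \<otimes> a \<in> lead I n" if ra: "r \<in> A" "a \<in> lead I n" for r a
  proof -
    obtain c where c: "a \<in> A" "c \<in> pol A u n" "c \<oplus> a \<otimes> u [^] n \<in> I" using ra by (auto simp: lead_def)
    have "r \<otimes> (c \<oplus> a \<otimes> u [^] n) = r \<otimes> c \<oplus> (r \<otimes> a) \<otimes> u [^] n"
      using c ra pol_carrier A_carrier u by (simp add: r_distr m_assoc)
    then have "r \<otimes> c \<oplus> (r \<otimes> a) \<otimes> u [^] n \<in> I"
      using subidealD(4)[OF assms _ c(3), of r] ra adj_ring_incl by auto
    then show ?thesis using c ra pol_mult_A subringE(6)[OF A] unfolding lead_def by blast
  qed
qed

lemma lead_Suc:
  assumes "subideal (adj_ring A u) I"
  shows "lead I n \<subseteq> lead I (Suc n)"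
proof
  fix a assume "a \<in> lead I n"
  then obtain c where c: "a \<in> A" "c \<in> pol A u n" "c \<oplus> a \<otimes> u [^] n \<in> I" by (auto simp: lead_def)
  have "u \<otimes> (c \<oplus> a \<otimes> u [^] n) = u \<otimes> c \<oplus> a \<otimes> u [^] Suc n"
    using c pol_carrier A_carrier u by (simp add: r_distr m_ac)
  then have "u \<otimes> c \<oplus> a \<otimes> u [^] Suc n \<in> I" using subidealD(4)[OF assms adj_ring_gen c(3)] by simp
  then show "a \<in> lead I (Suc n)" using c pol_mult_u unfolding lead_def by blast
qed

lemma lead_mono: "I \<subseteq> J \<Longrightarrow> lead I n \<subseteq> lead J n"
  by (auto simp: lead_def)

text \<open>Induction on the degree: subtract from an element of \<open>J\<close> an element of
  \<open>I\<close> with the same leading coefficient. The difference lies in \<open>J\<close> and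
  has an expression of smaller degree.\<close>

lemma lead_eq_imp:
  assumes I: "subideal (adj_ring A u) I" and J: "subideal (adj_ring A u) J" and IJ: "I \<subseteq> J"
    and lead: "\<And>n. lead J n \<subseteq> lead I n"
  shows "J \<subseteq> I"
proof -
  have "f \<in> I" if "f \<in> pol A u n" "f \<in> J" for n f
    using that
  proof (induction n arbitrary: f)
    case 0
    then show ?case using subidealD(2)[OF I] by simp
  next
    case (Suc n)
    obtain c a where c: "f = c \<oplus> a \<otimes> u [^] n" "c \<in> pol A u n" "a \<in> A" using Suc.prems by auto
    then have "a \<in> lead J n" using Suc.prems(2) by (auto simp: lead_def)
    then obtain d where d: "d \<in> pol A u n" "d \<oplus> a \<otimes> u [^] n \<in> I" using lead by (auto simp: lead_def)
    have cc: "c \<in> carrier R" "d \<in> carrier R" "a \<otimes> u [^] n \<in> carrier R" using c d pol_carrier A_carrier u by auto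
    have e: "f \<ominus> (d \<oplus> a \<otimes> u [^] n) = c \<oplus> (\<ominus> \<one>) \<otimes> d"
    proof -
      have "f \<ominus> (d \<oplus> a \<otimes> u [^] n) = (c \<oplus> \<ominus> d) \<oplus> (a \<otimes> u [^] n \<oplus> \<ominus> (a \<otimes> u [^] n))"
        using cc unfolding c(1) minus_eq by (simp add: minus_add a_ac del: r_neg)
      then show ?thesis using cc by (simp add: r_neg l_minus)
    qed
    have "\<ominus> \<one> \<in> A" using subringE(3,5)[OF A] by blast
    then have "c \<oplus> (\<ominus> \<one>) \<otimes> d \<in> pol A u n" using c d pol_add pol_mult_A by blast
    moreover have "f \<ominus> (d \<oplus> a \<otimes> u [^] n) \<in> J"
      using Suc.prems(2) d IJ by (intro subideal_minus[OF adj_ring_subring J]) auto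
    ultimately have "f \<ominus> (d \<oplus> a \<otimes> u [^] n) \<in> I" using Suc.IH e by simp
    then have "(f \<ominus> (d \<oplus> a \<otimes> u [^] n)) \<oplus> (d \<oplus> a \<otimes> u [^] n) \<in> I" using d subidealD(3)[OF I] by blast
    then show ?case using cc c by (simp add: minus_eq a_assoc l_neg)
  qed
  then show ?thesis using subidealD(1)[OF J] by (auto simp: adj_ring_def)
qed

text \<open>Hilbert's basis theorem. The ideals \<open>lead (I m) i\<close> increase in both
  arguments. The diagonal becomes constant from some \<open>N\<close> on, and each of the finitely
  many columns below \<open>N\<close> becomes constant from \<open>B i\<close> on. The maximum
  \<open>N'\<close> of these bounds works for the whole chain.\<close>

theorem noetherian_subring_adj_ring:
  assumes "noetherian_subring A"
  shows "noetherian_subring (adj_ring A u)"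
  unfolding noetherian_subring_def
proof (intro allI impI)
  fix I :: "nat \<Rightarrow> 'a set"
  assume "(\<forall>n. subideal (adj_ring A u) (I n)) \<and> (\<forall>n. I n \<subseteq> I (Suc n))"
  then have I: "\<And>n. subideal (adj_ring A u) (I n)" and inc: "\<And>n. I n \<subseteq> I (Suc n)" by auto
  have mono: "I m \<subseteq> I n" if "m \<le> n" for m n using inc that by (rule lift_Suc_mono_le)
  have lmono: "lead (I m) i \<subseteq> lead (I n) l" if "m \<le> n" "i \<le> l" for m n i l
  proof -
    have "lead (I m) i \<subseteq> lead (I m) l" using lead_Suc[OF I] that(2) by (rule lift_Suc_mono_le)
    then show ?thesis using lead_mono[OF mono[OF that(1)]] by blast
  qed
  have stab: "\<exists>N. \<forall>n\<ge>N. J n = J N" if "\<And>n. subideal A (J n)" "\<And>n. J n \<subseteq> J (Suc n)" for J :: "nat \<Rightarrow> 'a set"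
    using assms that unfolding noetherian_subring_def by blast
  obtain N where N: "\<And>n. n \<ge> N \<Longrightarrow> lead (I n) n = lead (I N) N"
    using stab[of "\<lambda>n. lead (I n) n", OF lead_subideal[OF I] lmono] by auto
  have "\<exists>N'. \<forall>m\<ge>N'. lead (I m) i = lead (I N') i" for i
    using stab[of "\<lambda>m. lead (I m) i", OF lead_subideal[OF I] lmono] by auto
  then obtain B where B: "\<And>i m. m \<ge> B i \<Longrightarrow> lead (I m) i = lead (I (B i)) i" by metis
  define N' where "N' = Max (insert N (B ` {..<N}))"
  have N': "N \<le> N'" "\<And>i. i < N \<Longrightarrow> B i \<le> N'" unfolding N'_def by auto
  have "I m = I N'" if m: "m \<ge> N'" for m
  proof
    show "I N' \<subseteq> I m" by (rule mono[OF m])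
    have "lead (I m) i \<subseteq> lead (I N') i" for i
    proof (cases "i < N")
      case True
      then show ?thesis using B[of i m] B[of i N'] N'(2)[of i] m by simp
    next
      case False
      \<comment> \<open>For \<open>i\<close> at least \<open>N\<close>, monotonicity squeezes the
        entry between the stable diagonal value and an entry of the diagonal.\<close>
      have "lead (I m) i \<subseteq> lead (I (max m i)) (max m i)" by (rule lmono) auto
      also have "\<dots> = lead (I N) N" using False m N'(1) by (intro N) auto
      also have "\<dots> \<subseteq> lead (I N') i" using False N' by (intro lmono) auto
      finally show ?thesis .
    qed
    then show "I m \<subseteq> I N'" by (rule lead_eq_imp[OF I I mono[OF m]])
  qed
  then show "\<exists>N. \<forall>n\<ge>N. I n = I N" by blast
qed

end

lemma noetherian_subring_subfield:
  assumes "subfield k R"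
  shows "noetherian_subring k"
  unfolding noetherian_subring_def
proof (intro allI impI)
  interpret k: subfield k R by fact
  fix I :: "nat \<Rightarrow> 'a set"
  assume "(\<forall>n. subideal k (I n)) \<and> (\<forall>n. I n \<subseteq> I (Suc n))"
  then have I: "\<And>n. subideal k (I n)" and inc: "\<And>n. I n \<subseteq> I (Suc n)" by auto
  have mono: "I m \<subseteq> I n" if "m \<le> n" for m n using inc that by (rule lift_Suc_mono_le)
  have full: "I n = k" if "a \<in> I n" "a \<noteq> \<zero>" for a n
  proof
    show "I n \<subseteq> k" by (rule subidealD(1)[OF I])
    show "k \<subseteq> I n"
    proof
      fix b assume b: "b \<in> k"
      have a: "a \<in> k - {\<zero>}" using that subidealD(1)[OF I] by blast
      have inv: "inv a \<in> k" "a \<otimes> inv a = \<one>" using subfield_m_inv[OF assms a] by auto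
      have c: "a \<in> carrier R" "b \<in> carrier R" "inv a \<in> carrier R" using a b inv k.subset by auto
      have "(b \<otimes> inv a) \<otimes> a \<in> I n" using that b inv by (intro subidealD(4)[OF I]) auto
      moreover have "(b \<otimes> inv a) \<otimes> a = b \<otimes> (a \<otimes> inv a)" using c by (simp add: m_ac)
      ultimately show "b \<in> I n" using inv(2) c by simp
    qed
  qed
  show "\<exists>N. \<forall>n\<ge>N. I n = I N"
  proof (cases "\<exists>n. \<exists>a\<in>I n. a \<noteq> \<zero>")
    case True
    then obtain n a where na: "a \<in> I n" "a \<noteq> \<zero>" by blast
    have "I m = I n" if "m \<ge> n" for m using full[OF na] full[of a m] na mono[OF that] by blast
    then show ?thesis by blast
  next
    case False
    then have "I n = {\<zero>}" for n using subidealD(2)[OF I, of n] by blast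
    then show ?thesis by blast
  qed
qed

text \<open>The generators are adjoined to \<open>k\<close> one at a time. The last subring contains
  all of them, so it is the whole ring.\<close>

lemma noetherian_subring_generate:
  assumes k: "subfield k R" and U: "finite U" "U \<subseteq> carrier R" and gen: "generate_ring R (k \<union> U) = carrier R"
  shows "noetherian_subring (carrier R)"
proof -
  have "\<exists>A. subring A R \<and> noetherian_subring A \<and> k \<union> U \<subseteq> A" using U
  proof (induction U rule: finite_induct)
    case empty
    then show ?case using noetherian_subring_subfield[OF k] subfieldE(1)[OF k] by auto
  next
    case (insert u U)
    then obtain A where A: "subring A R" "noetherian_subring A" "k \<union> U \<subseteq> A" by auto
    have u: "u \<in> carrier R" using insert by simp
    show ?case
      using adj_ring_subring[OF A(1) u] noetherian_subring_adj_ring[OF A(1) u A(2)] adj_ring_incl[OF A(1) u] adj_ring_gen[OF A(1) u] A(3)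
      by (intro exI[of _ "adj_ring A u"]) auto
  qed
  then obtain A where A: "subring A R" "noetherian_subring A" "k \<union> U \<subseteq> A" by blast
  have "k \<union> U \<subseteq> carrier R" using A(3) subringE(1)[OF A(1)] by blast
  then have "carrier R \<subseteq> A" using generate_ring_min_subring1[OF _ A(1,3)] gen by simp
  then show ?thesis using A subringE(1)[OF A(1)] by (metis subset_antisym)
qed

lemma noetherian_subring_acc_ideals:
  assumes "noetherian_subring (carrier R)"
  shows "acc_ideals R"
  unfolding acc_ideals_def wf_iff_no_infinite_down_chain
proof
  assume "\<exists>f. \<forall>i. (f (Suc i), f i) \<in> {(J, I). ideal I R \<and> ideal J R \<and> I \<subset> J}"
  then obtain f where f: "\<And>i. ideal (f i) R" "\<And>i. f i \<subset> f (Suc i)" by blast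
  have "subideal (carrier R) (f i)" for i
  proof -
    interpret ideal "f i" R by (rule f)
    show ?thesis unfolding subideal_def using a_subset I_l_closed by auto
  qed
  then have "\<exists>N. \<forall>n\<ge>N. f n = f N" using assms f(2) unfolding noetherian_subring_def by (simp add: psubset_imp_subset)
  then obtain N where "f (Suc N) = f N" by (meson le_SucI order_refl)
  then show False using f(2) by blast
qed

end

section \<open>Localization and the Cech complex\<close>

context module
begin

lemma pow_pow_smult:
  "f \<in> carrier R \<Longrightarrow> m \<in> carrier M \<Longrightarrow> f [^] (a::nat) \<odot>\<^bsub>M\<^esub> (f [^] (b::nat) \<odot>\<^bsub>M\<^esub> m) = f [^] (a + b) \<odot>\<^bsub>M\<^esub> m"
  by (simp flip: smult_assoc1 R.nat_pow_mult)

lemma pow_pow_eq: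
  assumes "f \<in> carrier R" "m \<in> carrier M" "a + b = c + (d::nat)"
  shows "f [^] a \<odot>\<^bsub>M\<^esub> (f [^] b \<odot>\<^bsub>M\<^esub> m) = f [^] c \<odot>\<^bsub>M\<^esub> (f [^] d \<odot>\<^bsub>M\<^esub> m)"
  using assms by (simp only: pow_pow_smult)

lemma loc_rel_iff:
  "((m, t), (m', t')) \<in> loc_rel R M f \<longleftrightarrow> m \<in> carrier M \<and> m' \<in> carrier M \<and>
     (\<exists>s::nat. f [^] (s + t') \<odot>\<^bsub>M\<^esub> m = f [^] (s + t) \<odot>\<^bsub>M\<^esub> m')"
  by (simp add: loc_rel_def)

lemma loc_rel_equiv:
  assumes f: "f \<in> carrier R"
  shows "equiv (carrier M \<times> UNIV) (loc_rel R M f)"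
proof (rule equivI)
  show "loc_rel R M f \<subseteq> (carrier M \<times> UNIV) \<times> (carrier M \<times> UNIV)" by (auto simp: loc_rel_def)
  show "refl_on (carrier M \<times> UNIV) (loc_rel R M f)" by (auto simp: refl_on_def loc_rel_iff)
  show "sym (loc_rel R M f)"
    by (rule symI) (auto simp: loc_rel_def intro: sym)
  show "trans (loc_rel R M f)"
  proof (rule transI)
    fix x y z assume xy: "(x, y) \<in> loc_rel R M f" and yz: "(y, z) \<in> loc_rel R M f"
    obtain m t m' t' m'' t'' where xyz: "x = (m, t)" "y = (m', t')" "z = (m'', t'')" by (metis surj_pair)
    have c: "m \<in> carrier M" "m' \<in> carrier M" "m'' \<in> carrier M" using xy yz xyz by (auto simp: loc_rel_iff)
    obtain s where s: "f [^] (s + t') \<odot>\<^bsub>M\<^esub> m = f [^] (s + t) \<odot>\<^bsub>M\<^esub> m'" using xy xyz by (auto simp: loc_rel_iff)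
    obtain s' where s': "f [^] (s' + t'') \<odot>\<^bsub>M\<^esub> m' = f [^] (s' + t') \<odot>\<^bsub>M\<^esub> m''" using yz xyz by (auto simp: loc_rel_iff)
    have "f [^] ((s + s' + t') + t'') \<odot>\<^bsub>M\<^esub> m = f [^] (s' + t'') \<odot>\<^bsub>M\<^esub> (f [^] (s + t') \<odot>\<^bsub>M\<^esub> m)"
      using f c by (simp add: pow_pow_smult add_ac)
    also have "\<dots> = f [^] (s + t) \<odot>\<^bsub>M\<^esub> (f [^] (s' + t'') \<odot>\<^bsub>M\<^esub> m')"
      unfolding s using f c by (simp add: pow_pow_smult add_ac)
    also have "\<dots> = f [^] ((s + s' + t') + t) \<odot>\<^bsub>M\<^esub> m''"
      unfolding s' using f c by (simp add: pow_pow_smult add_ac)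
    finally show "(x, z) \<in> loc_rel R M f" using c unfolding xyz loc_rel_iff by blast
  qed
qed

lemma loc_frac_eq_iff:
  assumes "f \<in> carrier R" "m \<in> carrier M" "m' \<in> carrier M"
  shows "loc_frac R M f m t = loc_frac R M f m' t' \<longleftrightarrow> (\<exists>s::nat. f [^] (s + t') \<odot>\<^bsub>M\<^esub> m = f [^] (s + t) \<odot>\<^bsub>M\<^esub> m')"
  unfolding loc_frac_def using eq_equiv_class_iff[OF loc_rel_equiv[OF assms(1)], of "(m, t)" "(m', t')"] assms
  by (simp add: loc_rel_iff)

lemma loc_frac_mem:
  "f \<in> carrier R \<Longrightarrow> m \<in> carrier M \<Longrightarrow> x \<in> loc_frac R M f m t \<longleftrightarrow>
     fst x \<in> carrier M \<and> loc_frac R M f (fst x) (snd x) = loc_frac R M f m t"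
proof -
  assume a: "f \<in> carrier R" "m \<in> carrier M"
  obtain b s where x: "x = (b, s)" by (cases x)
  have "x \<in> loc_frac R M f m t \<longleftrightarrow> b \<in> carrier M \<and> (\<exists>u::nat. f [^] (u + s) \<odot>\<^bsub>M\<^esub> m = f [^] (u + t) \<odot>\<^bsub>M\<^esub> b)"
    using a x by (simp add: loc_frac_def loc_rel_iff)
  also have "\<dots> \<longleftrightarrow> b \<in> carrier M \<and> loc_frac R M f m t = loc_frac R M f b s"
    using a by (intro conj_cong refl) (simp add: loc_frac_eq_iff)
  finally show ?thesis using x by auto
qed

lemma loc_frac_self: "f \<in> carrier R \<Longrightarrow> m \<in> carrier M \<Longrightarrow> (m, t) \<in> loc_frac R M f m t"
  by (simp add: loc_frac_mem)

lemma loc_frac_raise: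
  "f \<in> carrier R \<Longrightarrow> m \<in> carrier M \<Longrightarrow> loc_frac R M f (f [^] u \<odot>\<^bsub>M\<^esub> m) (t + u) = loc_frac R M f m t"
proof -
  assume a: "f \<in> carrier R" "m \<in> carrier M"
  then have c: "f [^] u \<odot>\<^bsub>M\<^esub> m \<in> carrier M" by simp
  show ?thesis
    unfolding loc_frac_eq_iff[OF a(1) c a(2)]
    by (intro exI[of _ 0], simp only: add_0) (rule pow_pow_smult[OF a])
qed

lemma loc_frac_add_wd:
  assumes f: "f \<in> carrier R" and c: "a \<in> carrier M" "m \<in> carrier M" "b \<in> carrier M" "n \<in> carrier M"
    and 1: "loc_frac R M f a s = loc_frac R M f m t" and 2: "loc_frac R M f b r = loc_frac R M f n q"
  shows "loc_frac R M f (f [^] r \<odot>\<^bsub>M\<^esub> a \<oplus>\<^bsub>M\<^esub> f [^] s \<odot>\<^bsub>M\<^esub> b) (s + r) =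
    loc_frac R M f (f [^] q \<odot>\<^bsub>M\<^esub> m \<oplus>\<^bsub>M\<^esub> f [^] t \<odot>\<^bsub>M\<^esub> n) (t + q)"
proof -
  obtain u where u: "f [^] (u + t) \<odot>\<^bsub>M\<^esub> a = f [^] (u + s) \<odot>\<^bsub>M\<^esub> m"
    using 1 unfolding loc_frac_eq_iff[OF f c(1,2)] by blast
  obtain v where v: "f [^] (v + q) \<odot>\<^bsub>M\<^esub> b = f [^] (v + r) \<odot>\<^bsub>M\<^esub> n"
    using 2 unfolding loc_frac_eq_iff[OF f c(3,4)] by blast
  \<comment> \<open>The exponent \<open>u + v\<close> serves both relations at once. The surplus
    powers of \<open>f\<close> are moved aside so that one relation at a time can be
    applied.\<close>
  have A: "f [^] (u + v + (t + q)) \<odot>\<^bsub>M\<^esub> (f [^] r \<odot>\<^bsub>M\<^esub> a) = f [^] (u + v + (s + r)) \<odot>\<^bsub>M\<^esub> (f [^] q \<odot>\<^bsub>M\<^esub> m)"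
  proof -
    have "f [^] (u + v + (t + q)) \<odot>\<^bsub>M\<^esub> (f [^] r \<odot>\<^bsub>M\<^esub> a) = f [^] (v + q + r) \<odot>\<^bsub>M\<^esub> (f [^] (u + t) \<odot>\<^bsub>M\<^esub> a)"
      using f c by (intro pow_pow_eq) auto
    also have "\<dots> = f [^] (u + v + (s + r)) \<odot>\<^bsub>M\<^esub> (f [^] q \<odot>\<^bsub>M\<^esub> m)"
      unfolding u using f c by (intro pow_pow_eq) auto
    finally show ?thesis .
  qed
  have B: "f [^] (u + v + (t + q)) \<odot>\<^bsub>M\<^esub> (f [^] s \<odot>\<^bsub>M\<^esub> b) = f [^] (u + v + (s + r)) \<odot>\<^bsub>M\<^esub> (f [^] t \<odot>\<^bsub>M\<^esub> n)"
  proof -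
    have "f [^] (u + v + (t + q)) \<odot>\<^bsub>M\<^esub> (f [^] s \<odot>\<^bsub>M\<^esub> b) = f [^] (u + t + s) \<odot>\<^bsub>M\<^esub> (f [^] (v + q) \<odot>\<^bsub>M\<^esub> b)"
      using f c by (intro pow_pow_eq) auto
    also have "\<dots> = f [^] (u + v + (s + r)) \<odot>\<^bsub>M\<^esub> (f [^] t \<odot>\<^bsub>M\<^esub> n)"
      unfolding v using f c by (intro pow_pow_eq) auto
    finally show ?thesis .
  qed
  have k: "f [^] r \<odot>\<^bsub>M\<^esub> a \<in> carrier M" "f [^] s \<odot>\<^bsub>M\<^esub> b \<in> carrier M" "f [^] q \<odot>\<^bsub>M\<^esub> m \<in> carrier M" "f [^] t \<odot>\<^bsub>M\<^esub> n \<in> carrier M"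
    and fp: "f [^] (i::nat) \<in> carrier R" for i
    using f c by auto
  have "f [^] (u + v + (t + q)) \<odot>\<^bsub>M\<^esub> (f [^] r \<odot>\<^bsub>M\<^esub> a \<oplus>\<^bsub>M\<^esub> f [^] s \<odot>\<^bsub>M\<^esub> b) =
      f [^] (u + v + (s + r)) \<odot>\<^bsub>M\<^esub> (f [^] q \<odot>\<^bsub>M\<^esub> m \<oplus>\<^bsub>M\<^esub> f [^] t \<odot>\<^bsub>M\<^esub> n)"
    unfolding smult_r_distr[OF fp k(1,2)] smult_r_distr[OF fp k(3,4)] A B ..
  then show ?thesis unfolding loc_frac_eq_iff[OF f M.a_closed[OF k(1,2)] M.a_closed[OF k(3,4)]] by blast
qed

text \<open>The operations on localizations and quotients are unions over representatives. They are
  evaluated by showing that all representatives yield the same set.\<close>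

lemma UN_const: "A \<noteq> {} \<Longrightarrow> (\<And>x. x \<in> A \<Longrightarrow> F x = B) \<Longrightarrow> (\<Union>x\<in>A. F x) = B"
  by auto

lemma loc_add:
  assumes f: "f \<in> carrier R" and c: "m \<in> carrier M" "n \<in> carrier M"
  shows "loc_frac R M f m t \<oplus>\<^bsub>localization R M f\<^esub> loc_frac R M f n q =
    loc_frac R M f (f [^] q \<odot>\<^bsub>M\<^esub> m \<oplus>\<^bsub>M\<^esub> f [^] t \<odot>\<^bsub>M\<^esub> n) (t + q)"
proof -
  have ne: "loc_frac R M f m t \<noteq> {}" "loc_frac R M f n q \<noteq> {}" using loc_frac_self f c by blast+
  have "loc_frac R M f (f [^] snd y \<odot>\<^bsub>M\<^esub> fst x \<oplus>\<^bsub>M\<^esub> f [^] snd x \<odot>\<^bsub>M\<^esub> fst y) (snd x + snd y) =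
      loc_frac R M f (f [^] q \<odot>\<^bsub>M\<^esub> m \<oplus>\<^bsub>M\<^esub> f [^] t \<odot>\<^bsub>M\<^esub> n) (t + q)"
    if "x \<in> loc_frac R M f m t" "y \<in> loc_frac R M f n q" for x y
    using that c loc_frac_mem[OF f c(1)] loc_frac_mem[OF f c(2)] by (intro loc_frac_add_wd[OF f]) auto
  then show ?thesis unfolding localization_def ring.simps case_prod_unfold
    by (intro UN_const ne)
qed

lemma loc_add_same:
  assumes f: "f \<in> carrier R" and c: "m \<in> carrier M" "n \<in> carrier M"
  shows "loc_frac R M f m t \<oplus>\<^bsub>localization R M f\<^esub> loc_frac R M f n t = loc_frac R M f (m \<oplus>\<^bsub>M\<^esub> n) t"
proof -
  have "f [^] t \<odot>\<^bsub>M\<^esub> m \<oplus>\<^bsub>M\<^esub> f [^] t \<odot>\<^bsub>M\<^esub> n = f [^] t \<odot>\<^bsub>M\<^esub> (m \<oplus>\<^bsub>M\<^esub> n)" using f c by (simp add: smult_r_distr)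
  then show ?thesis using f c by (simp add: loc_add loc_frac_raise)
qed

lemma loc_smult:
  assumes f: "f \<in> carrier R" and c: "m \<in> carrier M" "r \<in> carrier R"
  shows "r \<odot>\<^bsub>localization R M f\<^esub> loc_frac R M f m t = loc_frac R M f (r \<odot>\<^bsub>M\<^esub> m) t"
proof -
  have "loc_frac R M f (r \<odot>\<^bsub>M\<^esub> a) s = loc_frac R M f (r \<odot>\<^bsub>M\<^esub> m) t"
    if a: "a \<in> carrier M" "loc_frac R M f a s = loc_frac R M f m t" for a s
  proof -
    obtain u where "f [^] (u + t) \<odot>\<^bsub>M\<^esub> a = f [^] (u + s) \<odot>\<^bsub>M\<^esub> m"
      using a(2) unfolding loc_frac_eq_iff[OF f a(1) c(1)] by blast
    then have "r \<odot>\<^bsub>M\<^esub> (f [^] (u + t) \<odot>\<^bsub>M\<^esub> a) = r \<odot>\<^bsub>M\<^esub> (f [^] (u + s) \<odot>\<^bsub>M\<^esub> m)" by simp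
    then have "f [^] (u + t) \<odot>\<^bsub>M\<^esub> (r \<odot>\<^bsub>M\<^esub> a) = f [^] (u + s) \<odot>\<^bsub>M\<^esub> (r \<odot>\<^bsub>M\<^esub> m)"
      using f c a by (simp add: R.m_comm flip: smult_assoc1)
    then show ?thesis using f c a by (simp add: loc_frac_eq_iff) blast
  qed
  then have "loc_frac R M f (r \<odot>\<^bsub>M\<^esub> fst x) (snd x) = loc_frac R M f (r \<odot>\<^bsub>M\<^esub> m) t"
    if "x \<in> loc_frac R M f m t" for x using that loc_frac_mem[OF f c(1)] by blast
  moreover have ne: "loc_frac R M f m t \<noteq> {}" using loc_frac_self f c by blast
  ultimately show ?thesis unfolding localization_def module.simps case_prod_unfold
    by (intro UN_const)
qed

lemma loc_map_frac:
  assumes f: "f \<in> carrier R" and g: "g \<in> carrier R" and c: "m \<in> carrier M"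
  shows "loc_map R M f g (loc_frac R M f m t) = loc_frac R M (f \<otimes> g) (g [^] t \<odot>\<^bsub>M\<^esub> m) t"
proof -
  have "loc_frac R M (f \<otimes> g) (g [^] s \<odot>\<^bsub>M\<^esub> a) s = loc_frac R M (f \<otimes> g) (g [^] t \<odot>\<^bsub>M\<^esub> m) t"
    if a: "a \<in> carrier M" "loc_frac R M f a s = loc_frac R M f m t" for a s
  proof -
    obtain u where u: "f [^] (u + t) \<odot>\<^bsub>M\<^esub> a = f [^] (u + s) \<odot>\<^bsub>M\<^esub> m"
      using a(2) unfolding loc_frac_eq_iff[OF f a(1) c] by blast
    have "(f \<otimes> g) [^] (u + t) \<odot>\<^bsub>M\<^esub> (g [^] s \<odot>\<^bsub>M\<^esub> a) = g [^] (u + t + s) \<odot>\<^bsub>M\<^esub> (f [^] (u + t) \<odot>\<^bsub>M\<^esub> a)"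
      using f g a by (simp add: R.nat_pow_distrib R.m_ac flip: smult_assoc1 R.nat_pow_mult)
    also have "\<dots> = (f \<otimes> g) [^] (u + s) \<odot>\<^bsub>M\<^esub> (g [^] t \<odot>\<^bsub>M\<^esub> m)"
      unfolding u using f g c by (simp add: R.nat_pow_distrib R.m_ac flip: smult_assoc1 R.nat_pow_mult)
    finally show ?thesis using f g c a by (simp add: loc_frac_eq_iff) blast
  qed
  then have "loc_frac R M (f \<otimes> g) (g [^] snd x \<odot>\<^bsub>M\<^esub> fst x) (snd x) = loc_frac R M (f \<otimes> g) (g [^] t \<odot>\<^bsub>M\<^esub> m) t"
    if "x \<in> loc_frac R M f m t" for x using that loc_frac_mem[OF f c] by blast
  moreover have ne: "loc_frac R M f m t \<noteq> {}" using loc_frac_self f c by blast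
  ultimately show ?thesis unfolding loc_map_def case_prod_unfold
    by (intro UN_const)
qed

lemma loc_carrier: "U \<in> carrier (localization R M f) \<longleftrightarrow> (\<exists>m t. m \<in> carrier M \<and> U = loc_frac R M f m t)"
  by (auto simp: localization_def)

lemma loc_carrierI: "m \<in> carrier M \<Longrightarrow> loc_frac R M f m t \<in> carrier (localization R M f)"
  unfolding loc_carrier by blast

lemma loc_zero:
  assumes "f \<in> carrier R"
  shows "\<zero>\<^bsub>localization R M f\<^esub> = loc_frac R M f \<zero>\<^bsub>M\<^esub> t"
  using assms by (simp add: localization_def loc_frac_eq_iff)

text \<open>Finite sums in \<open>cech_diff\<close> are computed in this monoid. The laws reduce to
  those of M once the fractions have a common exponent.\<close>

lemma loc_abelian_monoid:
  assumes f: "f \<in> carrier R"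
  shows "abelian_monoid (localization R M f)"
proof (rule abelian_monoidI)
  let ?L = "localization R M f"
  have two: "\<exists>m n t. m \<in> carrier M \<and> n \<in> carrier M \<and> U = loc_frac R M f m t \<and> V = loc_frac R M f n t"
    if UV: "U \<in> carrier ?L" "V \<in> carrier ?L" for U V
  proof -
    obtain m t n q where "m \<in> carrier M" "U = loc_frac R M f m t" "n \<in> carrier M" "V = loc_frac R M f n q"
      using UV by (auto simp: loc_carrier)
    then show ?thesis using loc_frac_raise[OF f, of m q t] loc_frac_raise[OF f, of n t q] f
      by (intro exI[of _ "f [^] q \<odot>\<^bsub>M\<^esub> m"] exI[of _ "f [^] t \<odot>\<^bsub>M\<^esub> n"] exI[of _ "t + q"]) (simp add: add.commute)
  qed
  fix U V assume UV: "U \<in> carrier ?L" "V \<in> carrier ?L"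
  obtain m n t where mn: "m \<in> carrier M" "n \<in> carrier M" "U = loc_frac R M f m t" "V = loc_frac R M f n t"
    using two[OF UV] by blast
  show "U \<oplus>\<^bsub>?L\<^esub> V \<in> carrier ?L" using mn f by (auto simp: loc_add_same loc_carrier)
  show "U \<oplus>\<^bsub>?L\<^esub> V = V \<oplus>\<^bsub>?L\<^esub> U" using mn f by (simp add: loc_add_same M.a_comm)
  show "\<zero>\<^bsub>?L\<^esub> \<oplus>\<^bsub>?L\<^esub> U = U" using mn f by (simp add: loc_zero[of f t] loc_add_same)
  fix W assume "W \<in> carrier ?L"
  then obtain w q where w: "w \<in> carrier M" "W = loc_frac R M f w q" by (auto simp: loc_carrier)
  have "U = loc_frac R M f (f [^] q \<odot>\<^bsub>M\<^esub> m) (t + q)" "V = loc_frac R M f (f [^] q \<odot>\<^bsub>M\<^esub> n) (t + q)"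
    "W = loc_frac R M f (f [^] t \<odot>\<^bsub>M\<^esub> w) (t + q)"
    using mn w f loc_frac_raise[OF f, of w t q] loc_frac_raise[OF f mn(1), of q t] loc_frac_raise[OF f mn(2), of q t]
    by (simp_all add: add.commute)
  then show "(U \<oplus>\<^bsub>?L\<^esub> V) \<oplus>\<^bsub>?L\<^esub> W = U \<oplus>\<^bsub>?L\<^esub> (V \<oplus>\<^bsub>?L\<^esub> W)" using mn w f by (simp add: loc_add_same M.a_assoc)
next
  show "\<zero>\<^bsub>localization R M f\<^esub> \<in> carrier (localization R M f)" using f loc_zero[OF f, of 0] by (auto simp: loc_carrier)
qed

lemma loc_finsum:
  assumes f: "f \<in> carrier R" and "finite A" "\<And>i. i \<in> A \<Longrightarrow> m i \<in> carrier M"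
  shows "(\<Oplus>\<^bsub>localization R M f\<^esub>i\<in>A. loc_frac R M f (m i) t) = loc_frac R M f (\<Oplus>\<^bsub>M\<^esub>i\<in>A. m i) t"
proof -
  interpret L: abelian_monoid "localization R M f" by (rule loc_abelian_monoid[OF f])
  show ?thesis using assms(2,3)
  proof (induction A rule: finite_induct)
    case empty
    then show ?case using loc_zero[OF f] by simp
  next
    case (insert a A)
    have "loc_frac R M f (m i) t \<in> carrier (localization R M f)" if "i \<in> insert a A" for i
      using insert.prems that by (auto simp: loc_carrier)
    then show ?case using insert f
      by (simp add: L.finsum_insert M.finsum_insert Pi_def loc_add_same M.finsum_closed)
  qed
qed

end

section \<open>Cech cochains as families of numerators\<close>

context koszul
begin

abbreviation frac :: "nat set \<Rightarrow> 'b \<Rightarrow> nat \<Rightarrow> ('b \<times> nat) set" where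
  "frac S \<equiv> loc_frac R M (xprod S)"

lemma cech_elt_xprod: "cech_elt R xs S = xprod S"
  by (simp add: cech_elt_def xprod_def)

lemma cech_index_idx: "cech_index xs p = idx (int p)"
  by (simp add: cech_index_def idx_def)

text \<open>A stage \<open>t\<close> cochain turned into a Cech cochain, with one exponent
  \<open>t\<close> shared by all components.\<close>

definition rep :: "nat \<Rightarrow> nat \<Rightarrow> (nat set \<Rightarrow> 'b) \<Rightarrow> nat set \<Rightarrow> ('b \<times> nat) set" where
  "rep p t m = (\<lambda>S\<in>idx (int p). frac S (m S) t)"

lemma rep_cong: "(\<And>S. S \<in> idx (int p) \<Longrightarrow> m S = m' S) \<Longrightarrow> rep p t m = rep p t m'"
  by (auto simp: rep_def intro: restrict_ext)

lemma rep_cochain: "(\<And>S. S \<in> idx (int p) \<Longrightarrow> m S \<in> carrier M) \<Longrightarrow> rep p t m \<in> carrier (cech_cochains R M xs p)"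
  by (auto simp: rep_def cech_cochains_def cech_elt_xprod cech_index_idx loc_carrierI)

text \<open>Equality of fractions gives one exponent for each \<open>S\<close>. There are finitely
  many \<open>S\<close>, and the sum of these exponents works for all of them.\<close>

lemma rep_eq_iff:
  assumes "\<And>S. S \<in> idx (int p) \<Longrightarrow> m S \<in> carrier M" "\<And>S. S \<in> idx (int p) \<Longrightarrow> m' S \<in> carrier M"
  shows "rep p t m = rep p t' m' \<longleftrightarrow>
    (\<exists>s::nat. \<forall>S\<in>idx (int p). xprod S [^] (s + t') \<odot>\<^bsub>M\<^esub> m S = xprod S [^] (s + t) \<odot>\<^bsub>M\<^esub> m' S)"
    (is "?l \<longleftrightarrow> ?r")
proof
  assume ?r
  then show ?l unfolding rep_def using assms xprod_closed
    by (intro restrict_ext) (auto simp: loc_frac_eq_iff)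
next
  assume l: ?l
  have "\<exists>s::nat. xprod S [^] (s + t') \<odot>\<^bsub>M\<^esub> m S = xprod S [^] (s + t) \<odot>\<^bsub>M\<^esub> m' S" if S: "S \<in> idx (int p)" for S
    using fun_cong[OF l, of S] S assms xprod_closed[OF S] by (simp add: rep_def loc_frac_eq_iff)
  then obtain s :: "nat set \<Rightarrow> nat" where
    s: "\<And>S. S \<in> idx (int p) \<Longrightarrow> xprod S [^] (s S + t') \<odot>\<^bsub>M\<^esub> m S = xprod S [^] (s S + t) \<odot>\<^bsub>M\<^esub> m' S" by metis
  show ?r
  proof (intro exI ballI)
    fix S assume S: "S \<in> idx (int p)"
    let ?s = "\<Sum>S\<in>idx (int p). s S"
    have "s S \<le> ?s" by (rule member_le_sum[OF S]) (auto simp: finite_idx)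
    then obtain d where d: "?s = s S + d" using le_Suc_ex by blast
    have "xprod S [^] d \<odot>\<^bsub>M\<^esub> (xprod S [^] (s S + t') \<odot>\<^bsub>M\<^esub> m S) = xprod S [^] d \<odot>\<^bsub>M\<^esub> (xprod S [^] (s S + t) \<odot>\<^bsub>M\<^esub> m' S)"
      by (simp add: s[OF S])
    then show "xprod S [^] (?s + t') \<odot>\<^bsub>M\<^esub> m S = xprod S [^] (?s + t) \<odot>\<^bsub>M\<^esub> m' S"
      using assms S xprod_closed[OF S] by (simp add: d pow_pow_smult ac_simps)
  qed
qed

lemma rep_raise:
  assumes "\<And>S. S \<in> idx (int p) \<Longrightarrow> m S \<in> carrier M"
  shows "rep p (t + u) (\<lambda>S. xprod S [^] u \<odot>\<^bsub>M\<^esub> m S) = rep p t m"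
  unfolding rep_def using assms xprod_closed by (intro restrict_ext) (simp add: loc_frac_raise)

lemma rep_zero: "\<zero>\<^bsub>cech_cochains R M xs p\<^esub> = rep p t (\<lambda>_. \<zero>\<^bsub>M\<^esub>)"
  unfolding rep_def cech_cochains_def
  by (simp add: cech_elt_xprod cech_index_idx) (intro restrict_ext loc_zero xprod_closed)

lemma rep_add:
  assumes "\<And>S. S \<in> idx (int p) \<Longrightarrow> m S \<in> carrier M" "\<And>S. S \<in> idx (int p) \<Longrightarrow> m' S \<in> carrier M"
  shows "rep p t m \<oplus>\<^bsub>cech_cochains R M xs p\<^esub> rep p t m' = rep p t (\<lambda>S. m S \<oplus>\<^bsub>M\<^esub> m' S)"
  unfolding rep_def cech_cochains_def using assms xprod_closed
  by (simp add: cech_elt_xprod cech_index_idx) (intro restrict_ext, simp add: loc_add_same)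

text \<open>The new numerators are stated explicitly, because their degrees are read off later when
  the fractions are homogeneous.\<close>

lemma common_denominator:
  assumes c: "c \<in> carrier (cech_cochains R M xs p)"
    and m: "\<And>S. S \<in> idx (int p) \<Longrightarrow> m S \<in> carrier M" "\<And>S. S \<in> idx (int p) \<Longrightarrow> c S = frac S (m S) (\<tau> S)"
  shows "\<exists>t. (\<forall>S\<in>idx (int p). \<tau> S \<le> t) \<and> c = rep p t (\<lambda>S. xprod S [^] (t - \<tau> S) \<odot>\<^bsub>M\<^esub> m S)"
proof (intro exI conjI ballI)
  let ?t = "\<Sum>S\<in>idx (int p). \<tau> S"
  show le: "\<tau> S \<le> ?t" if "S \<in> idx (int p)" for S by (rule member_le_sum[OF that]) (auto simp: finite_idx)
  have "c \<in> extensional (idx (int p))" using c by (auto simp: cech_cochains_def cech_index_idx PiE_def)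
  then show "c = rep p ?t (\<lambda>S. xprod S [^] (?t - \<tau> S) \<odot>\<^bsub>M\<^esub> m S)"
  proof (rule extensionalityI)
    show "rep p ?t (\<lambda>S. xprod S [^] (?t - \<tau> S) \<odot>\<^bsub>M\<^esub> m S) \<in> extensional (idx (int p))" by (simp add: rep_def)
    fix S assume S: "S \<in> idx (int p)"
    show "c S = rep p ?t (\<lambda>S. xprod S [^] (?t - \<tau> S) \<odot>\<^bsub>M\<^esub> m S) S"
      using S m loc_frac_raise[OF xprod_closed[OF S] m(1)[OF S], of "?t - \<tau> S" "\<tau> S"] le[OF S] by (simp add: rep_def)
  qed
qed

lemma cochain_rep:
  assumes c: "c \<in> carrier (cech_cochains R M xs p)"
  obtains t m where "\<And>S. S \<in> idx (int p) \<Longrightarrow> m S \<in> carrier M" "c = rep p t m"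
proof -
  have "\<forall>S\<in>idx (int p). \<exists>m t. m \<in> carrier M \<and> c S = frac S m t"
    using c by (auto simp: cech_cochains_def cech_elt_xprod cech_index_idx loc_carrier PiE_def Pi_def)
  then obtain m \<tau> where m: "\<And>S. S \<in> idx (int p) \<Longrightarrow> m S \<in> carrier M" "\<And>S. S \<in> idx (int p) \<Longrightarrow> c S = frac S (m S) (\<tau> S)"
    by metis
  obtain t where "c = rep p t (\<lambda>S. xprod S [^] (t - \<tau> S) \<odot>\<^bsub>M\<^esub> m S)" using common_denominator[OF c m] by blast
  then show ?thesis using m xprod_closed by (intro that) auto
qed

lemma cech_diff_rep:
  assumes m: "\<And>S. S \<in> idx (int p) \<Longrightarrow> m S \<in> carrier M"
  shows "cech_diff R M xs p (rep p t m) = rep (Suc p) t (koszul_diff t m)"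
  unfolding cech_diff_def rep_def cech_index_idx
proof (rule restrict_ext)
  fix S assume S: "S \<in> idx (int (Suc p))"
  have S': "S - {i} \<in> idx (int p)" if "i \<in> S" for i using idx_diff[OF S that] by simp
  note x = idx_nth_closed[OF S] and f = xprod_closed[OF S]
  interpret L: abelian_monoid "localization R M (xprod S)" by (rule loc_abelian_monoid[OF f])
  let ?g = "\<lambda>i. (koszul_sign R S i \<otimes> (xs ! i) [^] t) \<odot>\<^bsub>M\<^esub> m (S - {i})"
  have g: "?g i \<in> carrier M" if "i \<in> S" for i using m[OF S'[OF that]] x[OF that] by simp
  have "(\<Oplus>\<^bsub>cech_loc R M xs S\<^esub>i\<in>S. ((\<ominus> \<one>) [^] card {j \<in> S. j < i}) \<odot>\<^bsub>cech_loc R M xs S\<^esub>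
      loc_map R M (cech_elt R xs (S - {i})) (xs ! i) ((\<lambda>S\<in>idx (int p). frac S (m S) t) (S - {i}))) =
    (\<Oplus>\<^bsub>localization R M (xprod S)\<^esub>i\<in>S. frac S (?g i) t)"
    unfolding cech_elt_xprod
  proof (rule L.finsum_cong'[OF refl])
    show "(\<lambda>i. frac S (?g i) t) \<in> S \<rightarrow> carrier (localization R M (xprod S))" using g by (auto intro!: loc_carrierI)
    fix i assume i: "i \<in> S"
    have "loc_map R M (xprod (S - {i})) (xs ! i) (frac (S - {i}) (m (S - {i})) t) = frac S ((xs ! i) [^] t \<odot>\<^bsub>M\<^esub> m (S - {i})) t"
      using loc_map_frac[OF xprod_closed[OF S'[OF i]] x[OF i] m[OF S'[OF i]]] xprod_remove[OF S i] by simp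
    then show "((\<ominus> \<one>) [^] card {j \<in> S. j < i}) \<odot>\<^bsub>localization R M (xprod S)\<^esub>
      loc_map R M (xprod (S - {i})) (xs ! i) ((\<lambda>S\<in>idx (int p). frac S (m S) t) (S - {i})) = frac S (?g i) t"
      using S'[OF i] m[OF S'[OF i]] x[OF i] f by (simp add: loc_smult koszul_sign_def smult_assoc1)
  qed
  also have "\<dots> = frac S (koszul_diff t m S) t"
    unfolding koszul_diff_def using g idx_finite[OF S] by (intro loc_finsum[OF f]) auto
  finally show "(\<Oplus>\<^bsub>cech_loc R M xs S\<^esub>i\<in>S. ((\<ominus> \<one>) [^] card {j \<in> S. j < i}) \<odot>\<^bsub>cech_loc R M xs S\<^esub>
      loc_map R M (cech_elt R xs (S - {i})) (xs ! i) ((\<lambda>S\<in>idx (int p). frac S (m S) t) (S - {i}))) = frac S (koszul_diff t m S) t" .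
qed

lemma mcong_0: "mcong {\<zero>\<^bsub>M\<^esub>} a b \<longleftrightarrow> a \<in> carrier M \<and> a = b"
proof
  assume ab: "mcong {\<zero>\<^bsub>M\<^esub>} a b"
  then have "a = \<zero>\<^bsub>M\<^esub> \<oplus>\<^bsub>M\<^esub> b" using minus_cancel[of a b] by (simp add: mcong_def)
  then show "a \<in> carrier M \<and> a = b" using mcong_closed[OF ab] by simp
next
  assume "a \<in> carrier M \<and> a = b"
  then show "mcong {\<zero>\<^bsub>M\<^esub>} a b" using mcong_refl[OF zero_submodule] by blast
qed

lemma koszul_diff_empty: "koszul_diff t b {} = \<zero>\<^bsub>M\<^esub>"
  by (simp add: koszul_diff_def)

text \<open>Two families of fractions agree when their numerators agree after multiplication by
  powers of \<open>xprod S\<close>, and this is the power \<open>u\<close> allowed in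
  \<open>is_coboundary\<close>.\<close>

lemma coboundary_rep:
  assumes m: "\<And>S. S \<in> idx (int p) \<Longrightarrow> m S \<in> carrier M"
  shows "rep p t m \<in> cech_coboundaries R M xs p \<longleftrightarrow> is_coboundary (carrier M) {\<zero>\<^bsub>M\<^esub>} (int p) t m"
proof (cases p)
  case 0
  \<comment> \<open>In degree 0 there is a single component and nothing to bound with, since
    \<open>idx\<close> is empty at -1. Both sides say that a power of \<open>xprod {}\<close> kills
    the only entry.\<close>
  have i0: "idx 0 = {{}}"
  proof -
    have "S = {}" if "S \<in> idx 0" for S using that idx_finite[OF that] by (simp add: idx_def)
    then show ?thesis by (auto simp: idx_def)
  qed
  have "rep p t m \<in> cech_coboundaries R M xs p \<longleftrightarrow> rep p t m = rep p 0 (\<lambda>_. \<zero>\<^bsub>M\<^esub>)"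
    by (simp add: cech_coboundaries_def 0 rep_zero[of 0 0])
  also have "\<dots> \<longleftrightarrow> (\<exists>s::nat. xprod {} [^] (s + 0) \<odot>\<^bsub>M\<^esub> m {} = xprod {} [^] (s + t) \<odot>\<^bsub>M\<^esub> \<zero>\<^bsub>M\<^esub>)"
    using m by (subst rep_eq_iff) (auto simp: 0 i0)
  also have "\<dots> \<longleftrightarrow> (\<exists>u::nat. xprod {} [^] u \<odot>\<^bsub>M\<^esub> m {} = \<zero>\<^bsub>M\<^esub>)"
    using xprod_closed[of "{}" 0] i0 by simp
  also have "\<dots> \<longleftrightarrow> is_coboundary (carrier M) {\<zero>\<^bsub>M\<^esub>} (int p) t m"
    using m xprod_closed[of "{}" 0] i0 by (auto simp: is_coboundary_def 0 idx_neg mcong_0 koszul_diff_empty)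
  finally show ?thesis .
next
  case (Suc q)
  have q: "int p - 1 = int q" using Suc by simp
  show ?thesis
  proof
    assume "rep p t m \<in> cech_coboundaries R M xs p"
    then obtain c where c: "c \<in> carrier (cech_cochains R M xs q)" "rep p t m = cech_diff R M xs q c"
      by (auto simp: cech_coboundaries_def Suc)
    obtain t' b where b: "\<And>S. S \<in> idx (int q) \<Longrightarrow> b S \<in> carrier M" "c = rep q t' b" using cochain_rep[OF c(1)] by blast
    have kb: "koszul_diff t' b S \<in> carrier M" if S: "S \<in> idx (int p)" for S
      by (rule koszul_diff_closed[OF S]) (use b q in auto)
    have "rep p t m = rep p t' (koszul_diff t' b)" using c b cech_diff_rep Suc by simp
    then obtain s :: nat where s: "\<And>S. S \<in> idx (int p) \<Longrightarrow> xprod S [^] (s + t') \<odot>\<^bsub>M\<^esub> m S = xprod S [^] (s + t) \<odot>\<^bsub>M\<^esub> koszul_diff t' b S"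
      using rep_eq_iff[of p m "koszul_diff t' b" t t'] m kb by blast
    show "is_coboundary (carrier M) {\<zero>\<^bsub>M\<^esub>} (int p) t m"
      unfolding is_coboundary_def q
    proof (intro exI conjI ballI)
      \<comment> \<open>The cochain \<open>b\<close> comes from stage \<open>t'\<close> and
        \<open>m\<close> from stage \<open>t\<close>. Both are moved to stage t + s + t'.\<close>
      show "xprod S [^] (s + t) \<odot>\<^bsub>M\<^esub> b S \<in> carrier M" if "S \<in> idx (int q)" for S using b that xprod_closed by simp
      fix S assume S: "S \<in> idx (int p)"
      have "xprod S [^] (s + t) \<odot>\<^bsub>M\<^esub> koszul_diff t' b S = koszul_diff (t' + (s + t)) (\<lambda>S. xprod S [^] (s + t) \<odot>\<^bsub>M\<^esub> b S) S"
        by (rule xprod_pow_koszul_diff[OF S]) (use b q in auto)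
      moreover have "t' + (s + t) = t + (s + t')" by simp
      moreover have "xprod S [^] (s + t') \<odot>\<^bsub>M\<^esub> m S \<in> carrier M" using m[OF S] xprod_closed[OF S] by simp
      ultimately show "mcong {\<zero>\<^bsub>M\<^esub>} (xprod S [^] (s + t') \<odot>\<^bsub>M\<^esub> m S) (koszul_diff (t + (s + t')) (\<lambda>S. xprod S [^] (s + t) \<odot>\<^bsub>M\<^esub> b S) S)"
        unfolding mcong_0 s[OF S] by simp
    qed
  next
    assume "is_coboundary (carrier M) {\<zero>\<^bsub>M\<^esub>} (int p) t m"
    then obtain u b where b: "\<And>S. S \<in> idx (int q) \<Longrightarrow> b S \<in> carrier M"
      "\<And>S. S \<in> idx (int p) \<Longrightarrow> xprod S [^] u \<odot>\<^bsub>M\<^esub> m S = koszul_diff (t + u) b S"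
      unfolding is_coboundary_def q mcong_0 by blast
    have "rep p t m = rep p (t + u) (\<lambda>S. xprod S [^] u \<odot>\<^bsub>M\<^esub> m S)" using rep_raise m by simp
    also have "\<dots> = rep p (t + u) (koszul_diff (t + u) b)" by (rule rep_cong) (rule b)
    also have "\<dots> = cech_diff R M xs q (rep q (t + u) b)" using cech_diff_rep b(1) Suc by simp
    finally show "rep p t m \<in> cech_coboundaries R M xs p"
      using rep_cochain[of q b "t + u"] b(1) by (auto simp: cech_coboundaries_def Suc)
  qed
qed

text \<open>The differential vanishes as a family of fractions when some power of
  \<open>xprod S\<close> kills its numerators. Moving that power through the differential turns it
  into a transition of \<open>m\<close>.\<close>

lemma cocycle_rep:
  assumes m: "\<And>S. S \<in> idx (int p) \<Longrightarrow> m S \<in> carrier M"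
  shows "rep p t m \<in> cech_cocycles R M xs p \<longleftrightarrow>
    (\<exists>s. is_cocycle (carrier M) {\<zero>\<^bsub>M\<^esub>} (int p) (t + s) (\<lambda>S. xprod S [^] s \<odot>\<^bsub>M\<^esub> m S))"
proof -
  have k: "koszul_diff t m S \<in> carrier M" if S: "S \<in> idx (int (Suc p))" for S
    by (rule koszul_diff_closed[OF S]) (use m in auto)
  have xk: "xprod S [^] s \<odot>\<^bsub>M\<^esub> koszul_diff t m S = koszul_diff (t + s) (\<lambda>S. xprod S [^] s \<odot>\<^bsub>M\<^esub> m S) S"
    if S: "S \<in> idx (int (Suc p))" for S s
    by (rule xprod_pow_koszul_diff[OF S]) (use m in auto)
  have "rep p t m \<in> cech_cocycles R M xs p \<longleftrightarrow> rep (Suc p) t (koszul_diff t m) = rep (Suc p) 0 (\<lambda>_. \<zero>\<^bsub>M\<^esub>)"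
    unfolding cech_cocycles_def using rep_cochain[of p m t] m cech_diff_rep by (simp add: rep_zero[of "Suc p" 0])
  also have "\<dots> \<longleftrightarrow> (\<exists>s::nat. \<forall>S\<in>idx (int (Suc p)). xprod S [^] (s + 0) \<odot>\<^bsub>M\<^esub> koszul_diff t m S = xprod S [^] (s + t) \<odot>\<^bsub>M\<^esub> \<zero>\<^bsub>M\<^esub>)"
    using k by (intro rep_eq_iff) auto
  also have "\<dots> \<longleftrightarrow> (\<exists>s::nat. \<forall>S\<in>idx (int (Suc p)). koszul_diff (t + s) (\<lambda>S. xprod S [^] s \<odot>\<^bsub>M\<^esub> m S) S = \<zero>\<^bsub>M\<^esub>)"
    using xk xprod_closed by simp
  also have "\<dots> \<longleftrightarrow> (\<exists>s. is_cocycle (carrier M) {\<zero>\<^bsub>M\<^esub>} (int p) (t + s) (\<lambda>S. xprod S [^] s \<odot>\<^bsub>M\<^esub> m S))"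
    using m xprod_closed by (simp add: is_cocycle_def add.commute)
  finally show ?thesis .
qed

lemma coboundary_cochain: "c \<in> cech_coboundaries R M xs p \<Longrightarrow> c \<in> carrier (cech_cochains R M xs p)"
proof (cases p)
  case 0
  assume "c \<in> cech_coboundaries R M xs p"
  then have "c = rep 0 0 (\<lambda>_. \<zero>\<^bsub>M\<^esub>)" by (simp add: cech_coboundaries_def 0 rep_zero[of 0 0])
  then show ?thesis using rep_cochain[of 0 "\<lambda>_. \<zero>\<^bsub>M\<^esub>" 0] 0 by simp
next
  case (Suc q)
  assume "c \<in> cech_coboundaries R M xs p"
  then obtain b where b: "b \<in> carrier (cech_cochains R M xs q)" "c = cech_diff R M xs q b"
    by (auto simp: cech_coboundaries_def Suc)
  obtain t m where m: "\<And>S. S \<in> idx (int q) \<Longrightarrow> m S \<in> carrier M" "b = rep q t m" using cochain_rep[OF b(1)] by blast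
  have "koszul_diff t m S \<in> carrier M" if S: "S \<in> idx (int (Suc q))" for S by (rule koszul_diff_closed[OF S]) (use m in auto)
  then show ?thesis using b m cech_diff_rep rep_cochain[of "Suc q" "koszul_diff t m" t] Suc by simp
qed

lemma cochain_rep2:
  assumes "b \<in> carrier (cech_cochains R M xs p)" "c \<in> carrier (cech_cochains R M xs p)"
  obtains t m n where "\<And>S. S \<in> idx (int p) \<Longrightarrow> m S \<in> carrier M" "\<And>S. S \<in> idx (int p) \<Longrightarrow> n S \<in> carrier M"
    "b = rep p t m" "c = rep p t n"
proof -
  obtain t m where m: "\<And>S. S \<in> idx (int p) \<Longrightarrow> m S \<in> carrier M" "b = rep p t m" using cochain_rep[OF assms(1)] by blast
  obtain q n where n: "\<And>S. S \<in> idx (int p) \<Longrightarrow> n S \<in> carrier M" "c = rep p q n" using cochain_rep[OF assms(2)] by blast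
  show ?thesis
  proof (rule that)
    show "b = rep p (t + q) (\<lambda>S. xprod S [^] q \<odot>\<^bsub>M\<^esub> m S)" using m rep_raise by simp
    show "c = rep p (t + q) (\<lambda>S. xprod S [^] t \<odot>\<^bsub>M\<^esub> n S)" using n rep_raise[of p n q t] by (simp add: add.commute)
  qed (use m n xprod_closed in auto)
qed

text \<open>Translation by a coboundary maps the coboundaries onto themselves. Closure under sums
  and negatives is taken from \<open>is_coboundary_add\<close> and
  \<open>is_coboundary_smult\<close> on numerators at a common stage.\<close>

lemma coset_eq_coboundaries:
  assumes c: "c \<in> carrier (cech_cochains R M xs p)"
  shows "cech_coboundaries R M xs p +>\<^bsub>cech_cocycle_module R M xs p\<^esub> c = cech_coboundaries R M xs p
    \<longleftrightarrow> c \<in> cech_coboundaries R M xs p"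
proof -
  let ?B = "cech_coboundaries R M xs p" and ?C = "cech_cochains R M xs p"
  have cos: "?B +>\<^bsub>cech_cocycle_module R M xs p\<^esub> c = (\<lambda>b. b \<oplus>\<^bsub>?C\<^esub> c) ` ?B"
    by (auto simp: a_r_coset_def r_coset_def cech_cocycle_module_def)
  have zB: "rep p t (\<lambda>_. \<zero>\<^bsub>M\<^esub>) \<in> ?B" for t
    by (subst coboundary_rep) (auto intro!: is_coboundary_mod zero_submodule carrier_is_submodule)
  show ?thesis unfolding cos
  proof
    assume eq: "(\<lambda>b. b \<oplus>\<^bsub>?C\<^esub> c) ` ?B = ?B"
    obtain t m where m: "\<And>S. S \<in> idx (int p) \<Longrightarrow> m S \<in> carrier M" "c = rep p t m" using cochain_rep[OF c] by blast
    have "rep p t (\<lambda>_. \<zero>\<^bsub>M\<^esub>) \<oplus>\<^bsub>?C\<^esub> c \<in> ?B" using eq zB by blast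
    moreover have "rep p t (\<lambda>_. \<zero>\<^bsub>M\<^esub>) \<oplus>\<^bsub>?C\<^esub> c = c"
      unfolding m(2) using m(1) by (subst rep_add) (auto intro: rep_cong)
    ultimately show "c \<in> ?B" by simp
  next
    assume cB: "c \<in> ?B"
    show "(\<lambda>b. b \<oplus>\<^bsub>?C\<^esub> c) ` ?B = ?B"
    proof (intro equalityI subsetI)
      fix d assume "d \<in> (\<lambda>b. b \<oplus>\<^bsub>?C\<^esub> c) ` ?B"
      then obtain b where b: "b \<in> ?B" "d = b \<oplus>\<^bsub>?C\<^esub> c" by blast
      obtain t m n where mn: "\<And>S. S \<in> idx (int p) \<Longrightarrow> m S \<in> carrier M" "\<And>S. S \<in> idx (int p) \<Longrightarrow> n S \<in> carrier M"
        "b = rep p t m" "c = rep p t n" using cochain_rep2[OF coboundary_cochain[OF b(1)] c] by blast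
      have bm: "is_coboundary (carrier M) {\<zero>\<^bsub>M\<^esub>} (int p) t m" using b(1) mn(3) coboundary_rep[OF mn(1)] by simp
      have bn: "is_coboundary (carrier M) {\<zero>\<^bsub>M\<^esub>} (int p) t n" using cB mn(4) coboundary_rep[OF mn(2)] by simp
      have "is_coboundary (carrier M) {\<zero>\<^bsub>M\<^esub>} (int p) t (\<lambda>S. m S \<oplus>\<^bsub>M\<^esub> n S)"
        by (rule is_coboundary_add[OF zero_submodule carrier_is_submodule bm bn mn(1,2)])
      then have "rep p t (\<lambda>S. m S \<oplus>\<^bsub>M\<^esub> n S) \<in> ?B" by (subst coboundary_rep) (use mn(1,2) in auto)
      then show "d \<in> ?B" unfolding b(2) mn(3,4) by (subst rep_add[OF mn(1,2)])
    next
      fix b assume b: "b \<in> ?B"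
      obtain t m n where mn: "\<And>S. S \<in> idx (int p) \<Longrightarrow> m S \<in> carrier M" "\<And>S. S \<in> idx (int p) \<Longrightarrow> n S \<in> carrier M"
        "b = rep p t m" "c = rep p t n" using cochain_rep2[OF coboundary_cochain[OF b(1)] c] by blast
      have bm: "is_coboundary (carrier M) {\<zero>\<^bsub>M\<^esub>} (int p) t m" using b mn(3) coboundary_rep[OF mn(1)] by simp
      have bn: "is_coboundary (carrier M) {\<zero>\<^bsub>M\<^esub>} (int p) t n" using cB mn(4) coboundary_rep[OF mn(2)] by simp
      \<comment> \<open>The numerators of the negative of \<open>c\<close>. Adding them to those of
        \<open>b\<close> gives the preimage of \<open>b\<close> under translation by
        \<open>c\<close>.\<close>
      define n' where "n' S = (\<ominus> \<one>) \<odot>\<^bsub>M\<^esub> n S" for S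
      have n': "n' S \<in> carrier M" if "S \<in> idx (int p)" for S using mn(2)[OF that] by (simp add: n'_def)
      have bn': "is_coboundary (carrier M) {\<zero>\<^bsub>M\<^esub>} (int p) t n'"
        unfolding n'_def by (rule is_coboundary_smult[OF zero_submodule carrier_is_submodule bn mn(2)]) auto
      define l where "l S = m S \<oplus>\<^bsub>M\<^esub> n' S" for S
      have l: "l S \<in> carrier M" if "S \<in> idx (int p)" for S using mn(1)[OF that] n'[OF that] by (simp add: l_def)
      have "is_coboundary (carrier M) {\<zero>\<^bsub>M\<^esub>} (int p) t l"
        unfolding l_def by (rule is_coboundary_add[OF zero_submodule carrier_is_submodule bm bn' mn(1) n'])
      then have lB: "rep p t l \<in> ?B" using coboundary_rep[OF l] by simp
      have "l S \<oplus>\<^bsub>M\<^esub> n S = m S" if "S \<in> idx (int p)" for S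
        using mn(1)[OF that] mn(2)[OF that] by (simp add: l_def n'_def smult_l_minus M.a_assoc M.l_neg)
      then have "rep p t (\<lambda>S. l S \<oplus>\<^bsub>M\<^esub> n S) = rep p t m" by (rule rep_cong)
      then have "rep p t l \<oplus>\<^bsub>?C\<^esub> c = b" unfolding mn(3,4) using rep_add[of p l n t, OF l mn(2)] by simp
      with lB show "b \<in> (\<lambda>b. b \<oplus>\<^bsub>?C\<^esub> c) ` ?B" by blast
    qed
  qed
qed

end

text \<open>The bridge from the Cech cohomology of the definitions to \<open>vanishes\<close>. The
  hypothesis presents each homogeneous piece as the fixed points of a projection.\<close>

theorem (in graded_koszul) cech_cohomology_vanishes_iff:
  assumes gm: "\<And>e. gm e = {m \<in> carrier M. pr e m = m}"
  shows "cech_cohomology_grading R M gm xs p j \<noteq> {\<zero>\<^bsub>cech_cohomology R M xs p\<^esub>}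
    \<longleftrightarrow> \<not> vanishes pr (carrier M) {\<zero>\<^bsub>M\<^esub>} (int p) j"
proof -
  let ?B = "cech_coboundaries R M xs p"
  let ?Z = "cech_cocycle_grading R M gm xs p j"
  have Zc: "c \<in> carrier (cech_cochains R M xs p)" if "c \<in> ?Z" for c
    using that by (auto simp: cech_cocycle_grading_def cech_cocycles_def)
  have repZ: "rep p t m \<in> ?Z" if m: "is_cocycle (carrier M) {\<zero>\<^bsub>M\<^esub>} (int p) t m" "is_homogeneous pr (int p) j t m" for t m
  proof -
    have mc: "\<And>S. S \<in> idx (int p) \<Longrightarrow> m S \<in> carrier M" using m by (auto simp: is_cocycle_def)
    have "is_cocycle (carrier M) {\<zero>\<^bsub>M\<^esub>} (int p) (t + 0) (\<lambda>S. xprod S [^] (0::nat) \<odot>\<^bsub>M\<^esub> m S)"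
    proof -
      have "koszul_diff t (\<lambda>S. xprod S [^] (0::nat) \<odot>\<^bsub>M\<^esub> m S) S = koszul_diff t m S" if S: "S \<in> idx (int p + 1)" for S
        by (rule koszul_diff_cong[OF _ _ S]) (use mc in auto)
      then show ?thesis using m(1) by (simp add: is_cocycle_def)
    qed
    then have "rep p t m \<in> cech_cocycles R M xs p" using cocycle_rep mc by blast
    moreover have "\<exists>t' m'. m' \<in> gm (j + int (t' * p)) \<and> rep p t m S = loc_frac R M (cech_elt R xs S) m' t'"
      if S: "S \<in> idx (int p)" for S
      using S mc m(2) by (intro exI[of _ t] exI[of _ "m S"]) (simp add: gm is_homogeneous_def rep_def cech_elt_xprod)
    ultimately show ?thesis by (simp add: cech_cocycle_grading_def cech_index_idx)
  qed
  \<comment> \<open>The zero cocycle shows that the graded piece is not empty. Only then does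
    differing from the singleton of zero produce a nonzero class.\<close>
  have zZ: "rep p 0 (\<lambda>_. \<zero>\<^bsub>M\<^esub>) \<in> ?Z"
  proof (rule repZ)
    have "koszul_diff 0 (\<lambda>_. \<zero>\<^bsub>M\<^esub>) S \<in> {\<zero>\<^bsub>M\<^esub>}" if S: "S \<in> idx (int p + 1)" for S
      by (rule koszul_diff_in_submodule[OF zero_submodule S]) simp
    then show "is_cocycle (carrier M) {\<zero>\<^bsub>M\<^esub>} (int p) 0 (\<lambda>_. \<zero>\<^bsub>M\<^esub>)" by (simp add: is_cocycle_def)
    show "is_homogeneous pr (int p) j 0 (\<lambda>_. \<zero>\<^bsub>M\<^esub>)" using proj by (simp add: is_homogeneous_def grading_proj_zero)
  qed
  have "cech_cohomology_grading R M gm xs p j \<noteq> {\<zero>\<^bsub>cech_cohomology R M xs p\<^esub>} \<longleftrightarrow> (\<exists>c\<in>?Z. c \<notin> ?B)"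
  proof -
    have 0: "\<zero>\<^bsub>cech_cohomology R M xs p\<^esub> = ?B" by (simp add: cech_cohomology_def quotient_module_def)
    have im: "F ` Z \<noteq> {B} \<longleftrightarrow> (\<exists>c\<in>Z. F c \<noteq> B)" if "Z \<noteq> {}" for F Z B
    proof
      assume ne: "F ` Z \<noteq> {B}"
      show "\<exists>c\<in>Z. F c \<noteq> B"
      proof (rule ccontr)
        assume "\<not> (\<exists>c\<in>Z. F c \<noteq> B)"
        then have "F ` Z = {B}" using that by auto
        then show False using ne by simp
      qed
    qed blast
    have "?Z \<noteq> {}" using zZ by blast
    then have "(\<lambda>c. ?B +>\<^bsub>cech_cocycle_module R M xs p\<^esub> c) ` ?Z \<noteq> {?B}
        \<longleftrightarrow> (\<exists>c\<in>?Z. ?B +>\<^bsub>cech_cocycle_module R M xs p\<^esub> c \<noteq> ?B)" by (rule im)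
    also have "\<dots> \<longleftrightarrow> (\<exists>c\<in>?Z. c \<notin> ?B)"
      using coset_eq_coboundaries[OF Zc] by (intro bex_cong refl) simp
    finally show ?thesis unfolding cech_cohomology_grading_def quotient_grading_def 0 .
  qed
  also have "\<dots> \<longleftrightarrow> \<not> vanishes pr (carrier M) {\<zero>\<^bsub>M\<^esub>} (int p) j"
  proof
    assume "\<exists>c\<in>?Z. c \<notin> ?B"
    then obtain c where c: "c \<in> ?Z" "c \<notin> ?B" by blast
    have "\<forall>S\<in>idx (int p). \<exists>t m. m \<in> gm (j + int (t * p)) \<and> c S = frac S m t"
      using c(1) by (simp add: cech_cocycle_grading_def cech_index_idx cech_elt_xprod)
    then obtain \<tau> m where m: "\<And>S. S \<in> idx (int p) \<Longrightarrow> m S \<in> gm (j + int (\<tau> S * p))"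
      "\<And>S. S \<in> idx (int p) \<Longrightarrow> c S = frac S (m S) (\<tau> S)" by metis
    have mc: "\<And>S. S \<in> idx (int p) \<Longrightarrow> m S \<in> carrier M" using m(1) gm by blast
    obtain t where t: "\<forall>S\<in>idx (int p). \<tau> S \<le> t" "c = rep p t (\<lambda>S. xprod S [^] (t - \<tau> S) \<odot>\<^bsub>M\<^esub> m S)"
      using common_denominator[OF Zc[OF c(1)] mc m(2)] by blast
    \<comment> \<open>Raising exponents to the common \<open>t\<close> changes the numerators'
      degrees along with the denominators', so the fractions keep degree \<open>j\<close>.\<close>
    define n where "n S = xprod S [^] (t - \<tau> S) \<odot>\<^bsub>M\<^esub> m S" for S
    have nc: "\<And>S. S \<in> idx (int p) \<Longrightarrow> n S \<in> carrier M" using mc by (simp add: n_def)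
    have h: "is_homogeneous pr (int p) j t n"
      unfolding is_homogeneous_def
    proof
      fix S assume S: "S \<in> idx (int p)"
      have "pr (j + int (\<tau> S) * int p) (m S) = m S" using m(1)[OF S] by (simp add: gm)
      then show "pr (j + int t * int p) (n S) = n S"
        using proj_xpow[OF S mc[OF S], of j "\<tau> S" "t - \<tau> S"] t(1) S by (simp add: n_def)
    qed
    have cn: "c = rep p t n" using t(2) by (simp add: n_def[abs_def])
    have "rep p t n \<in> cech_cocycles R M xs p" using c(1) cn by (simp add: cech_cocycle_grading_def)
    then obtain s where s: "is_cocycle (carrier M) {\<zero>\<^bsub>M\<^esub>} (int p) (t + s) (\<lambda>S. xprod S [^] s \<odot>\<^bsub>M\<^esub> n S)"
      using cocycle_rep nc by blast
    show "\<not> vanishes pr (carrier M) {\<zero>\<^bsub>M\<^esub>} (int p) j"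
    proof
      assume "vanishes pr (carrier M) {\<zero>\<^bsub>M\<^esub>} (int p) j"
      then have "is_coboundary (carrier M) {\<zero>\<^bsub>M\<^esub>} (int p) (t + s) (\<lambda>S. xprod S [^] s \<odot>\<^bsub>M\<^esub> n S)"
        using s is_homogeneous_twist[OF h nc] unfolding vanishes_def by blast
      then have "is_coboundary (carrier M) {\<zero>\<^bsub>M\<^esub>} (int p) t n" using is_coboundary_twist nc by blast
      then show False using c(2) cn coboundary_rep nc by simp
    qed
  next
    assume "\<not> vanishes pr (carrier M) {\<zero>\<^bsub>M\<^esub>} (int p) j"
    then obtain t m where m: "is_cocycle (carrier M) {\<zero>\<^bsub>M\<^esub>} (int p) t m" "is_homogeneous pr (int p) j t m"
      "\<not> is_coboundary (carrier M) {\<zero>\<^bsub>M\<^esub>} (int p) t m" unfolding vanishes_def by blast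
    then have "rep p t m \<notin> ?B" using coboundary_rep by (simp add: is_cocycle_def)
    then show "\<exists>c\<in>?Z. c \<notin> ?B" using repZ m by blast
  qed
  finally show ?thesis .
qed

section \<open>Transfer along module homomorphisms\<close>

text \<open>A homomorphism that respects the projections identifies \<open>L\<close> modulo the
  preimage of \<open>N\<close> with its image modulo \<open>N\<close>. It serves for the inclusion
  of 0 : x as a module of its own and for the map from M onto M/xM.\<close>

lemma vanishes_transfer:
  assumes K1: "graded_koszul R M xs pr" and K2: "graded_koszul R M' xs pr'"
    and cl: "\<And>m. m \<in> carrier M \<Longrightarrow> \<phi> m \<in> carrier M'"
    and add: "\<And>m n. m \<in> carrier M \<Longrightarrow> n \<in> carrier M \<Longrightarrow> \<phi> (m \<oplus>\<^bsub>M\<^esub> n) = \<phi> m \<oplus>\<^bsub>M'\<^esub> \<phi> n"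
    and smult: "\<And>r m. r \<in> carrier R \<Longrightarrow> m \<in> carrier M \<Longrightarrow> \<phi> (r \<odot>\<^bsub>M\<^esub> m) = r \<odot>\<^bsub>M'\<^esub> \<phi> m"
    and proj: "\<And>e m. m \<in> carrier M \<Longrightarrow> \<phi> (pr e m) = pr' e (\<phi> m)"
    and L: "submodule L R M" "\<And>e m. m \<in> L \<Longrightarrow> pr e m \<in> L"
  shows "koszul.vanishes R M xs pr L {m \<in> L. \<phi> m \<in> N} p j \<longleftrightarrow> koszul.vanishes R M' xs pr' (\<phi> ` L) N p j"
proof -
  interpret A: graded_koszul R M xs pr by fact
  interpret B: graded_koszul R M' xs pr' by fact
  note Lc = A.submodule_carrier[OF L(1)]
  have zero: "\<phi> \<zero>\<^bsub>M\<^esub> = \<zero>\<^bsub>M'\<^esub>"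
    using smult[of "\<zero>\<^bsub>R\<^esub>" "\<zero>\<^bsub>M\<^esub>"] cl[of "\<zero>\<^bsub>M\<^esub>"] by simp
  have minus: "\<phi> (m \<ominus>\<^bsub>M\<^esub> n) = \<phi> m \<ominus>\<^bsub>M'\<^esub> \<phi> n" if mn: "m \<in> carrier M" "n \<in> carrier M" for m n
  proof -
    have "m \<ominus>\<^bsub>M\<^esub> n = m \<oplus>\<^bsub>M\<^esub> (\<ominus>\<^bsub>R\<^esub> \<one>\<^bsub>R\<^esub>) \<odot>\<^bsub>M\<^esub> n" using mn by (simp add: A.smult_l_minus A.M.minus_eq)
    then show ?thesis using mn cl by (simp add: add smult B.smult_l_minus B.M.minus_eq)
  qed
  have finsum: "\<phi> (\<Oplus>\<^bsub>M\<^esub>i\<in>I. f i) = (\<Oplus>\<^bsub>M'\<^esub>i\<in>I. \<phi> (f i))" if "finite I" "\<And>i. i \<in> I \<Longrightarrow> f i \<in> carrier M" for f and I :: "nat set"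
    using that by (induction I rule: finite_induct) (simp_all add: zero add cl A.M.finsum_insert B.M.finsum_insert Pi_def)
  have koszul_diff: "\<phi> (A.koszul_diff t m S) = B.koszul_diff t (\<lambda>T. \<phi> (m T)) S"
    if S: "S \<in> A.idx q" and m: "\<And>T. T \<in> A.idx (q - 1) \<Longrightarrow> m T \<in> carrier M" for t m S q
  proof -
    have c: "(koszul_sign R S i \<otimes>\<^bsub>R\<^esub> (xs ! i) [^]\<^bsub>R\<^esub> t) \<in> carrier R" "m (S - {i}) \<in> carrier M" if "i \<in> S" for i
      using A.idx_nth_closed[OF S that] m[OF A.idx_diff[OF S that]] by auto
    show ?thesis unfolding A.koszul_diff_def B.koszul_diff_def
      using A.idx_finite[OF S] c cl by (subst finsum) (auto simp: smult intro!: B.M.finsum_cong')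
  qed
  show ?thesis
  proof
    assume V: "A.vanishes pr L {m \<in> L. \<phi> m \<in> N} p j"
    show "B.vanishes pr' (\<phi> ` L) N p j" unfolding B.vanishes_def
    proof (intro allI impI)
      fix t m assume m: "B.is_cocycle (\<phi> ` L) N p t m" "B.is_homogeneous pr' p j t m"
      have "\<forall>S\<in>A.idx p. \<exists>l\<in>L. m S = \<phi> l" using m(1) by (auto simp: B.is_cocycle_def)
      then obtain l where l: "\<And>S. S \<in> A.idx p \<Longrightarrow> l S \<in> L" "\<And>S. S \<in> A.idx p \<Longrightarrow> m S = \<phi> (l S)" by metis
      \<comment> \<open>An arbitrary lift need not be homogeneous. Its projection is, and it still
        lifts \<open>m\<close> because \<open>m\<close> is homogeneous.\<close>
      define n where "n S = pr (j + int t * p) (l S)" for S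
      have nL: "n S \<in> L" if "S \<in> A.idx p" for S using l(1)[OF that] L(2) by (simp add: n_def)
      have nc: "n S \<in> carrier M" if "S \<in> A.idx p" for S using nL[OF that] Lc by blast
      have mn: "m S = \<phi> (n S)" if S: "S \<in> A.idx p" for S
      proof -
        have "m S = pr' (j + int t * p) (m S)" using m(2) S by (simp add: B.is_homogeneous_def)
        also have "\<dots> = \<phi> (n S)" unfolding l(2)[OF S] n_def using l(1)[OF S] Lc proj by simp
        finally show ?thesis .
      qed
      have hn: "A.is_homogeneous pr p j t n"
        unfolding A.is_homogeneous_def n_def using l(1) Lc A.grading_projD(3)[OF A.proj] by blast
      have kn: "A.koszul_diff t n S \<in> {m \<in> L. \<phi> m \<in> N}" if S: "S \<in> A.idx (p + 1)" for S
      proof -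
        have "A.koszul_diff t n S \<in> L" by (rule A.koszul_diff_in_submodule[OF L(1) S]) (use nL in auto)
        moreover have "\<phi> (A.koszul_diff t n S) = B.koszul_diff t (\<lambda>T. \<phi> (n T)) S" by (rule koszul_diff[OF S]) (use nc in auto)
        moreover have "\<dots> = B.koszul_diff t m S" by (rule B.koszul_diff_cong[OF _ _ S]) (use mn nc cl in auto)
        ultimately show ?thesis using m(1) S by (auto simp: B.is_cocycle_def)
      qed
      have "A.is_coboundary L {m \<in> L. \<phi> m \<in> N} p t n" by (rule A.vanD[OF V nL kn hn])
      then obtain u b where b: "\<forall>S\<in>A.idx (p - 1). b S \<in> L"
        "\<forall>S\<in>A.idx p. A.mcong {m \<in> L. \<phi> m \<in> N} (A.xprod S [^]\<^bsub>R\<^esub> u \<odot>\<^bsub>M\<^esub> n S) (A.koszul_diff (t + u) b S)" unfolding A.is_coboundary_def by blast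
      show "B.is_coboundary (\<phi> ` L) N p t m" unfolding B.is_coboundary_def
      proof (intro exI conjI ballI)
        show "\<phi> (b S) \<in> \<phi> ` L" if "S \<in> A.idx (p - 1)" for S using b(1) that by blast
        fix S assume S: "S \<in> A.idx p"
        have mc: "A.mcong {m \<in> L. \<phi> m \<in> N} (A.xprod S [^]\<^bsub>R\<^esub> u \<odot>\<^bsub>M\<^esub> n S) (A.koszul_diff (t + u) b S)" using b(2) S by blast
        have k: "\<phi> (A.koszul_diff (t + u) b S) = B.koszul_diff (t + u) (\<lambda>T. \<phi> (b T)) S" by (rule koszul_diff[OF S]) (use b(1) Lc in auto)
        have x: "\<phi> (A.xprod S [^]\<^bsub>R\<^esub> u \<odot>\<^bsub>M\<^esub> n S) = B.xprod S [^]\<^bsub>R\<^esub> u \<odot>\<^bsub>M'\<^esub> m S"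
          using S nc[OF S] by (simp add: smult mn)
        show "B.mcong N (B.xprod S [^]\<^bsub>R\<^esub> u \<odot>\<^bsub>M'\<^esub> m S) (B.koszul_diff (t + u) (\<lambda>T. \<phi> (b T)) S)"
          using mc A.mcong_closed[OF mc] cl minus unfolding x[symmetric] k[symmetric] B.mcong_def A.mcong_def by auto
      qed
    qed
  next
    assume V: "B.vanishes pr' (\<phi> ` L) N p j"
    show "A.vanishes pr L {m \<in> L. \<phi> m \<in> N} p j" unfolding A.vanishes_def
    proof (intro allI impI)
      fix t m assume m: "A.is_cocycle L {m \<in> L. \<phi> m \<in> N} p t m" "A.is_homogeneous pr p j t m"
      have mL: "m S \<in> L" if "S \<in> A.idx p" for S using m(1) that by (simp add: A.is_cocycle_def)
      have mc: "m S \<in> carrier M" if "S \<in> A.idx p" for S using mL[OF that] Lc by blast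
      have "B.koszul_diff t (\<lambda>S. \<phi> (m S)) S \<in> N" if S: "S \<in> A.idx (p + 1)" for S
      proof -
        have "\<phi> (A.koszul_diff t m S) = B.koszul_diff t (\<lambda>T. \<phi> (m T)) S" by (rule koszul_diff[OF S]) (use mc in auto)
        moreover have "\<phi> (A.koszul_diff t m S) \<in> N" using m(1) S by (simp add: A.is_cocycle_def)
        ultimately show ?thesis by simp
      qed
      moreover have "B.is_homogeneous pr' p j t (\<lambda>S. \<phi> (m S))"
        unfolding B.is_homogeneous_def
      proof
        fix S assume S: "S \<in> A.idx p"
        have "\<phi> (pr (j + int t * p) (m S)) = pr' (j + int t * p) (\<phi> (m S))" by (rule proj[OF mc[OF S]])
        moreover have "pr (j + int t * p) (m S) = m S" using m(2) S by (simp add: A.is_homogeneous_def)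
        ultimately show "pr' (j + int t * p) (\<phi> (m S)) = \<phi> (m S)" by simp
      qed
      ultimately have "B.is_coboundary (\<phi> ` L) N p t (\<lambda>S. \<phi> (m S))" by (intro B.vanD[OF V]) (use mL in auto)
      then obtain u b' where b': "\<forall>S\<in>A.idx (p - 1). b' S \<in> \<phi> ` L"
        "\<forall>S\<in>A.idx p. B.mcong N (B.xprod S [^]\<^bsub>R\<^esub> u \<odot>\<^bsub>M'\<^esub> \<phi> (m S)) (B.koszul_diff (t + u) b' S)" unfolding B.is_coboundary_def by blast
      have "\<forall>S\<in>A.idx (p - 1). \<exists>b. b \<in> L \<and> b' S = \<phi> b" using b'(1) by blast
      then obtain b where b: "\<And>S. S \<in> A.idx (p - 1) \<Longrightarrow> b S \<in> L" "\<And>S. S \<in> A.idx (p - 1) \<Longrightarrow> b' S = \<phi> (b S)" by metis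
      show "A.is_coboundary L {m \<in> L. \<phi> m \<in> N} p t m" unfolding A.is_coboundary_def
      proof (intro exI conjI ballI)
        show "b S \<in> L" if "S \<in> A.idx (p - 1)" for S by (rule b(1)[OF that])
        fix S assume S: "S \<in> A.idx p"
        have bc: "b T \<in> carrier M" if "T \<in> A.idx (p - 1)" for T using b(1)[OF that] Lc by blast
        have k: "\<phi> (A.koszul_diff (t + u) b S) = B.koszul_diff (t + u) b' S"
        proof -
          have "\<phi> (A.koszul_diff (t + u) b S) = B.koszul_diff (t + u) (\<lambda>T. \<phi> (b T)) S" by (rule koszul_diff[OF S bc])
          also have "\<dots> = B.koszul_diff (t + u) b' S" by (rule B.koszul_diff_cong[OF _ _ S]) (use b b' bc cl in auto)
          finally show ?thesis .
        qed
        have x: "\<phi> (A.xprod S [^]\<^bsub>R\<^esub> u \<odot>\<^bsub>M\<^esub> m S) = B.xprod S [^]\<^bsub>R\<^esub> u \<odot>\<^bsub>M'\<^esub> \<phi> (m S)"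
          using S mc[OF S] by (simp add: smult)
        have c: "A.xprod S [^]\<^bsub>R\<^esub> u \<odot>\<^bsub>M\<^esub> m S \<in> L" "A.koszul_diff (t + u) b S \<in> L"
          using S mL[OF S] A.submoduleE(4)[OF L(1)] A.koszul_diff_in_submodule[OF L(1) S b(1)] by auto
        have "B.mcong N (\<phi> (A.xprod S [^]\<^bsub>R\<^esub> u \<odot>\<^bsub>M\<^esub> m S)) (\<phi> (A.koszul_diff (t + u) b S))"
          unfolding x k using b'(2) S by blast
        then show "A.mcong {m \<in> L. \<phi> m \<in> N} (A.xprod S [^]\<^bsub>R\<^esub> u \<odot>\<^bsub>M\<^esub> m S) (A.koszul_diff (t + u) b S)"
          using c Lc minus A.submodule_minus[OF L(1)] unfolding B.mcong_def A.mcong_def by auto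
      qed
    qed
  qed
qed

section \<open>Quotient modules\<close>

context module
begin

context
  fixes N
  assumes N: "submodule N R M"
begin

lemma submodule_abelian_subgroup: "abelian_subgroup N M"
  using submodule.axioms(1)[OF N]
  by (intro abelian_subgroupI3 additive_subgroup.intro M.abelian_group_axioms)

lemma coset_eq_iff:
  assumes "a \<in> carrier M" "b \<in> carrier M"
  shows "N +>\<^bsub>M\<^esub> a = N +>\<^bsub>M\<^esub> b \<longleftrightarrow> mcong N a b"
proof -
  interpret N: abelian_subgroup N M by (rule submodule_abelian_subgroup)
  have "N +>\<^bsub>M\<^esub> a = N +>\<^bsub>M\<^esub> b \<longleftrightarrow> a \<in> N +>\<^bsub>M\<^esub> b"
    using N.a_repr_independence'[of a b] N.a_repr_independenceD[of a b] assms by metis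
  also have "\<dots> \<longleftrightarrow> mcong N a b" using N.a_rcos_module[OF assms(2,1)] assms by (simp add: mcong_def M.minus_eq)
  finally show ?thesis .
qed

lemma coset_eq_self_iff: "a \<in> carrier M \<Longrightarrow> N +>\<^bsub>M\<^esub> a = N \<longleftrightarrow> a \<in> N"
  using coset_eq_iff[of a "\<zero>\<^bsub>M\<^esub>"] M.a_coset_add_zero[of N] submoduleE(1)[OF N] by (simp add: mcong_zero)

lemma quotient_carrier: "U \<in> carrier (quotient_module R M N) \<longleftrightarrow> (\<exists>m\<in>carrier M. U = N +>\<^bsub>M\<^esub> m)"
  by (auto simp: quotient_module_def A_RCOSETS_def RCOSETS_def a_r_coset_def)

lemma coset_in_quotient: "m \<in> carrier M \<Longrightarrow> N +>\<^bsub>M\<^esub> m \<in> carrier (quotient_module R M N)"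
  unfolding quotient_carrier by blast

lemma quotient_zero: "\<zero>\<^bsub>quotient_module R M N\<^esub> = N"
  by (simp add: quotient_module_def)

lemma quotient_add:
  "a \<in> carrier M \<Longrightarrow> b \<in> carrier M \<Longrightarrow> (N +>\<^bsub>M\<^esub> a) \<oplus>\<^bsub>quotient_module R M N\<^esub> (N +>\<^bsub>M\<^esub> b) = N +>\<^bsub>M\<^esub> (a \<oplus>\<^bsub>M\<^esub> b)"
  using abelian_subgroup.a_rcos_sum[OF submodule_abelian_subgroup] by (simp add: quotient_module_def)

lemma quotient_smult:
  assumes "a \<in> carrier M" "r \<in> carrier R"
  shows "r \<odot>\<^bsub>quotient_module R M N\<^esub> (N +>\<^bsub>M\<^esub> a) = N +>\<^bsub>M\<^esub> (r \<odot>\<^bsub>M\<^esub> a)"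
proof -
  interpret N: abelian_subgroup N M by (rule submodule_abelian_subgroup)
  have "N +>\<^bsub>M\<^esub> (r \<odot>\<^bsub>M\<^esub> b) = N +>\<^bsub>M\<^esub> (r \<odot>\<^bsub>M\<^esub> a)" if b: "b \<in> N +>\<^bsub>M\<^esub> a" for b
  proof -
    have bc: "b \<in> carrier M" by (rule N.a_elemrcos_carrier[OF assms(1) b])
    have "mcong N b a" using N.a_rcos_module[OF assms(1) bc] b bc assms by (simp add: mcong_def M.minus_eq)
    then have "mcong N (r \<odot>\<^bsub>M\<^esub> b) (r \<odot>\<^bsub>M\<^esub> a)" using assms N by (intro mcong_smult)
    then show ?thesis using coset_eq_iff bc assms by simp
  qed
  moreover have "N +>\<^bsub>M\<^esub> a \<noteq> {}" using N.a_rcos_self[OF assms(1)] by blast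
  ultimately show ?thesis unfolding quotient_module_def module.simps
    by (intro UN_const)
qed

lemma quotient_module_module: "module R (quotient_module R M N)"
proof (rule moduleI)
  let ?Q = "quotient_module R M N"
  note q = quotient_add quotient_smult quotient_carrier
  show "cring R" by (rule R.cring_axioms)
  have coset0: "N +>\<^bsub>M\<^esub> \<zero>\<^bsub>M\<^esub> = N" using coset_eq_self_iff[of "\<zero>\<^bsub>M\<^esub>"] submodule_zero[OF N] by simp
  show "abelian_group ?Q"
  proof (rule abelian_groupI)
    show "\<zero>\<^bsub>?Q\<^esub> \<in> carrier ?Q" using coset_in_quotient[of "\<zero>\<^bsub>M\<^esub>"] coset0 by (simp add: quotient_zero)
    fix U assume "U \<in> carrier ?Q"
    then obtain a where a: "a \<in> carrier M" "U = N +>\<^bsub>M\<^esub> a" unfolding quotient_carrier by blast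
    show "\<zero>\<^bsub>?Q\<^esub> \<oplus>\<^bsub>?Q\<^esub> U = U" using quotient_add[of "\<zero>\<^bsub>M\<^esub>" a] a coset0 by (simp add: quotient_zero)
    have "(N +>\<^bsub>M\<^esub> (\<ominus>\<^bsub>M\<^esub> a)) \<oplus>\<^bsub>?Q\<^esub> U = \<zero>\<^bsub>?Q\<^esub>"
      using quotient_add[of "\<ominus>\<^bsub>M\<^esub> a" a] a coset0 by (simp add: quotient_zero M.l_neg)
    moreover have "N +>\<^bsub>M\<^esub> (\<ominus>\<^bsub>M\<^esub> a) \<in> carrier ?Q" using a by (simp add: coset_in_quotient)
    ultimately show "\<exists>V\<in>carrier ?Q. V \<oplus>\<^bsub>?Q\<^esub> U = \<zero>\<^bsub>?Q\<^esub>" by blast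
    fix V assume "V \<in> carrier ?Q"
    then obtain b where b: "b \<in> carrier M" "V = N +>\<^bsub>M\<^esub> b" unfolding quotient_carrier by blast
    show "U \<oplus>\<^bsub>?Q\<^esub> V \<in> carrier ?Q" using a b by (simp add: quotient_add coset_in_quotient)
    show "U \<oplus>\<^bsub>?Q\<^esub> V = V \<oplus>\<^bsub>?Q\<^esub> U" using a b by (simp add: quotient_add M.a_comm)
    fix W assume "W \<in> carrier ?Q"
    then obtain c where c: "c \<in> carrier M" "W = N +>\<^bsub>M\<^esub> c" unfolding quotient_carrier by blast
    show "(U \<oplus>\<^bsub>?Q\<^esub> V) \<oplus>\<^bsub>?Q\<^esub> W = U \<oplus>\<^bsub>?Q\<^esub> (V \<oplus>\<^bsub>?Q\<^esub> W)" using a b c by (simp add: quotient_add M.a_assoc)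
  qed
  fix r U assume r: "r \<in> carrier R" and "U \<in> carrier ?Q"
  then obtain a where a: "a \<in> carrier M" "U = N +>\<^bsub>M\<^esub> a" unfolding quotient_carrier by blast
  show "r \<odot>\<^bsub>?Q\<^esub> U \<in> carrier ?Q" using a r by (simp add: quotient_smult coset_in_quotient)
  show "(r \<otimes> s) \<odot>\<^bsub>?Q\<^esub> U = r \<odot>\<^bsub>?Q\<^esub> (s \<odot>\<^bsub>?Q\<^esub> U)" if "s \<in> carrier R" for s
    using a r that by (simp add: quotient_smult smult_assoc1)
  show "(r \<oplus> s) \<odot>\<^bsub>?Q\<^esub> U = r \<odot>\<^bsub>?Q\<^esub> U \<oplus>\<^bsub>?Q\<^esub> s \<odot>\<^bsub>?Q\<^esub> U" if "s \<in> carrier R" for s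
    using a r that by (simp add: quotient_smult quotient_add smult_l_distr)
  fix V assume "V \<in> carrier ?Q"
  then obtain b where b: "b \<in> carrier M" "V = N +>\<^bsub>M\<^esub> b" unfolding quotient_carrier by blast
  show "r \<odot>\<^bsub>?Q\<^esub> (U \<oplus>\<^bsub>?Q\<^esub> V) = r \<odot>\<^bsub>?Q\<^esub> U \<oplus>\<^bsub>?Q\<^esub> r \<odot>\<^bsub>?Q\<^esub> V"
    using a b r by (simp add: quotient_smult quotient_add smult_r_distr)
next
  fix U assume "U \<in> carrier (quotient_module R M N)"
  then obtain a where a: "a \<in> carrier M" "U = N +>\<^bsub>M\<^esub> a" unfolding quotient_carrier by blast
  then show "\<one> \<odot>\<^bsub>quotient_module R M N\<^esub> U = U" by (simp add: quotient_smult)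
qed

text \<open>The chosen representative does not matter when \<open>N\<close> is graded, since the
  projections then respect congruence modulo \<open>N\<close>.\<close>

definition quotient_proj :: "(int \<Rightarrow> 'c \<Rightarrow> 'c) \<Rightarrow> int \<Rightarrow> 'c set \<Rightarrow> 'c set" where
  "quotient_proj pr e U = N +>\<^bsub>M\<^esub> pr e (SOME m. m \<in> carrier M \<and> U = N +>\<^bsub>M\<^esub> m)"

lemma quotient_proj_coset:
  assumes "grading_proj pr" "graded_sub pr N" "m \<in> carrier M"
  shows "quotient_proj pr e (N +>\<^bsub>M\<^esub> m) = N +>\<^bsub>M\<^esub> pr e m"
proof -
  define n where "n = (SOME n. n \<in> carrier M \<and> N +>\<^bsub>M\<^esub> m = N +>\<^bsub>M\<^esub> n)"
  have n: "n \<in> carrier M \<and> N +>\<^bsub>M\<^esub> m = N +>\<^bsub>M\<^esub> n"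
    unfolding n_def by (rule someI_ex) (use assms in blast)
  then have "mcong N n m" using coset_eq_iff assms by (metis)
  then have "mcong N (pr e n) (pr e m)" by (rule mcong_proj[OF assms(1,2)])
  then show ?thesis using n assms coset_eq_iff unfolding quotient_proj_def n_def[symmetric]
    by (simp add: grading_projD)
qed

end

end

lemma (in graded_koszul) graded_koszul_quotient:
  assumes "graded_sub pr N"
  shows "graded_koszul R (quotient_module R M N) xs (quotient_proj N pr)"
proof -
  have N: "submodule N R M" using assms by (rule graded_subD)
  interpret Q: module R "quotient_module R M N" by (rule quotient_module_module[OF N])
  have B: "(\<forall>U\<in>carrier (quotient_module R M N). P U) \<longleftrightarrow> (\<forall>m\<in>carrier M. P (N +>\<^bsub>M\<^esub> m))" for P
    unfolding Ball_def quotient_carrier[OF N] by blast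
  have C: "m \<in> carrier M \<Longrightarrow> N +>\<^bsub>M\<^esub> m \<in> carrier (quotient_module R M N)" for m
    by (rule coset_in_quotient[OF N])
  have g: "Q.grading_proj (quotient_proj N pr)"
    unfolding Q.grading_proj_def B
    using proj assms
    by (auto simp: C quotient_proj_coset[OF N] quotient_add[OF N] grading_projD)
  have h: "Q.homog_elt (quotient_proj N pr) 1 y" if "y \<in> set xs" for y
    unfolding Q.homog_elt_def B
    using proj assms xs_homog[OF that]
    by (auto simp: quotient_proj_coset[OF N] quotient_smult[OF N] homog_eltD grading_projD)
  show ?thesis
    by (intro graded_koszul.intro koszul.intro koszul_axioms.intro graded_koszul_axioms.intro
        Q.module_axioms xs_closed g h)
qed

lemma (in graded_koszul) graded_koszul_submodule:
  assumes "graded_sub pr K"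
  shows "graded_koszul R (M\<lparr>carrier := K\<rparr>) xs pr"
proof -
  have K: "submodule K R M" using assms by (rule graded_subD)
  note Kc = submodule_carrier[OF K]
  interpret S: module R "M\<lparr>carrier := K\<rparr>" by (rule submodule.submodule_is_module[OF K module_axioms])
  have g: "S.grading_proj pr"
    unfolding S.grading_proj_def using proj assms Kc by (simp add: grading_projD graded_sub_def)
  have h: "S.homog_elt pr 1 y" if "y \<in> set xs" for y
    unfolding S.homog_elt_def using xs_homog[OF that] Kc by (simp add: homog_eltD)
  show ?thesis
    by (intro graded_koszul.intro koszul.intro koszul_axioms.intro graded_koszul_axioms.intro
        S.module_axioms xs_closed g h)
qed

section \<open>Homogeneous components\<close>

context abelian_group
begin

definition decomp :: "('i \<Rightarrow> 'a set) \<Rightarrow> 'a \<Rightarrow> ('i \<Rightarrow> 'a) \<Rightarrow> bool" where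
  "decomp A r f \<longleftrightarrow> (\<forall>i. f i \<in> A i) \<and> finite {i. f i \<noteq> \<zero>} \<and> r = (\<Oplus>i\<in>{i. f i \<noteq> \<zero>}. f i)"

definition component :: "('i \<Rightarrow> 'a set) \<Rightarrow> 'a \<Rightarrow> 'i \<Rightarrow> 'a" where
  "component A r = (THE f. decomp A r f)"

context
  fixes A :: "'i \<Rightarrow> 'a set"
  assumes A: "internal_direct_sum G A"
begin

lemma piece_subgroup: "additive_subgroup (A i) G"
  using A by (simp add: internal_direct_sum_def)

lemma piece_carrier: "a \<in> A i \<Longrightarrow> a \<in> carrier G"
  using additive_subgroup.a_subset[OF piece_subgroup] by blast

lemma piece_zero: "\<zero> \<in> A i"
  using additive_subgroup.zero_closed[OF piece_subgroup] .

lemma piece_add: "a \<in> A i \<Longrightarrow> b \<in> A i \<Longrightarrow> a \<oplus> b \<in> A i"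
  using additive_subgroup.a_closed[OF piece_subgroup] .

lemma decomp_ex1: "r \<in> carrier G \<Longrightarrow> \<exists>!f. decomp A r f"
  using A by (simp add: internal_direct_sum_def decomp_def)

lemma decomp_component: "r \<in> carrier G \<Longrightarrow> decomp A r (component A r)"
  unfolding component_def by (rule theI'[OF decomp_ex1])

lemma component_eq: "r \<in> carrier G \<Longrightarrow> decomp A r f \<Longrightarrow> component A r = f"
  using decomp_ex1 decomp_component by blast

lemma component_mem: "r \<in> carrier G \<Longrightarrow> component A r i \<in> A i"
  using decomp_component by (simp add: decomp_def)

lemma decompI:
  assumes "\<And>i. f i \<in> A i" "finite F" "\<And>i. i \<notin> F \<Longrightarrow> f i = \<zero>" "r = (\<Oplus>i\<in>F. f i)"
  shows "decomp A r f"
proof -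
  have sub: "{i. f i \<noteq> \<zero>} \<subseteq> F" using assms(3) by blast
  have c: "f i \<in> carrier G" for i using assms(1) piece_carrier by blast
  have "(\<Oplus>i\<in>{i. f i \<noteq> \<zero>}. f i) = (\<Oplus>i\<in>F. f i)"
    using c by (intro add.finprod_mono_neutral_cong_left[OF assms(2) sub]) auto
  then show ?thesis using assms sub finite_subset by (auto simp: decomp_def)
qed

lemma decompE:
  assumes "decomp A r f"
  shows "\<And>i. f i \<in> A i" "finite {i. f i \<noteq> \<zero>}" "finite F \<Longrightarrow> {i. f i \<noteq> \<zero>} \<subseteq> F \<Longrightarrow> r = (\<Oplus>i\<in>F. f i)"
proof -
  show 1: "\<And>i. f i \<in> A i" and "finite {i. f i \<noteq> \<zero>}" using assms by (auto simp: decomp_def)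
  have c: "f i \<in> carrier G" for i using 1 piece_carrier by blast
  assume F: "finite F" "{i. f i \<noteq> \<zero>} \<subseteq> F"
  have "(\<Oplus>i\<in>{i. f i \<noteq> \<zero>}. f i) = (\<Oplus>i\<in>F. f i)"
    using c by (intro add.finprod_mono_neutral_cong_left[OF F]) auto
  then show "r = (\<Oplus>i\<in>F. f i)" using assms by (simp add: decomp_def)
qed

lemma component_add:
  assumes "r \<in> carrier G" "s \<in> carrier G"
  shows "component A (r \<oplus> s) i = component A r i \<oplus> component A s i"
proof -
  note r = decomp_component[OF assms(1)] and s = decomp_component[OF assms(2)]
  let ?F = "{i. component A r i \<noteq> \<zero>} \<union> {i. component A s i \<noteq> \<zero>}"
  have fin: "finite ?F" using decompE(2)[OF r] decompE(2)[OF s] by blast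
  have c: "component A r i \<in> carrier G" "component A s i \<in> carrier G" for i
    using component_mem assms piece_carrier by blast+
  have "r \<oplus> s = (\<Oplus>i\<in>?F. component A r i) \<oplus> (\<Oplus>i\<in>?F. component A s i)"
    using decompE(3)[OF r fin] decompE(3)[OF s fin] by simp
  also have "\<dots> = (\<Oplus>i\<in>?F. component A r i \<oplus> component A s i)" using c by (simp add: finsum_addf)
  finally have "decomp A (r \<oplus> s) (\<lambda>i. component A r i \<oplus> component A s i)"
    using component_mem assms piece_add by (intro decompI[OF _ fin]) auto
  then show ?thesis using component_eq assms by simp
qed

lemma component_piece:
  assumes "r \<in> A i"
  shows "component A r k = (if k = i then r else \<zero>)"
proof -
  have "decomp A r (\<lambda>k. if k = i then r else \<zero>)"
    using assms piece_zero piece_carrier by (intro decompI[of _ "{i}"]) auto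
  then show ?thesis using component_eq piece_carrier[OF assms] by simp
qed

text \<open>The map sends the decomposition of \<open>r\<close> to a decomposition with degrees
  moved by \<open>\<sigma>\<close>, and uniqueness identifies it. Degrees outside the range occur
  for the ring, whose degrees are natural numbers: a shift by \<open>d\<close> misses those below
  \<open>d\<close>.\<close>

lemma component_map:
  assumes \<phi>: "\<And>a b. a \<in> carrier G \<Longrightarrow> b \<in> carrier G \<Longrightarrow> \<phi> (a \<oplus> b) = \<phi> a \<oplus> \<phi> b"
    and \<sigma>: "inj \<sigma>" and deg: "\<And>i a. a \<in> A i \<Longrightarrow> \<phi> a \<in> A (\<sigma> i)" and \<phi>c: "\<And>a. a \<in> carrier G \<Longrightarrow> \<phi> a \<in> carrier G"
    and r: "r \<in> carrier G"
  shows "component A (\<phi> r) (\<sigma> i) = \<phi> (component A r i)"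
    and "k \<notin> range \<sigma> \<Longrightarrow> component A (\<phi> r) k = \<zero>"
proof -
  have \<phi>0: "\<phi> \<zero> = \<zero>"
  proof -
    have "\<phi> \<zero> \<oplus> \<phi> \<zero> = \<phi> \<zero>" using \<phi>[of \<zero> \<zero>] by simp
    then show ?thesis using \<phi>c[of \<zero>] by (metis add.r_cancel_one' zero_closed)
  qed
  note d = decomp_component[OF r]
  let ?f = "component A r" and ?F = "{i. component A r i \<noteq> \<zero>}"
  have fin: "finite ?F" by (rule decompE(2)[OF d])
  have c: "?f i \<in> carrier G" for i using component_mem[OF r] piece_carrier by blast
  have sum: "\<phi> (\<Oplus>i\<in>F. ?f i) = (\<Oplus>i\<in>F. \<phi> (?f i))" if "finite F" for F
    using that by (induction F rule: finite_induct) (simp_all add: \<phi>0 \<phi> \<phi>c c finsum_insert Pi_def)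
  \<comment> \<open>The candidate for the decomposition of the image: reindexed along
    \<open>\<sigma>\<close> and zero in the degrees that \<open>\<sigma>\<close> misses.\<close>
  define g where "g k = (if k \<in> range \<sigma> then \<phi> (?f (inv_into UNIV \<sigma> k)) else \<zero>)" for k
  have g\<sigma>: "g (\<sigma> i) = \<phi> (?f i)" for i using \<sigma> by (simp add: g_def)
  have "r = (\<Oplus>i\<in>?F. ?f i)" by (rule decompE(3)[OF d fin order_refl])
  then have "\<phi> r = (\<Oplus>i\<in>?F. \<phi> (?f i))" using sum[OF fin] by simp
  also have "\<dots> = (\<Oplus>i\<in>?F. g (\<sigma> i))" by (simp add: g\<sigma>)
  also have "\<dots> = (\<Oplus>k\<in>\<sigma> ` ?F. g k)"
    using \<sigma> c \<phi>c by (intro finsum_reindex[symmetric]) (auto simp: g\<sigma> inj_on_def inj_def)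
  finally have "decomp A (\<phi> r) g"
  proof (intro decompI[of _ "\<sigma> ` ?F"])
    show "g k \<in> A k" for k using deg component_mem[OF r] piece_zero \<sigma> by (auto simp: g_def)
    show "g k = \<zero>" if "k \<notin> \<sigma> ` ?F" for k
      using that \<sigma> \<phi>0 by (auto simp: g_def)
  qed (use fin in auto)
  then have g: "component A (\<phi> r) = g" using component_eq \<phi>c r by simp
  show "component A (\<phi> r) (\<sigma> i) = \<phi> (component A r i)" using g g\<sigma> by simp
  show "component A (\<phi> r) k = \<zero>" if "k \<notin> range \<sigma>" using g that by (simp add: g_def)
qed

lemma piece_induct:
  assumes r: "r \<in> carrier G" and P: "P \<zero>" "\<And>a b. a \<in> carrier G \<Longrightarrow> b \<in> carrier G \<Longrightarrow> P a \<Longrightarrow> P b \<Longrightarrow> P (a \<oplus> b)"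
    and piece: "\<And>i a. a \<in> A i \<Longrightarrow> P a"
  shows "P r"
proof -
  note d = decomp_component[OF r]
  have c: "component A r i \<in> carrier G" for i using component_mem[OF r] piece_carrier by blast
  have "P (\<Oplus>i\<in>F. component A r i)" if "finite F" for F
    using that
  proof (induction F rule: finite_induct)
    case (insert x F)
    have "P (component A r x)" using component_mem[OF r] piece by blast
    then show ?case using insert c by (simp add: finsum_insert Pi_def P(2) finsum_closed)
  qed (simp add: P)
  then show ?thesis using decompE(2,3)[OF d] by (metis order_refl)
qed

end

end

section \<open>Standard graded algebras and Krull dimension\<close>

context standard_graded_algebra
begin

text \<open>An ideal generated by forms is homogeneous. The elements all of whose components lie in
  \<open>Idl U\<close> form an ideal containing \<open>U\<close>, where closure under multiplication
  is checked on homogeneous factors by \<open>piece_induct\<close>.\<close>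

lemma Idl_component:
  assumes U: "U \<subseteq> gr 1" and b: "b \<in> Idl U"
  shows "component gr b i \<in> Idl U"
proof -
  note A = grading
  have Uc: "U \<subseteq> carrier R" using U piece_carrier[OF A] by blast
  have I: "ideal (Idl U) R" by (rule genideal_ideal[OF Uc])
  interpret I: ideal "Idl U" R by (rule I)
  define J where "J = {b \<in> carrier R. \<forall>i. component gr b i \<in> Idl U}"
  have J0: "\<zero> \<in> J" unfolding J_def using component_piece[OF A piece_zero[OF A]] by auto
  have Jadd: "a \<oplus> b \<in> J" if "a \<in> J" "b \<in> J" for a b
    using that component_add[OF A, of a b] by (auto simp: J_def)
  have Jmult: "r \<otimes> b \<in> J" if r: "r \<in> carrier R" and b: "b \<in> J" for r b
    using r
  proof (rule piece_induct[OF A])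
    have bc: "b \<in> carrier R" using b by (simp add: J_def)
    show "\<zero> \<otimes> b \<in> J" using J0 bc by simp
    show "(a \<oplus> a') \<otimes> b \<in> J" if "a \<in> carrier R" "a' \<in> carrier R" "a \<otimes> b \<in> J" "a' \<otimes> b \<in> J" for a a'
      using Jadd that bc by (simp add: l_distr)
    fix d a assume a: "a \<in> gr d"
    have ac: "a \<in> carrier R" by (rule piece_carrier[OF A a])
    have inj: "inj ((+) d)" by simp
    note cm = component_map[OF A, of "(\<otimes>) a" "(+) d" b, OF _ inj _ _ bc]
    have 1: "component gr (a \<otimes> b) (d + i) = a \<otimes> component gr b i" for i
      by (rule cm(1)) (use ac a mult_degree in \<open>auto simp: r_distr\<close>)
    have 2: "component gr (a \<otimes> b) k = \<zero>" if "k \<notin> range ((+) d)" for k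
      by (rule cm(2)[OF _ _ _ that]) (use ac a mult_degree in \<open>auto simp: r_distr\<close>)
    have "component gr (a \<otimes> b) k \<in> Idl U" for k
    proof (cases "k \<in> range ((+) d)")
      case True
      then show ?thesis using 1 b ac I.I_l_closed by (auto simp: J_def)
    next
      case False
      then show ?thesis using 2 by simp
    qed
    then show "a \<otimes> b \<in> J" using ac bc by (simp add: J_def)
  qed
  have "ideal J R"
  proof (rule idealI[OF ring_axioms])
    show "subgroup J (add_monoid R)"
    proof (rule add.subgroupI)
      show "J \<subseteq> carrier R" by (auto simp: J_def)
      show "J \<noteq> {}" using J0 by blast
      show "\<ominus> a \<in> J" if "a \<in> J" for a
        using Jmult[of "\<ominus> \<one>" a] that by (simp add: J_def l_minus)
    qed (use Jadd in auto)
    show "x \<otimes> a \<in> J" "a \<otimes> x \<in> J" if "a \<in> J" "x \<in> carrier R" for a x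
      using Jmult[OF that(2,1)] that by (auto simp: J_def m_comm)
  qed
  moreover have "U \<subseteq> J"
  proof
    fix u assume u: "u \<in> U"
    have "u \<in> Idl U" using genideal_self[OF Uc] u by blast
    then have "component gr u i \<in> Idl U" for i using component_piece[OF A, of u 1 i] u U by auto
    then show "u \<in> J" using u Uc by (auto simp: J_def)
  qed
  ultimately have "Idl U \<subseteq> J" by (rule genideal_minimal)
  then show ?thesis using b by (auto simp: J_def)
qed

text \<open>The sum of \<open>k\<close> and \<open>Idl U\<close> is a subring containing the
  generators, so it is everything. A form of positive degree is its own component, to which the
  summand from \<open>k\<close> contributes nothing, so it is a component of an element of
  \<open>Idl U\<close>.\<close>

lemma irrelevant_ideal_gens:
  assumes U: "U \<subseteq> gr 1" and gen: "generate_ring R (k \<union> U) = carrier R"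
  shows "Idl U = irrelevant_ideal R gr"
proof
  note A = grading
  have Uc: "U \<subseteq> carrier R" using U piece_carrier[OF A] by blast
  have I: "ideal (Idl U) R" by (rule genideal_ideal[OF Uc])
  interpret I: ideal "Idl U" R by (rule I)
  have k: "subring k R" by (rule subfieldE(1)[OF subfield_axioms])
  have kc: "a \<in> k \<Longrightarrow> a \<in> carrier R" for a using subringE(1)[OF k] by blast
  have grc: "(\<Union>i\<in>{1..}. gr i) \<subseteq> carrier R" using piece_carrier[OF A] by blast
  have "U \<subseteq> irrelevant_ideal R gr"
    using U genideal_self[OF grc] unfolding irrelevant_ideal_def by fastforce
  then show "Idl U \<subseteq> irrelevant_ideal R gr"
    using genideal_minimal genideal_ideal[OF grc] unfolding irrelevant_ideal_def by blast
  define T where "T = {a \<oplus> b | a b. a \<in> k \<and> b \<in> Idl U}"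
  have TI: "a \<in> k \<Longrightarrow> b \<in> Idl U \<Longrightarrow> a \<oplus> b \<in> T" for a b unfolding T_def by blast
  have sub: "subring T R"
  proof (rule subringI)
    show "T \<subseteq> carrier R" using kc I.Icarr by (auto simp: T_def)
    have "\<one> \<in> k" using subringE(3)[OF k] .
    then show "\<one> \<in> T" using TI[of \<one> \<zero>] by simp
    show "\<ominus> h \<in> T" if h: "h \<in> T" for h
    proof -
      obtain a b where ab: "h = a \<oplus> b" "a \<in> k" "b \<in> Idl U" using h by (auto simp: T_def)
      have "\<ominus> h = \<ominus> a \<oplus> \<ominus> b" using ab kc I.Icarr by (simp add: minus_add)
      then show ?thesis using TI[of "\<ominus> a" "\<ominus> b"] ab subringE(5)[OF k] by simp
    qed
    fix h h' assume "h \<in> T" "h' \<in> T"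
    then obtain a b a' b' where ab: "h = a \<oplus> b" "a \<in> k" "b \<in> Idl U" "h' = a' \<oplus> b'" "a' \<in> k" "b' \<in> Idl U"
      by (auto simp: T_def)
    then have c: "a \<in> carrier R" "b \<in> carrier R" "a' \<in> carrier R" "b' \<in> carrier R" using kc I.Icarr by auto
    have "h \<oplus> h' = (a \<oplus> a') \<oplus> (b \<oplus> b')" using ab c by (simp add: a_ac)
    then show "h \<oplus> h' \<in> T" using TI[of "a \<oplus> a'" "b \<oplus> b'"] ab subringE(7)[OF k] by simp
    have "h \<otimes> h' = a \<otimes> a' \<oplus> (a \<otimes> b' \<oplus> h' \<otimes> b)" using ab c by (simp add: l_distr r_distr m_comm a_ac)
    moreover have "a \<otimes> b' \<oplus> h' \<otimes> b \<in> Idl U" using ab c I.I_l_closed by simp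
    ultimately show "h \<otimes> h' \<in> T" using TI[of "a \<otimes> a'" "a \<otimes> b' \<oplus> h' \<otimes> b"] ab subringE(6)[OF k] by simp
  qed
  have kT: "k \<union> U \<subseteq> T"
  proof
    fix a assume a: "a \<in> k \<union> U"
    have "\<zero> \<in> k" using subringE(2)[OF k] .
    then show "a \<in> T" using TI[of a \<zero>] TI[of \<zero> a] a kc Uc genideal_self[OF Uc] by auto
  qed
  have "k \<union> U \<subseteq> carrier R" using kc Uc by blast
  then have RT: "carrier R \<subseteq> T" using generate_ring_min_subring1[OF _ sub kT] gen by simp
  have "r \<in> Idl U" if r: "r \<in> gr i" and i: "i \<ge> 1" for r i
  proof -
    have rc: "r \<in> carrier R" by (rule piece_carrier[OF A r])
    obtain a b where ab: "r = a \<oplus> b" "a \<in> k" "b \<in> Idl U" using RT rc by (auto simp: T_def)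
    have c: "a \<in> carrier R" "b \<in> carrier R" using ab kc I.Icarr by auto
    have "r = component gr r i" using component_piece[OF A r] by simp
    also have "\<dots> = component gr a i \<oplus> component gr b i" unfolding ab(1) by (rule component_add[OF A c])
    also have "component gr a i = \<zero>" using component_piece[OF A, of a 0 i] ab(2) i degree_zero by simp
    finally have "r = component gr b i"
      using Idl_component[OF U ab(3)] I.Icarr by simp
    then show ?thesis using Idl_component[OF U ab(3)] by simp
  qed
  then show "irrelevant_ideal R gr \<subseteq> Idl U"
    unfolding irrelevant_ideal_def by (intro genideal_minimal[OF I]) auto
qed

lemma irrelevant_gens_spec:
  "set (irrelevant_gens R gr) \<subseteq> gr 1" "Idl (set (irrelevant_gens R gr)) = irrelevant_ideal R gr"
proof -
  obtain U where U: "finite U" "U \<subseteq> gr 1" "generate_ring R (k \<union> U) = carrier R"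
    using generated_degree_one by blast
  obtain ys where ys: "set ys = U" using finite_list[OF U(1)] by blast
  have "\<exists>ys. set ys \<subseteq> gr 1 \<and> Idl (set ys) = irrelevant_ideal R gr"
    using irrelevant_ideal_gens[OF U(2,3)] U(2) ys by blast
  then have "set (irrelevant_gens R gr) \<subseteq> gr 1 \<and> Idl (set (irrelevant_gens R gr)) = irrelevant_ideal R gr"
    unfolding irrelevant_gens_def by (rule someI_ex)
  then show "set (irrelevant_gens R gr) \<subseteq> gr 1" "Idl (set (irrelevant_gens R gr)) = irrelevant_ideal R gr" by auto
qed

lemma standard_graded_acc: "acc_ideals R"
proof -
  obtain U where U: "finite U" "U \<subseteq> gr 1" "generate_ring R (k \<union> U) = carrier R"
    using generated_degree_one by blast
  have "U \<subseteq> carrier R" using U(2) piece_carrier[OF grading] by blast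
  then show ?thesis using noetherian_subring_acc_ideals noetherian_subring_generate[OF subfield_axioms U(1) _ U(3)] by blast
qed

end

section \<open>Prime ideals of a quotient ring\<close>

lemma (in cring) primeideal_image:
  assumes I: "ideal I R" and P: "primeideal P R" and IP: "I \<subseteq> P"
  shows "primeideal ((+>) I ` P) (R Quot I)"
proof -
  interpret I: ideal I R by fact
  interpret P: primeideal P R by fact
  interpret Q: cring "R Quot I" by (rule I.quotient_is_cring[OF cring_axioms])
  \<comment> \<open>Because \<open>I\<close> is contained in \<open>P\<close>, membership in
    \<open>P\<close> depends only on the coset modulo \<open>I\<close>.\<close>
  have mem: "a \<in> P" if a: "a \<in> carrier R" and im: "I +> a \<in> (+>) I ` P" for a
  proof -
    obtain b where b: "b \<in> P" "I +> a = I +> b" using im by (rule imageE)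
    have "a \<in> I +> b" using I.a_repr_independenceD[of a b] b a by simp
    then have "a \<ominus> b \<in> I" using I.a_rcos_module_minus[OF ring_axioms P.Icarr[OF b(1)] a] by simp
    then have "(a \<ominus> b) \<oplus> b \<in> P" using IP b by blast
    then show "a \<in> P" using a b P.Icarr by (simp add: minus_eq a_assoc l_neg)
  qed
  have carr: "carrier (R Quot I) = (+>) I ` carrier R"
    by (auto simp: FactRing_def A_RCOSETS_def RCOSETS_def a_r_coset_def)
  show ?thesis
  proof (rule primeidealI)
    show "ideal ((+>) I ` P) (R Quot I)" by (rule ring_ideal_imp_quot_ideal[OF I P.is_ideal])
    show "cring (R Quot I)" by (rule Q.cring_axioms)
    show "carrier (R Quot I) \<noteq> (+>) I ` P"
    proof
      assume eq: "carrier (R Quot I) = (+>) I ` P"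
      have "a \<in> P" if a: "a \<in> carrier R" for a
      proof -
        have "I +> a \<in> (+>) I ` carrier R" using a by (rule imageI)
        then show ?thesis using mem[OF a] eq carr by simp
      qed
      then have "carrier R \<subseteq> P" by (rule subsetI)
      then show False using P.I_notcarr P.a_subset by (metis subset_antisym)
    qed
    fix U V assume UV: "U \<in> carrier (R Quot I)" "V \<in> carrier (R Quot I)" "U \<otimes>\<^bsub>R Quot I\<^esub> V \<in> (+>) I ` P"
    obtain a where a: "a \<in> carrier R" "U = I +> a" using UV(1) unfolding carr by (rule imageE)
    obtain b where b: "b \<in> carrier R" "V = I +> b" using UV(2) unfolding carr by (rule imageE)
    note ab = a b
    have "U \<otimes>\<^bsub>R Quot I\<^esub> V = I +> (a \<otimes> b)" using ab by (simp add: FactRing_def I.rcoset_mult_add)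
    then have "a \<otimes> b \<in> P" using mem[of "a \<otimes> b"] ab UV(3) by simp
    then have "a \<in> P \<or> b \<in> P" by (rule P.I_prime[OF a(1) b(1)])
    then show "U \<in> (+>) I ` P \<or> V \<in> (+>) I ` P" unfolding a(2) b(2) by (auto intro: imageI)
  qed
qed

text \<open>Used contrapositively: a number not bounded by the dimension of R/I admits no chain of
  that length above \<open>I\<close>.\<close>

lemma (in cring) krull_dim_Quot_ge:
  assumes I: "ideal I R" and ch: "prime_chain R I n"
  shows "ereal (real n) \<le> krull_dim (R Quot I)"
proof -
  interpret I: ideal I R by fact
  obtain P where P: "\<forall>i\<le>n. primeideal (P i) R \<and> I \<subseteq> P i" "\<forall>i<n. P i \<subset> P (Suc i)"
    using ch unfolding prime_chain_def by blast
  have pr: "primeideal ((+>) I ` P i) (R Quot I)" if "i \<le> n" for i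
    using P(1) that by (intro primeideal_image[OF I]) auto
  have lt: "(+>) I ` P i \<subset> (+>) I ` P (Suc i)" if i: "i < n" for i
  proof -
    obtain a where a: "a \<in> P (Suc i)" "a \<notin> P i" using P(2) i by blast
    interpret Pi: primeideal "P i" R using P(1) i by simp
    interpret Ps: primeideal "P (Suc i)" R using P(1) i by simp
    have "I +> a \<notin> (+>) I ` P i"
    proof
      assume "I +> a \<in> (+>) I ` P i"
      then obtain b where b: "b \<in> P i" "I +> a = I +> b" by (rule imageE)
      have ac: "a \<in> carrier R" using a Ps.Icarr by blast
      have "a \<in> I +> b" using I.a_repr_independenceD[of a b] b ac by simp
      then have "a \<ominus> b \<in> I" using I.a_rcos_module_minus[OF ring_axioms Pi.Icarr[OF b(1)] ac] by simp
      then have "a \<ominus> b \<in> P i" using P(1) i less_imp_le by blast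
      then have "(a \<ominus> b) \<oplus> b \<in> P i" using b by simp
      then show False using a ac b Pi.Icarr by (simp add: minus_eq a_assoc l_neg)
    qed
    moreover have "I +> a \<in> (+>) I ` P (Suc i)" using a(1) by (rule imageI)
    moreover have "(+>) I ` P i \<subseteq> (+>) I ` P (Suc i)" using P(2) i by (intro image_mono) auto
    ultimately show ?thesis by blast
  qed
  show ?thesis unfolding krull_dim_def
  proof (rule Sup_upper, intro CollectI exI conjI)
    show "\<forall>i\<le>n. primeideal ((+>) I ` P i) (R Quot I)" using pr by blast
    show "\<forall>i<n. (+>) I ` P i \<subset> (+>) I ` P (Suc i)" using lt by blast
  qed simp
qed

section \<open>Regular sequences\<close>

context module
begin

lemma submodule_Inter:
  assumes "\<And>N. N \<in> \<N> \<Longrightarrow> submodule N R M" "\<N> \<noteq> {}"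
  shows "submodule (\<Inter>\<N>) R M"
proof (rule submoduleI)
  obtain N where "N \<in> \<N>" using assms(2) by blast
  then show "\<Inter>\<N> \<subseteq> carrier M" using submoduleE(1)[OF assms(1)] by blast
  show "\<zero>\<^bsub>M\<^esub> \<in> \<Inter>\<N>" using submodule_zero[OF assms(1)] by blast
  show "\<ominus>\<^bsub>M\<^esub> a \<in> \<Inter>\<N>" if "a \<in> \<Inter>\<N>" for a using submoduleE(3)[OF assms(1)] that by blast
  show "a \<oplus>\<^bsub>M\<^esub> b \<in> \<Inter>\<N>" if "a \<in> \<Inter>\<N>" "b \<in> \<Inter>\<N>" for a b using submoduleE(5)[OF assms(1)] that by blast
  show "r \<odot>\<^bsub>M\<^esub> a \<in> \<Inter>\<N>" if "r \<in> carrier R" "a \<in> \<Inter>\<N>" for r a using submoduleE(4)[OF assms(1)] that by blast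
qed

lemma module_span_submodule: "V \<subseteq> carrier M \<Longrightarrow> submodule (module_span R M V) R M"
  unfolding module_span_def using carrier_is_submodule by (intro submodule_Inter) blast+

lemma module_span_incl: "V \<subseteq> module_span R M V"
  unfolding module_span_def by blast

lemma module_span_least: "submodule N R M \<Longrightarrow> V \<subseteq> N \<Longrightarrow> module_span R M V \<subseteq> N"
  unfolding module_span_def by blast

lemma seq_smult_submodule: "set ys \<subseteq> carrier R \<Longrightarrow> submodule (seq_smult R M ys) R M"
  unfolding seq_smult_def by (rule module_span_submodule) (auto intro!: smult_closed)

lemma seq_smult_Nil: "seq_smult R M [] = {\<zero>\<^bsub>M\<^esub>}"
proof
  show "seq_smult R M [] \<subseteq> {\<zero>\<^bsub>M\<^esub>}" unfolding seq_smult_def by (rule module_span_least[OF zero_submodule]) simp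
  show "{\<zero>\<^bsub>M\<^esub>} \<subseteq> seq_smult R M []" using submodule_zero[OF seq_smult_submodule[of "[]"]] by simp
qed

text \<open>Puts the submodules of a regular sequence into the form N + yM, in which
  \<open>vanishes_below_depth\<close> consumes them.\<close>

lemma seq_smult_snoc:
  assumes ys: "set ys \<subseteq> carrier R" and y: "y \<in> carrier R"
  shows "seq_smult R M (ys @ [y]) = padd (seq_smult R M ys) (carrier M) y"
proof
  let ?N = "seq_smult R M ys" and ?N' = "seq_smult R M (ys @ [y])"
  have N: "submodule ?N R M" using ys by (rule seq_smult_submodule)
  have N': "submodule ?N' R M" using ys y by (intro seq_smult_submodule) simp
  have P: "submodule (padd ?N (carrier M) y) R M" by (rule padd_submodule[OF N carrier_is_submodule y])
  have g: "z \<odot>\<^bsub>M\<^esub> m \<in> seq_smult R M zs" if "z \<in> set zs" "m \<in> carrier M" for z m zs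
    unfolding seq_smult_def using that by (intro subsetD[OF module_span_incl]) blast
  have "z \<odot>\<^bsub>M\<^esub> m \<in> padd ?N (carrier M) y" if zm: "z \<in> set (ys @ [y])" "m \<in> carrier M" for z m
  proof (cases "z \<in> set ys")
    case True
    then show ?thesis using g zm padd_incl[OF N carrier_is_submodule y] by blast
  next
    case False
    have "y \<odot>\<^bsub>M\<^esub> m = \<zero>\<^bsub>M\<^esub> \<oplus>\<^bsub>M\<^esub> y \<odot>\<^bsub>M\<^esub> m" using y zm by simp
    then have "y \<odot>\<^bsub>M\<^esub> m \<in> padd ?N (carrier M) y" using zm(2) submodule_zero[OF N] unfolding padd_def by blast
    then show ?thesis using False zm(1) by simp
  qed
  then show "?N' \<subseteq> padd ?N (carrier M) y"
    unfolding seq_smult_def[of R M "ys @ [y]"] by (intro module_span_least[OF P]) blast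
  have g': "z \<odot>\<^bsub>M\<^esub> m \<in> ?N'" if "z \<in> set ys" "m \<in> carrier M" for z m using that by (intro g) auto
  have NN: "?N \<subseteq> ?N'"
    unfolding seq_smult_def[of R M ys] using g' by (intro module_span_least[OF N']) blast
  have yN: "y \<odot>\<^bsub>M\<^esub> m \<in> ?N'" if "m \<in> carrier M" for m using that by (intro g) auto
  show "padd ?N (carrier M) y \<subseteq> ?N'"
  proof
    fix a assume "a \<in> padd ?N (carrier M) y"
    then obtain n m where a: "a = n \<oplus>\<^bsub>M\<^esub> y \<odot>\<^bsub>M\<^esub> m" "n \<in> ?N" "m \<in> carrier M" unfolding padd_def by blast
    show "a \<in> ?N'" unfolding a(1) using NN a(2) yN[OF a(3)] by (intro submoduleE(5)[OF N']) auto
  qed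
qed

end

context koszul
begin

text \<open>Regularity on the quotient module is read back in M: a coset killed by the next element
  is zero exactly when \<open>colon\<close> adds nothing to the submodule.\<close>

lemma vanishes_ungraded_regular_sequence:
  assumes reg: "regular_sequence R M ys" and ys: "set ys \<subseteq> Idl (set xs)" and p: "p < length ys"
  shows "vanishes_ungraded (carrier M) {\<zero>\<^bsub>M\<^esub>} (int p)"
proof -
  define N where "N i = seq_smult R M (take i ys)" for i
  have yc: "set ys \<subseteq> carrier R" using reg by (simp add: regular_sequence_def)
  have tc: "set (take i ys) \<subseteq> carrier R" for i using yc set_take_subset by fastforce
  have N: "submodule (N i) R M" for i unfolding N_def by (rule seq_smult_submodule[OF tc])
  have c: "colon (N i) (carrier M) (ys ! i) = N i" if i: "i < length ys" for i
  proof -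
    have yi: "ys ! i \<in> carrier R" using yc i nth_mem by blast
    let ?Q = "quotient_module R M (N i)"
    have nz: "\<forall>z\<in>carrier ?Q. (ys ! i) \<odot>\<^bsub>?Q\<^esub> z = \<zero>\<^bsub>?Q\<^esub> \<longrightarrow> z = \<zero>\<^bsub>?Q\<^esub>"
      using reg i unfolding regular_sequence_def Let_def N_def by blast
    have "m \<in> N i" if m: "m \<in> carrier M" "(ys ! i) \<odot>\<^bsub>M\<^esub> m \<in> N i" for m
    proof -
      have "(ys ! i) \<odot>\<^bsub>?Q\<^esub> (N i +>\<^bsub>M\<^esub> m) = \<zero>\<^bsub>?Q\<^esub>"
        using m yi coset_eq_self_iff[OF N, of "(ys ! i) \<odot>\<^bsub>M\<^esub> m" i] by (simp add: quotient_smult[OF N] quotient_zero[OF N])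
      then have "N i +>\<^bsub>M\<^esub> m = \<zero>\<^bsub>?Q\<^esub>" using nz coset_in_quotient[OF N m(1)] by blast
      then show ?thesis using coset_eq_self_iff[OF N m(1)] by (simp add: quotient_zero[OF N])
    qed
    moreover have "(ys ! i) \<odot>\<^bsub>M\<^esub> m \<in> N i" if "m \<in> N i" for m using that yi submoduleE(4)[OF N] by blast
    ultimately show ?thesis using submodule_carrier[OF N] unfolding colon_def by blast
  qed
  have s: "padd (N i) (carrier M) (ys ! i) = N (Suc i)" if i: "i < length ys" for i
  proof -
    have yi: "ys ! i \<in> carrier R" using yc i nth_mem by blast
    show ?thesis unfolding N_def take_Suc_conv_app_nth[OF i] by (rule seq_smult_snoc[OF tc yi, symmetric])
  qed
  have "ys ! i \<in> Idl (set xs)" if "i < length ys" for i using ys that nth_mem by blast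
  from vanishes_below_depth[of "length ys" N "\<lambda>i. ys ! i" 0 "int p", OF N this c s] p
  show ?thesis by (simp add: N_def seq_smult_Nil)
qed

lemma vanishes_ungraded_depth:
  assumes I: "Idl (set xs) = irrelevant_ideal R gr" and p: "ereal (real p) < module_depth R gr M"
  shows "vanishes_ungraded (carrier M) {\<zero>\<^bsub>M\<^esub>} (int p)"
proof (cases "carrier M = {\<zero>\<^bsub>M\<^esub>}")
  \<comment> \<open>The zero module has depth infinity by convention, with no regular sequence
    behind it. Its cohomology vanishes outright.\<close>
  case True
  interpret T: graded_koszul R M xs "\<lambda>_ m. m" by (rule graded_koszul_ungraded)
  show ?thesis unfolding True by (rule T.vanishes_refl[OF graded_sub_ungraded[OF zero_submodule]])
next
  case False
  have "ereal (real p) < Sup {ereal (real (length ys)) | ys. set ys \<subseteq> irrelevant_ideal R gr \<and> regular_sequence R M ys}"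
    using p unfolding module_depth_def if_not_P[OF False] .
  then obtain ys where "set ys \<subseteq> irrelevant_ideal R gr" "regular_sequence R M ys" "p < length ys"
    unfolding less_Sup_iff by auto
  then show ?thesis using vanishes_ungraded_regular_sequence I by simp
qed

lemma vanishes_ungraded_dim:
  assumes acc: "acc_ideals R" and K: "submodule K R M"
    and p: "\<not> ereal (real p) \<le> module_dim R (M\<lparr>carrier := K\<rparr>)"
  shows "vanishes_ungraded K {\<zero>\<^bsub>M\<^esub>} (int p)"
proof (rule vanishes_above_dim[OF acc K])
  let ?A = "{r \<in> carrier R. \<forall>m\<in>K. r \<odot>\<^bsub>M\<^esub> m = \<zero>\<^bsub>M\<^esub>}"
  note Kc = submodule_carrier[OF K]
  have I: "ideal ?A R"
  proof (rule idealI[OF R.ring_axioms])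
    show "subgroup ?A (add_monoid R)"
    proof (rule R.add.subgroupI)
      have "\<zero> \<in> ?A" using Kc by simp
      then show "?A \<noteq> {}" by blast
    qed (use Kc in \<open>auto simp: smult_l_minus smult_l_distr\<close>)
    show "r \<otimes> a \<in> ?A" if "a \<in> ?A" "r \<in> carrier R" for a r
      using that Kc by (simp add: smult_assoc1)
    then show "a \<otimes> r \<in> ?A" if "a \<in> ?A" "r \<in> carrier R" for a r
      using that R.m_comm[of a r] by simp
  qed
  have A: "module_ann R (M\<lparr>carrier := K\<rparr>) = ?A" by (simp add: module_ann_def)
  show "\<not> prime_chain R ?A p" using R.krull_dim_Quot_ge[OF I, of p] p unfolding module_dim_def A by blast
qed

end

section \<open>Exact sequences for multiplication by x on M\<close>

context graded_koszul
begin

text \<open>The submodules 0 : x and xM, written as instances of \<open>colon\<close> and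
  \<open>padd\<close> so that the lemmas on subquotients apply to them.\<close>

abbreviation K_sub :: "'a \<Rightarrow> 'c set" where "K_sub x \<equiv> colon {\<zero>\<^bsub>M\<^esub>} (carrier M) x"
abbreviation P_sub :: "'a \<Rightarrow> 'c set" where "P_sub x \<equiv> padd {\<zero>\<^bsub>M\<^esub>} (carrier M) x"

lemma graded_sub_zero: "graded_sub pr {\<zero>\<^bsub>M\<^esub>}"
  using zero_submodule proj by (simp add: graded_sub_def grading_proj_zero)

lemma graded_sub_carrier_M: "graded_sub pr (carrier M)"
  using carrier_is_submodule proj by (simp add: graded_sub_def grading_projD)

context
  fixes x and d :: int
  assumes x: "homog_elt pr d x"
begin

lemmas gK = colon_graded[OF proj graded_sub_zero graded_sub_carrier_M x]
lemmas gP = padd_graded[OF proj graded_sub_zero graded_sub_carrier_M x]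

lemma zero_in_graded: "graded_sub pr N \<Longrightarrow> {\<zero>\<^bsub>M\<^esub>} \<subseteq> N"
  using submodule_zero graded_subD(1) by blast

lemma graded_in_carrier: "graded_sub pr N \<Longrightarrow> N \<subseteq> carrier M"
  using submoduleE(1) graded_subD(1) by blast

lemma vanishes_module_from_ends:
  assumes "x \<in> Idl (set xs)"
    and "\<And>k. vanishes pr (K_sub x) {\<zero>\<^bsub>M\<^esub>} p (j + int k * d)"
    and "\<And>k. vanishes pr (carrier M) (P_sub x) (p - 1) (j + int k * d + d)"
  shows "vanishes pr (carrier M) {\<zero>\<^bsub>M\<^esub>} p j"
  by (rule vanishes_torsion[OF graded_sub_zero graded_sub_carrier_M x zero_in_graded[OF graded_sub_carrier_M] assms])

text \<open>Follow the obstruction backwards: from M/xM in cohomological degree p - 2 to xM in p -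
  1, then through multiplication by x to M/K in p - 1 and internal degree \<open>j\<close>, and on
  to K in degree p. At both connecting maps the neighbouring term from M vanishes.\<close>

lemma vanishes_kernel:
  assumes "vanishes pr (carrier M) {\<zero>\<^bsub>M\<^esub>} p j" "vanishes pr (carrier M) {\<zero>\<^bsub>M\<^esub>} (p - 1) (j + d)"
    and "vanishes pr (carrier M) (P_sub x) (p - 2) (j + d)"
  shows "vanishes pr (K_sub x) {\<zero>\<^bsub>M\<^esub>} p j"
proof -
  have "vanishes pr (P_sub x) {\<zero>\<^bsub>M\<^esub>} (p - 1) (j + d)"
    using vanishes_sub[OF graded_sub_zero gP graded_sub_carrier_M zero_in_graded[OF gP] graded_in_carrier[OF gP]] assms(2,3)
    by simp
  then have "vanishes pr (carrier M) (K_sub x) (p - 1) j"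
    by (rule vanishes_colon[OF graded_sub_zero graded_sub_carrier_M x zero_in_graded[OF graded_sub_carrier_M]])
  then show ?thesis
    using vanishes_sub[OF graded_sub_zero gK graded_sub_carrier_M zero_in_graded[OF gK] graded_in_carrier[OF gK]] assms(1)
    by blast
qed

text \<open>Here one starts at K in cohomological degree p + 2, passes to M/K in p + 1, then by
  multiplication by x to xM in internal degree \<open>j\<close>, and finally to M/xM in degree
  p.\<close>

lemma vanishes_cokernel:
  assumes "vanishes pr (carrier M) {\<zero>\<^bsub>M\<^esub>} p j" "vanishes pr (carrier M) {\<zero>\<^bsub>M\<^esub>} (p + 1) (j - d)"
    and "vanishes pr (K_sub x) {\<zero>\<^bsub>M\<^esub>} (p + 2) (j - d)"
  shows "vanishes pr (carrier M) (P_sub x) p j"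
proof -
  have "vanishes pr (carrier M) (K_sub x) (p + 1) (j - d)"
    using vanishes_quot[OF graded_sub_zero gK graded_sub_carrier_M zero_in_graded[OF gK] graded_in_carrier[OF gK] assms(2)] assms(3)
    by (simp add: add.commute)
  then have "vanishes pr (P_sub x) {\<zero>\<^bsub>M\<^esub>} (p + 1) j"
    using vanishes_padd[OF graded_sub_zero graded_sub_carrier_M x, of "p + 1" "j - d"] by simp
  then show ?thesis
    by (rule vanishes_quot[OF graded_sub_zero gP graded_sub_carrier_M zero_in_graded[OF gP] graded_in_carrier[OF gP] assms(1)])
qed

end

end

section \<open>Comparison of the regularities\<close>

text \<open>\<open>V i j\<close> stands for the vanishing of H^i in degree \<open>j\<close>. All
  three regularities take this shape, which reduces the equation to arithmetic of indices.\<close>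

definition reg_sup :: "(nat \<Rightarrow> int \<Rightarrow> bool) \<Rightarrow> ereal" where
  "reg_sup V = Sup {ereal (real i + real_of_int j) | i j. \<not> V i j}"

lemma reg_sup_upper: "\<not> V i j \<Longrightarrow> ereal (real i + real_of_int j) \<le> reg_sup V"
  unfolding reg_sup_def by (rule Sup_upper) blast

lemma reg_sup_least: "(\<And>i j. \<not> V i j \<Longrightarrow> ereal (real i + real_of_int j) \<le> B) \<Longrightarrow> reg_sup V \<le> B"
  unfolding reg_sup_def by (rule Sup_least) blast

lemma ereal_shift_le:
  fixes a b e f :: real and r :: ereal
  assumes "ereal a \<le> r" "b \<le> a - e + f"
  shows "ereal b \<le> r - ereal e + ereal f"
  using assms by (cases r) auto

text \<open>The hypotheses are what the exact sequences provide, with the possibly obstructing term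
  already removed from \<open>ker\<close>. Infinite values are covered, as everything is compared
  with single indices i + j.\<close>

lemma reg_sup_eq_max:
  fixes VM VK VQ :: "nat \<Rightarrow> int \<Rightarrow> bool" and d :: nat
  assumes d: "d \<ge> 1"
    and up: "\<And>i j. (\<And>k::nat. VK i (j + int k * int d)) \<Longrightarrow>
      (\<And>(k::nat) q. i = Suc q \<Longrightarrow> VQ q (j + int k * int d + int d)) \<Longrightarrow> VM i j"
    and ker: "\<And>i j. VM i j \<Longrightarrow> (\<And>q. i = Suc q \<Longrightarrow> VM q (j + int d)) \<Longrightarrow> VK i j"
    and coker: "\<And>i j. VM i j \<Longrightarrow> VM (i + 1) (j - int d) \<Longrightarrow> VK (i + 2) (j - int d) \<Longrightarrow> VQ i j"
  shows "reg_sup VM = max (reg_sup VK) (reg_sup VQ - ereal (real d) + 1)"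
proof (rule antisym)
  show "reg_sup VM \<le> max (reg_sup VK) (reg_sup VQ - ereal (real d) + 1)"
  proof (rule reg_sup_least, rule ccontr)
    fix i j assume nV: "\<not> VM i j"
      and "\<not> ereal (real i + real_of_int j) \<le> max (reg_sup VK) (reg_sup VQ - ereal (real d) + 1)"
    then have K: "reg_sup VK < ereal (real i + real_of_int j)"
      and Q: "reg_sup VQ - ereal (real d) + 1 < ereal (real i + real_of_int j)" by (auto simp: not_le)
    have "VM i j"
    proof (rule up)
      fix k :: nat
      show "VK i (j + int k * int d)"
      proof (rule ccontr)
        assume "\<not> VK i (j + int k * int d)"
        then have "ereal (real i + real_of_int (j + int k * int d)) \<le> reg_sup VK" by (rule reg_sup_upper)
        moreover have "real i + real_of_int j \<le> real i + real_of_int (j + int k * int d)" by simp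
        ultimately have "ereal (real i + real_of_int j) \<le> reg_sup VK" using order_trans ereal_less_eq(3) by blast
        then show False using K by simp
      qed
      fix q assume i: "i = Suc q"
      show "VQ q (j + int k * int d + int d)"
      proof (rule ccontr)
        assume "\<not> VQ q (j + int k * int d + int d)"
        then have "ereal (real q + real_of_int (j + int k * int d + int d)) \<le> reg_sup VQ" by (rule reg_sup_upper)
        \<comment> \<open>Since i = q + 1, the class found here has index at least i + j + d - 1.
          This is the source of the shift by 1 - d.\<close>
        then have "ereal (real i + real_of_int j) \<le> reg_sup VQ - ereal (real d) + ereal 1"
          by (rule ereal_shift_le) (simp add: i)
        then show False using Q by (simp add: one_ereal_def)
      qed
    qed
    then show False using nV by blast
  qed
  have KM: "reg_sup VK \<le> reg_sup VM"
  proof (rule reg_sup_least, rule ccontr)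
    fix i j assume nV: "\<not> VK i j" and "\<not> ereal (real i + real_of_int j) \<le> reg_sup VM"
    then have M: "reg_sup VM < ereal (real i + real_of_int j)" by simp
    have "VM i j" using M reg_sup_upper by fastforce
    moreover have "VM q (j + int d)" if i: "i = Suc q" for q
    proof (rule ccontr)
      assume "\<not> VM q (j + int d)"
      then have "ereal (real q + real_of_int (j + int d)) \<le> reg_sup VM" by (rule reg_sup_upper)
      \<comment> \<open>Here d >= 1 enters: the loss of one cohomological degree is made up by the
        gain of \<open>d\<close> in internal degree.\<close>
      moreover have "real i + real_of_int j \<le> real q + real_of_int (j + int d)" using d i by simp
      ultimately have "ereal (real i + real_of_int j) \<le> reg_sup VM" using order_trans ereal_less_eq(3) by blast
      then show False using M by simp
    qed
    ultimately show False using ker nV by blast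
  qed
  \<comment> \<open>The shift is added on the side of M, which postpones the subtraction on extended
    reals to the end.\<close>
  have "reg_sup VQ \<le> reg_sup VM + ereal (real d - 1)"
  proof (rule reg_sup_least, rule ccontr)
    fix i j assume nV: "\<not> VQ i j" and n: "\<not> ereal (real i + real_of_int j) \<le> reg_sup VM + ereal (real d - 1)"
    have bound: "VM i' j'" if le: "real i + real_of_int j - (real d - 1) \<le> real i' + real_of_int j'" for i' j'
    proof (rule ccontr)
      assume "\<not> VM i' j'"
      then have "ereal (real i' + real_of_int j') \<le> reg_sup VM" by (rule reg_sup_upper)
      then have "ereal (real i + real_of_int j) \<le> reg_sup VM + ereal (real d - 1)"
        using le by (cases "reg_sup VM") auto
      then show False using n by blast
    qed
    have "VK (i + 2) (j - int d)"
    proof (rule ccontr)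
      \<comment> \<open>The index is i + j - d + 2, one more than the bound requires, and K is
        compared with M by the inequality just proved.\<close>
      assume "\<not> VK (i + 2) (j - int d)"
      then have "ereal (real (i + 2) + real_of_int (j - int d)) \<le> reg_sup VM"
        using reg_sup_upper KM order_trans by blast
      then have "ereal (real i + real_of_int j) \<le> reg_sup VM + ereal (real d - 1)"
        by (cases "reg_sup VM") auto
      then show False using n by blast
    qed
    moreover have "VM i j" "VM (i + 1) (j - int d)" using d by (auto intro!: bound)
    ultimately show False using coker nV by blast
  qed
  then have "reg_sup VQ - ereal (real d) + 1 \<le> reg_sup VM"
    by (cases "reg_sup VM"; cases "reg_sup VQ") (auto simp: one_ereal_def)
  then show "max (reg_sup VK) (reg_sup VQ - ereal (real d) + 1) \<le> reg_sup VM" using KM by simp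
qed

lemma (in graded_koszul) regularity_reg_sup:
  assumes "xs = irrelevant_gens R gr" "\<And>e. gm e = {m \<in> carrier M. pr e m = m}"
  shows "regularity R gr M gm = reg_sup (\<lambda>i j. vanishes pr (carrier M) {\<zero>\<^bsub>M\<^esub>} (int i) j)"
  unfolding regularity_def reg_sup_def local_cohomology_grading_def local_cohomology_def
  using cech_cohomology_vanishes_iff[OF assms(2)] assms(1) by simp

lemma (in graded_ring) gr_carrier: "a \<in> gr i \<Longrightarrow> a \<in> carrier R"
  by (rule piece_carrier[OF grading])

section \<open>Projections onto the homogeneous components of a graded module\<close>

context graded_module
begin

definition deg_part :: "int \<Rightarrow> 'b \<Rightarrow> 'b" where
  "deg_part e m = M.component gm m e"

lemma deg_part_piece: "gm e = {m \<in> carrier M. deg_part e m = m}"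
proof (intro equalityI subsetI CollectI conjI)
  fix m assume m: "m \<in> gm e"
  show "m \<in> carrier M" by (rule M.piece_carrier[OF module_grading m])
  show "deg_part e m = m" unfolding deg_part_def using M.component_piece[OF module_grading m, of e] by simp
next
  fix m assume "m \<in> {m \<in> carrier M. deg_part e m = m}"
  then show "m \<in> gm e" using M.component_mem[OF module_grading, of m e] by (simp add: deg_part_def)
qed

lemma grading_proj_deg_part: "grading_proj deg_part"
  unfolding grading_proj_def
proof (intro conjI allI ballI)
  fix e m assume m: "m \<in> carrier M"
  have "deg_part e m \<in> gm e" unfolding deg_part_def by (rule M.component_mem[OF module_grading m])
  then show "deg_part e m \<in> carrier M" "deg_part e (deg_part e m) = deg_part e m"
    unfolding deg_part_piece[of e] by auto
  show "deg_part e (m \<oplus>\<^bsub>M\<^esub> n) = deg_part e m \<oplus>\<^bsub>M\<^esub> deg_part e n" if "n \<in> carrier M" for n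
    unfolding deg_part_def by (rule M.component_add[OF module_grading m that])
qed

lemma homog_elt_deg_part: "r \<in> gr d \<Longrightarrow> homog_elt deg_part (int d) r"
proof -
  assume r: "r \<in> gr d"
  have rc: "r \<in> carrier R" by (rule gr_carrier[OF r])
  have inj: "inj (\<lambda>e. e + int d)" by (simp add: inj_def)
  have "M.component gm (r \<odot>\<^bsub>M\<^esub> m) (e + int d) = r \<odot>\<^bsub>M\<^esub> M.component gm m e" if "m \<in> carrier M" for e m
    by (rule M.component_map(1)[OF module_grading, of "\<lambda>m. r \<odot>\<^bsub>M\<^esub> m" "\<lambda>e. e + int d"])
      (use that rc inj smult_degree[OF r] in \<open>auto simp: smult_r_distr add.commute\<close>)
  then show ?thesis using rc by (simp add: homog_elt_def deg_part_def)
qed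

lemma graded_koszul_deg_part: "set ys \<subseteq> gr 1 \<Longrightarrow> graded_koszul R M ys deg_part"
proof (intro graded_koszul.intro koszul.intro koszul_axioms.intro graded_koszul_axioms.intro module_axioms)
  assume ys: "set ys \<subseteq> gr 1"
  show "set ys \<subseteq> carrier R" using ys gr_carrier by blast
  show "homog_elt deg_part 1 y" if "y \<in> set ys" for y
    using homog_elt_deg_part[of y 1] ys that by auto
qed (rule grading_proj_deg_part)

end

text \<open>With \<open>a\<close> the dimension and \<open>b\<close> the depth, n + 2 <= dim gives n
  < n + 1 <= dim - 1 <= depth. The strict inequality is what vanishing below the depth
  needs.\<close>

lemma ereal_less_of_le_minus_1:
  assumes "ereal (real (Suc (Suc n))) \<le> a" "a - 1 \<le> b"
  shows "ereal (real n) < b"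
proof -
  have "ereal (real n) < a - 1" using assms(1) by (cases a) (auto simp: one_ereal_def)
  then show ?thesis using assms(2) by (rule less_le_trans)
qed

theorem corollary7p6:
  fixes k :: "'a set"
    and R :: "('a, 'm) ring_scheme" and gr :: "nat \<Rightarrow> 'a set"
    and M :: "('a, 'b, 'n) module_scheme" and gm :: "int \<Rightarrow> 'b set"
    and x :: 'a and d :: nat
  assumes "standard_graded_algebra k R gr"
    and "graded_module R gr M gm"
    and "fin_gen_module R M"
    and "x \<in> gr d" and "d \<ge> 1"
    and "module_depth R gr (mod_elt R M x) \<ge> module_dim R (zero_colon M x) - 1"
  shows "regularity R gr M gm =
    max (regularity R gr (zero_colon M x) (zero_colon_grading M gm x))
        (regularity R gr (mod_elt R M x) (mod_elt_grading M gm x) - ereal (real d) + 1)"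
proof -
  interpret S: standard_graded_algebra k R gr by fact
  interpret G: graded_module R gr M gm by fact
  define xs where "xs = irrelevant_gens R gr"
  define pr where "pr = G.deg_part"
  have xs: "set xs \<subseteq> gr 1" "Idl\<^bsub>R\<^esub> (set xs) = irrelevant_ideal R gr"
    unfolding xs_def by (rule S.irrelevant_gens_spec)+
  interpret A: graded_koszul R M xs pr
    unfolding pr_def by (rule G.graded_koszul_deg_part[OF xs(1)])
  have gm: "gm e = {m \<in> carrier M. pr e m = m}" for e unfolding pr_def by (rule G.deg_part_piece)
  have hx: "G.homog_elt pr (int d) x" unfolding pr_def by (rule G.homog_elt_deg_part) fact
  have xc: "x \<in> carrier R" using hx by (rule G.homog_eltD)
  \<comment> \<open>Because \<open>d\<close> is positive, \<open>x\<close> lies in the irrelevant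
    ideal, so some power of it kills each cohomology class.\<close>
  have xI: "x \<in> Idl\<^bsub>R\<^esub> (set xs)"
  proof -
    have "(\<Union>i\<in>{1..}. gr i) \<subseteq> carrier R" using S.gr_carrier by blast
    then have "(\<Union>i\<in>{1..}. gr i) \<subseteq> irrelevant_ideal R gr" unfolding irrelevant_ideal_def by (rule S.genideal_self)
    then show ?thesis unfolding xs(2) using assms(4,5) by auto
  qed
  define K where "K = A.K_sub x"
  define P where "P = A.P_sub x"
  define Q where "Q = quotient_module R M P"
  have gK: "G.graded_sub pr K" unfolding K_def by (rule A.gK[OF hx])
  have gP: "G.graded_sub pr P" unfolding P_def by (rule A.gP[OF hx])
  have sK: "submodule K R M" and sP: "submodule P R M" using gK gP G.graded_subD by blast+
  note Kc = G.submodule_carrier[OF sK]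
  have eK: "zero_colon M x = M\<lparr>carrier := K\<rparr>"
    unfolding zero_colon_def K_def G.colon_def by simp
  have "elt_smult x M = P"
  proof -
    have z: "x \<odot>\<^bsub>M\<^esub> m = \<zero>\<^bsub>M\<^esub> \<oplus>\<^bsub>M\<^esub> x \<odot>\<^bsub>M\<^esub> m" if "m \<in> carrier M" for m using xc that by simp
    have "P = {x \<odot>\<^bsub>M\<^esub> m | m. m \<in> carrier M}"
      unfolding P_def G.padd_def using z by (metis (no_types, lifting) singletonD singletonI)
    then show ?thesis unfolding elt_smult_def by blast
  qed
  then have eQ: "mod_elt R M x = Q" "mod_elt_grading M gm x = quotient_grading M gm P"
    unfolding mod_elt_def mod_elt_grading_def Q_def by simp_all
  interpret B: graded_koszul R "M\<lparr>carrier := K\<rparr>" xs pr by (rule A.graded_koszul_submodule[OF gK])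
  interpret C: graded_koszul R Q xs "G.quotient_proj P pr"
    unfolding Q_def by (rule A.graded_koszul_quotient[OF gP])
  \<comment> \<open>All three families are computed inside M with its own projections, which is
    where the exact sequences live. The modules 0 : x and M/xM of the statement are compared with
    them by transfer.\<close>
  define VM where "VM i j = A.vanishes pr (carrier M) {\<zero>\<^bsub>M\<^esub>} (int i) j" for i j
  define VK where "VK i j = A.vanishes pr K {\<zero>\<^bsub>M\<^esub>} (int i) j" for i j
  define VQ where "VQ i j = A.vanishes pr (carrier M) P (int i) j" for i j
  have regM: "regularity R gr M gm = reg_sup VM"
    unfolding VM_def by (rule A.regularity_reg_sup[OF xs_def gm])
  have regK: "regularity R gr (zero_colon M x) (zero_colon_grading M gm x) = reg_sup VK"
  proof -
    have "zero_colon_grading M gm x e = {m \<in> carrier (M\<lparr>carrier := K\<rparr>). pr e m = m}" for e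
      unfolding zero_colon_grading_def eK gm using Kc by auto
    then have "regularity R gr (zero_colon M x) (zero_colon_grading M gm x) =
        reg_sup (\<lambda>i j. B.vanishes pr K {\<zero>\<^bsub>M\<^esub>} (int i) j)"
      using B.regularity_reg_sup[OF xs_def] unfolding eK by simp
    also have "(\<lambda>i j. B.vanishes pr K {\<zero>\<^bsub>M\<^esub>} (int i) j) = VK"
    proof (intro ext)
      fix i j
      have sub: "{m \<in> K. id m \<in> {\<zero>\<^bsub>M\<^esub>}} = {\<zero>\<^bsub>M\<^esub>}" using G.submodule_zero[OF sK] by auto
      \<comment> \<open>The transfer is along the identity map, from K as a module of its own to K
        as a submodule of M.\<close>
      have "B.vanishes pr K {m \<in> K. id m \<in> {\<zero>\<^bsub>M\<^esub>}} (int i) j \<longleftrightarrow> A.vanishes pr (id ` K) {\<zero>\<^bsub>M\<^esub>} (int i) j"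
      proof (rule vanishes_transfer[OF B.graded_koszul_axioms A.graded_koszul_axioms])
        show "submodule K R (M\<lparr>carrier := K\<rparr>)" using B.carrier_is_submodule by simp
        show "pr e m \<in> K" if "m \<in> K" for e m using G.graded_subD(2)[OF gK that] .
      qed (use Kc in auto)
      then show "B.vanishes pr K {\<zero>\<^bsub>M\<^esub>} (int i) j = VK i j" unfolding sub VK_def by simp
    qed
    finally show ?thesis .
  qed
  have qc: "carrier Q = (\<lambda>m. P +>\<^bsub>M\<^esub> m) ` carrier M"
    using G.quotient_carrier[OF sP] unfolding Q_def by blast
  have qz: "\<zero>\<^bsub>Q\<^esub> = P" unfolding Q_def by (rule G.quotient_zero[OF sP])
  \<comment> \<open>Stated for arbitrary compatible projections, because it is used twice: with the
    grading for the regularity, and with identities for the depth.\<close>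
  have VQ_transfer: "C.vanishes prQ (carrier Q) {\<zero>\<^bsub>Q\<^esub>} p j \<longleftrightarrow> A.vanishes pr' (carrier M) P p j"
    if "graded_koszul R M xs pr'" "graded_koszul R Q xs prQ"
      "\<And>e m. m \<in> carrier M \<Longrightarrow> P +>\<^bsub>M\<^esub> pr' e m = prQ e (P +>\<^bsub>M\<^esub> m)"
      "\<And>e m. m \<in> carrier M \<Longrightarrow> pr' e m \<in> carrier M" for pr' prQ p j
  proof -
    have sub: "{m \<in> carrier M. P +>\<^bsub>M\<^esub> m \<in> {P}} = P"
      using G.coset_eq_self_iff[OF sP] G.submodule_carrier[OF sP] by auto
    have "A.vanishes pr' (carrier M) {m \<in> carrier M. P +>\<^bsub>M\<^esub> m \<in> {P}} p j \<longleftrightarrow>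
        C.vanishes prQ ((\<lambda>m. P +>\<^bsub>M\<^esub> m) ` carrier M) {P} p j"
    proof (rule vanishes_transfer[OF that(1,2)])
      show "P +>\<^bsub>M\<^esub> m \<in> carrier Q" if "m \<in> carrier M" for m
        using G.coset_in_quotient[OF sP that] by (simp add: Q_def)
      show "P +>\<^bsub>M\<^esub> (m \<oplus>\<^bsub>M\<^esub> n) = (P +>\<^bsub>M\<^esub> m) \<oplus>\<^bsub>Q\<^esub> (P +>\<^bsub>M\<^esub> n)" if "m \<in> carrier M" "n \<in> carrier M" for m n
        using G.quotient_add[OF sP that] by (simp add: Q_def)
      show "P +>\<^bsub>M\<^esub> (r \<odot>\<^bsub>M\<^esub> m) = r \<odot>\<^bsub>Q\<^esub> (P +>\<^bsub>M\<^esub> m)" if "r \<in> carrier R" "m \<in> carrier M" for r m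
        using G.quotient_smult[OF sP that(2,1)] by (simp add: Q_def)
      show "submodule (carrier M) R M" by (rule G.carrier_is_submodule)
    qed (use that(3,4) in auto)
    then show ?thesis unfolding sub qc qz by simp
  qed
  have regQ: "regularity R gr (mod_elt R M x) (mod_elt_grading M gm x) = reg_sup VQ"
  proof -
    have "quotient_grading M gm P e = {U \<in> carrier Q. G.quotient_proj P pr e U = U}" for e
    proof (intro equalityI subsetI)
      fix U assume "U \<in> quotient_grading M gm P e"
      then obtain m where m: "m \<in> carrier M" "pr e m = m" "U = P +>\<^bsub>M\<^esub> m"
        unfolding quotient_grading_def gm by auto
      then show "U \<in> {U \<in> carrier Q. G.quotient_proj P pr e U = U}"
        using G.quotient_proj_coset[OF sP A.proj gP m(1), of e] qc by simp
    next
      fix U assume U: "U \<in> {U \<in> carrier Q. G.quotient_proj P pr e U = U}"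
      then obtain m where m: "m \<in> carrier M" "U = P +>\<^bsub>M\<^esub> m" using qc by auto
      have "U = P +>\<^bsub>M\<^esub> pr e m" using U m G.quotient_proj_coset[OF sP A.proj gP m(1), of e] by simp
      moreover have "pr e m \<in> gm e" unfolding gm using G.grading_projD[OF A.proj m(1)] by simp
      ultimately show "U \<in> quotient_grading M gm P e" unfolding quotient_grading_def by blast
    qed
    then have "regularity R gr (mod_elt R M x) (mod_elt_grading M gm x) =
        reg_sup (\<lambda>i j. C.vanishes (G.quotient_proj P pr) (carrier Q) {\<zero>\<^bsub>Q\<^esub>} (int i) j)"
      using C.regularity_reg_sup[OF xs_def] unfolding eQ by simp
    also have "(\<lambda>i j. C.vanishes (G.quotient_proj P pr) (carrier Q) {\<zero>\<^bsub>Q\<^esub>} (int i) j) = VQ"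
      unfolding VQ_def
      by (intro ext VQ_transfer A.graded_koszul_axioms C.graded_koszul_axioms)
        (simp_all add: G.quotient_proj_coset[OF sP A.proj gP] G.grading_projD[OF A.proj])
    finally show ?thesis .
  qed
  \<comment> \<open>The only use of the hypothesis on depth and dimension. Either \<open>i\<close>
    exceeds the dimension of K, or i - 2 lies below the depth of M/xM. In both cases the vanishing
    is ungraded and holds in all internal degrees.\<close>
  have vanish: "VK i j \<or> (\<forall>q j'. i = Suc (Suc q) \<longrightarrow> VQ q j')" for i j
  proof (cases "ereal (real i) \<le> module_dim R (M\<lparr>carrier := K\<rparr>)")
    case False
    then have "A.vanishes_ungraded K {\<zero>\<^bsub>M\<^esub>} (int i)" by (rule A.vanishes_ungraded_dim[OF S.standard_graded_acc sK])
    then show ?thesis unfolding VK_def using A.vanishes_ungraded_imp by blast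
  next
    case True
    have "VQ q j'" if i: "i = Suc (Suc q)" for q j'
    proof -
      have "ereal (real q) < module_depth R gr Q"
        using ereal_less_of_le_minus_1 True assms(6) unfolding i eK eQ(1) by blast
      then have "C.vanishes_ungraded (carrier Q) {\<zero>\<^bsub>Q\<^esub>} (int q)" by (rule C.vanishes_ungraded_depth[OF xs(2)])
      then have "A.vanishes_ungraded (carrier M) P (int q)"
        using VQ_transfer[OF A.graded_koszul_ungraded C.graded_koszul_ungraded] by simp
      then show ?thesis unfolding VQ_def by (rule A.vanishes_ungraded_imp)
    qed
    then show ?thesis by blast
  qed
  show ?thesis unfolding regM regK regQ
  proof (rule reg_sup_eq_max[OF assms(5)])
    fix i j
    show "VM i j" if K: "\<And>k::nat. VK i (j + int k * int d)"
      and Q: "\<And>(k::nat) q. i = Suc q \<Longrightarrow> VQ q (j + int k * int d + int d)"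
    proof -
      have "A.vanishes pr (carrier M) P (int i - 1) (j + int k * int d + int d)" for k :: nat
      proof (cases i)
        \<comment> \<open>The cokernel term then sits in cohomological degree -1, where there are no
          cochains.\<close>
        case 0
        then show ?thesis unfolding A.vanishes_def A.is_coboundary_def by (simp add: A.idx_neg)
      next
        case (Suc q)
        then show ?thesis using Q[of q k] by (simp add: VQ_def)
      qed
      then show ?thesis
        using A.vanishes_module_from_ends[OF hx xI, of "int i" j] K unfolding VM_def VK_def K_def P_def by blast
    qed
    show "VK i j" if M: "VM i j" "\<And>q. i = Suc q \<Longrightarrow> VM q (j + int d)"
    proof (cases "VK i j")
      case False
      \<comment> \<open>If H^i(K)_j is not known to vanish, the dichotomy removes the source of the
        obstruction, and the exact sequences apply.\<close>
      then have Q: "VQ q j'" if "i = Suc (Suc q)" for q j' using vanish[of i j] that by blast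
      have neg: "A.vanishes pr L N p j'" if "p < 0" for L N p j'
        unfolding A.vanishes_def A.is_coboundary_def using that by (simp add: A.idx_neg)
      have "A.vanishes pr (carrier M) {\<zero>\<^bsub>M\<^esub>} (int i - 1) (j + int d)"
        using M(2) neg[of "int i - 1"] by (cases i) (auto simp: VM_def)
      moreover have "A.vanishes pr (carrier M) P (int i - 2) (j + int d)"
      proof (cases "i < 2")
        case True
        then show ?thesis by (intro neg) simp
      next
        case False
        then obtain q where q: "i = Suc (Suc q)" by (metis add_2_eq_Suc le_Suc_ex not_less)
        then show ?thesis using Q[OF q] by (simp add: VQ_def)
      qed
      ultimately show ?thesis
        using A.vanishes_kernel[OF hx, of "int i" j] M(1) unfolding VM_def VK_def K_def P_def by blast
    qed
    show "VQ i j" if "VM i j" "VM (i + 1) (j - int d)" "VK (i + 2) (j - int d)"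
      using A.vanishes_cokernel[OF hx, of "int i" j] that unfolding VM_def VK_def VQ_def K_def P_def
      by (simp add: add.commute)
  qed
qed

end
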